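(* Let $f\colon M\to\mathbb{R}^4$ be an affine hypersphere with the null-direction $\mathcal{D}^-$ and a $\widetilde{J}$-tangent Blaschke field $C$. Then, locally (around every point of $M$), there exist an open interval $I\subset\mathbb{R}$, smooth planar curves $\alpha\colon I\to\mathbb{R}^2$, $\beta\colon I\to\mathbb{R}^2$ with the property $$\det[\alpha,\alpha']\cdot\det[\beta,\beta']\neq0,\qquad(1)$$ a smooth function $A\colon I\to\mathbb{R}$, and a non-zero constant $E$ such that $f$ can be expressed (in suitable local coordinates $(x,y,z)$) in the form $$f(x,y,z)=\widetilde{J}g(x,y)\cosh z-g(x,y)\sinh z,\qquad(2)$$ where $g(x,y)=(y+A(x))\cdot(\alpha,-\alpha)(x)+B(x)(\alpha',-\alpha')(x)+(\beta,\beta)(x)$ and $$B(x)=\frac{E}{\sqrt{|\det[\alpha(x),\alpha'(x)]\cdot\det[\beta(x),\beta'(x)]|}}.$$ Moreover, for any smooth curves $\alpha,\beta\colon I\to\mathbb{R}^2$ on an open interval $I$ satisfying (1), any smooth function $A\colon I\to\mathbb{R}$ and any non-zero constant $E$, the function $f$ given by (2) (with $g(x,y)=(y+A(x))\cdot(\alpha,-\alpha)(x)+B(x)(\alpha',-\alpha')(x)+(\beta,\beta)(x)$ and $B(x)=E/\sqrt{|\det[\alpha(x),\alpha'(x)]\cdot\det[\beta(x),\beta'(x)]|}$, $(x,y,z)\in I\times\mathbb{R}\times\mathbb{R}$) is a $\widetilde{J}$-tangent affine hypersphere with the null-direction $\mathcal{D}^-$.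
   Context: All objects are smooth. $M$ is a connected, orientable $3$-dimensional manifold and $f\colon M\to\mathbb{R}^4$ is an immersion (hypersurface), assumed nondegenerate; $D$ is the standard flat connection on $\mathbb{R}^4$. For a transversal vector field $C$ along $f$, the formulas $D_Xf_*Y=f_*(\nabla_XY)+h(X,Y)C$ and $D_XC=-f_*(SX)+\tau(X)C$ define the torsion-free connection $\nabla$, the second fundamental form $h$, the shape operator $S$ and the transversal connection form $\tau$. $f$ is nondegenerate if $h$ is nondegenerate (this does not depend on $C$). The induced volume element of $C$ is $\Theta(X_1,X_2,X_3)=\det[f_*X_1,f_*X_2,f_*X_3,C]$; the metric volume form is $\omega_h(X_1,X_2,X_3)=|\det[h(X_i,X_j)]|^{1/2}$ for bases positively oriented relative to $\Theta$. For nondegenerate $f$ the Blaschke field is the transversal field, unique up to sign, with $\tau=0$ and $\omega_h=\Theta$. $f$ is an affine hypersphere if the shape operator of its Blaschke field is $S=\lambda\,\mathrm{I}$ with $\lambda$ constant. The para-complex structure on $\mathbb{R}^4$ is $\widetilde{J}(x_1,x_2,y_1,y_2)=(y_1,y_2,x_1,x_2)$. A transversal field $C$ is $\widetilde{J}$-tangent if $\widetilde{J}C_x\in f_*(T_xM)$ for every $x\in M$. A $\widetilde{J}$-tangent affine hypersphere is an affine hypersphere whose Blaschke field is $\widetilde{J}$-tangent. The distribution $\mathcal{D}$ is the biggest $\widetilde{J}$-invariant distribution on $M$: $\mathcal{D}_x=f_*^{-1}\big(f_*(T_xM)\cap\widetilde{J}(f_*(T_xM))\big)$; when a $\widetilde{J}$-tangent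 transversal field exists it has rank $2$. $\mathcal{D}^{\pm}=\{v\in\mathcal{D}: \widetilde{J}f_*v=\pm f_*v\}$; these are $1$-dimensional distributions with $\mathcal{D}=\mathcal{D}^+\oplus\mathcal{D}^-$. A $1$-dimensional smooth distribution $\mathcal{A}\subset TM$ is a null-direction for $f$ if $h_x(v,v)=0$ for every $x\in M$ and $v\in\mathcal{A}_x$. For planar curves $\mu,\nu$, $(\mu,\nu)$ denotes the curve $(\mu_1,\mu_2,\nu_1,\nu_2)$ in $\mathbb{R}^4$.
   Formalization: In the first part the form (2) is proved for f − p₀, where p₀ is the centre of the hypersphere (C = r(f − p₀), r constant), instead of for f itself; as stated the claim fails for translates of (2), and p₀ = 0 when the centre is the origin. *)

theory Defs
  imports "HOL-Analysis.Analysis"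
begin

section \<open>Smooth maps\<close>

text \<open>Meant for open \<^term>\<open>S\<close> in a finite-dimensional space, where differentiability of all
  directional derivatives of all orders is the usual \<open>C\<^sup>\<infinity>\<close> condition.\<close>

primrec Ck_on :: "nat \<Rightarrow> ('a::real_normed_vector \<Rightarrow> 'b::real_normed_vector) \<Rightarrow> 'a set \<Rightarrow> bool" where
  "Ck_on 0 f S \<longleftrightarrow> continuous_on S f"
| "Ck_on (Suc k) f S \<longleftrightarrow>
     (\<forall>x\<in>S. f differentiable (at x)) \<and> (\<forall>v. Ck_on k (\<lambda>x. frechet_derivative f (at x) v) S)"

definition smooth_on :: "'a::real_normed_vector set \<Rightarrow> ('a \<Rightarrow> 'b::real_normed_vector) \<Rightarrow> bool" where
  "smooth_on S f \<longleftrightarrow> (\<forall>k. Ck_on k f S)"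


section \<open>Smooth 3-manifolds\<close>

text \<open>The manifold is the topological space \<^term>\<open>X\<close> with a (not necessarily maximal) smooth atlas.
  A chart is its domain together with the coordinate map (junk outside the domain).\<close>

type_synonym 'm chart = "'m set \<times> ('m \<Rightarrow> real^3)"

definition chart_range :: "'m chart \<Rightarrow> (real^3) set" where
  "chart_range c = snd c ` fst c"

definition is_chart :: "'m topology \<Rightarrow> 'm chart \<Rightarrow> bool" where
  "is_chart X c \<longleftrightarrow> openin X (fst c) \<and> open (chart_range c) \<and>
     homeomorphic_map (subtopology X (fst c)) (top_of_set (chart_range c)) (snd c)"

definition local_rep :: "'m chart \<Rightarrow> ('m \<Rightarrow> 'b) \<Rightarrow> real^3 \<Rightarrow> 'b" where
  "local_rep c f = f \<circ> inv_into (fst c) (snd c)"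

text \<open>The transition map from \<^term>\<open>c\<close> to \<^term>\<open>c'\<close> is \<^term>\<open>local_rep c (snd c')\<close>, on the set
  \<^term>\<open>overlap c c'\<close>.\<close>

definition overlap :: "'m chart \<Rightarrow> 'm chart \<Rightarrow> (real^3) set" where
  "overlap c c' = snd c ` (fst c \<inter> fst c')"

definition compatible :: "'m chart \<Rightarrow> 'm chart \<Rightarrow> bool" where
  "compatible c c' \<longleftrightarrow> smooth_on (overlap c c') (local_rep c (snd c')) \<and>
     smooth_on (overlap c' c) (local_rep c' (snd c))"

definition smooth_atlas :: "'m topology \<Rightarrow> 'm chart set \<Rightarrow> bool" where
  "smooth_atlas X \<A> \<longleftrightarrow> (\<forall>c\<in>\<A>. is_chart X c) \<and> (\<Union>c\<in>\<A>. fst c) = topspace X \<and>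
     (\<forall>c\<in>\<A>. \<forall>c'\<in>\<A>. compatible c c')"

definition coordinate_chart :: "'m topology \<Rightarrow> 'm chart set \<Rightarrow> 'm chart \<Rightarrow> bool" where
  "coordinate_chart X \<A> c \<longleftrightarrow> is_chart X c \<and> (\<forall>c'\<in>\<A>. compatible c c')"

definition orientable :: "'m topology \<Rightarrow> 'm chart set \<Rightarrow> bool" where
  "orientable X \<A> \<longleftrightarrow>
     (\<exists>\<B>. smooth_atlas X \<B> \<and> (\<forall>c\<in>\<B>. coordinate_chart X \<A> c) \<and>
       (\<forall>c\<in>\<B>. \<forall>c'\<in>\<B>. \<forall>u\<in>overlap c c'.
          det (matrix (frechet_derivative (local_rep c (snd c')) (at u))) > 0))"

definition connected_orientable_3manifold :: "'m topology \<Rightarrow> 'm chart set \<Rightarrow> bool" where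
  "connected_orientable_3manifold X \<A> \<longleftrightarrow>
     Hausdorff_space X \<and> second_countable X \<and> connected_space X \<and> smooth_atlas X \<A> \<and> orientable X \<A>"


section \<open>Hypersurfaces in a coordinate domain\<close>

text \<open>Here \<^term>\<open>V\<close> is an open subset of \<open>\<real>\<^sup>3\<close>, \<^term>\<open>F\<close> the hypersurface and \<^term>\<open>C\<close> a vector field
  along it. Tangent vectors are elements of \<open>\<real>\<^sup>3\<close>, and vector fields are functions
  from \<open>\<real>\<^sup>3\<close> to \<open>\<real>\<^sup>3\<close>.\<close>

definition push :: "(real^3 \<Rightarrow> real^4) \<Rightarrow> real^3 \<Rightarrow> real^3 \<Rightarrow> real^4" where
  "push F u = frechet_derivative F (at u)"

definition immersion_on :: "(real^3) set \<Rightarrow> (real^3 \<Rightarrow> real^4) \<Rightarrow> bool" where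
  "immersion_on V F \<longleftrightarrow> smooth_on V F \<and> (\<forall>u\<in>V. inj (push F u))"

definition transversal_on :: "(real^3) set \<Rightarrow> (real^3 \<Rightarrow> real^4) \<Rightarrow> (real^3 \<Rightarrow> real^4) \<Rightarrow> bool" where
  "transversal_on V F C \<longleftrightarrow> smooth_on V C \<and> (\<forall>u\<in>V. C u \<notin> range (push F u))"

text \<open>The components of \<open>w \<in> \<real>\<^sup>4\<close> with respect to the splitting of \<open>\<real>\<^sup>4\<close> into the tangent space
  at \<^term>\<open>u\<close> and the line spanned by \<^term>\<open>C u\<close>.\<close>

definition tangential_part ::
  "(real^3 \<Rightarrow> real^4) \<Rightarrow> (real^3 \<Rightarrow> real^4) \<Rightarrow> real^3 \<Rightarrow> real^4 \<Rightarrow> real^3" where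
  "tangential_part F C u w = (THE v. \<exists>a. w = push F u v + a *\<^sub>R C u)"

definition transversal_part ::
  "(real^3 \<Rightarrow> real^4) \<Rightarrow> (real^3 \<Rightarrow> real^4) \<Rightarrow> real^3 \<Rightarrow> real^4 \<Rightarrow> real" where
  "transversal_part F C u w = (THE a. \<exists>v. w = push F u v + a *\<^sub>R C u)"

text \<open>The flat connection on fields along \<^term>\<open>F\<close>.\<close>

definition flat_D :: "(real^3 \<Rightarrow> real^3) \<Rightarrow> (real^3 \<Rightarrow> real^4) \<Rightarrow> real^3 \<Rightarrow> real^4" where
  "flat_D Y \<xi> u = frechet_derivative \<xi> (at u) (Y u)"

definition second_fundamental_form ::
  "(real^3 \<Rightarrow> real^4) \<Rightarrow> (real^3 \<Rightarrow> real^4) \<Rightarrow> (real^3 \<Rightarrow> real^3) \<Rightarrow> (real^3 \<Rightarrow> real^3) \<Rightarrow> real^3 \<Rightarrow> real" where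
  "second_fundamental_form F C Y Z u = transversal_part F C u (flat_D Y (\<lambda>q. push F q (Z q)) u)"

text \<open>The tangential part of the same vector is the induced connection, which is not needed here.
  As the second fundamental form is tensorial, its value on tangent vectors may be computed
  with their constant extensions in the coordinates; likewise for \<open>S\<close> and \<open>\<tau>\<close> below.\<close>

definition h_at ::
  "(real^3 \<Rightarrow> real^4) \<Rightarrow> (real^3 \<Rightarrow> real^4) \<Rightarrow> real^3 \<Rightarrow> real^3 \<Rightarrow> real^3 \<Rightarrow> real" where
  "h_at F C u v w = second_fundamental_form F C (\<lambda>_. v) (\<lambda>_. w) u"

definition shape_operator ::
  "(real^3 \<Rightarrow> real^4) \<Rightarrow> (real^3 \<Rightarrow> real^4) \<Rightarrow> real^3 \<Rightarrow> real^3 \<Rightarrow> real^3" where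
  "shape_operator F C u v = - tangential_part F C u (flat_D (\<lambda>_. v) C u)"

definition transversal_connection_form ::
  "(real^3 \<Rightarrow> real^4) \<Rightarrow> (real^3 \<Rightarrow> real^4) \<Rightarrow> real^3 \<Rightarrow> real^3 \<Rightarrow> real" where
  "transversal_connection_form F C u v = transversal_part F C u (flat_D (\<lambda>_. v) C u)"

text \<open>Nondegeneracy of \<open>h\<close> does not depend on the transversal field used to define it.\<close>

definition nondegenerate_on :: "(real^3) set \<Rightarrow> (real^3 \<Rightarrow> real^4) \<Rightarrow> bool" where
  "nondegenerate_on V F \<longleftrightarrow>
     (\<exists>C. transversal_on V F C \<and> (\<forall>u\<in>V. \<forall>v. (\<forall>w. h_at F C u v w = 0) \<longrightarrow> v = 0))"

text \<open>In the next two definitions \<^term>\<open>T\<close> is the triple of tangent vectors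
  \<^term>\<open>T$1\<close>, \<^term>\<open>T$2\<close>, \<^term>\<open>T$3\<close>.\<close>

definition induced_volume ::
  "(real^3 \<Rightarrow> real^4) \<Rightarrow> (real^3 \<Rightarrow> real^4) \<Rightarrow> real^3 \<Rightarrow> real^3^3 \<Rightarrow> real" where
  "induced_volume F C u T =
     det (vector [push F u (T$1), push F u (T$2), push F u (T$3), C u] :: real^4^4)"

text \<open>The value of \<open>\<omega>\<^sub>h\<close> on bases \<^term>\<open>T\<close> positively oriented relative to \<open>\<Theta>\<close>.\<close>

definition metric_volume ::
  "(real^3 \<Rightarrow> real^4) \<Rightarrow> (real^3 \<Rightarrow> real^4) \<Rightarrow> real^3 \<Rightarrow> real^3^3 \<Rightarrow> real" where
  "metric_volume F C u T = sqrt \<bar>det (\<chi> i j. h_at F C u (T$i) (T$j))\<bar>"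

definition blaschke_on :: "(real^3) set \<Rightarrow> (real^3 \<Rightarrow> real^4) \<Rightarrow> (real^3 \<Rightarrow> real^4) \<Rightarrow> bool" where
  "blaschke_on V F C \<longleftrightarrow> transversal_on V F C \<and>
     (\<forall>u\<in>V. \<forall>v. transversal_connection_form F C u v = 0) \<and>
     (\<forall>u\<in>V. \<forall>T. induced_volume F C u T > 0 \<longrightarrow> metric_volume F C u T = induced_volume F C u T)"


section \<open>Affine hyperspheres\<close>

definition nondegenerate_hypersurface :: "'m topology \<Rightarrow> 'm chart set \<Rightarrow> ('m \<Rightarrow> real^4) \<Rightarrow> bool" where
  "nondegenerate_hypersurface X \<A> f \<longleftrightarrow> connected_orientable_3manifold X \<A> \<and>
     (\<forall>c\<in>\<A>. immersion_on (chart_range c) (local_rep c f) \<and>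
            nondegenerate_on (chart_range c) (local_rep c f))"

definition blaschke_field :: "'m chart set \<Rightarrow> ('m \<Rightarrow> real^4) \<Rightarrow> ('m \<Rightarrow> real^4) \<Rightarrow> bool" where
  "blaschke_field \<A> f C \<longleftrightarrow> (\<forall>c\<in>\<A>. blaschke_on (chart_range c) (local_rep c f) (local_rep c C))"

definition affine_hypersphere ::
  "'m topology \<Rightarrow> 'm chart set \<Rightarrow> ('m \<Rightarrow> real^4) \<Rightarrow> ('m \<Rightarrow> real^4) \<Rightarrow> bool" where
  "affine_hypersphere X \<A> f C \<longleftrightarrow> nondegenerate_hypersurface X \<A> f \<and> blaschke_field \<A> f C \<and>
     (\<exists>l. \<forall>c\<in>\<A>. \<forall>u\<in>chart_range c. \<forall>v. shape_operator (local_rep c f) (local_rep c C) u v = l *\<^sub>R v)"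

text \<open>The point \<^term>\<open>p\<^sub>0\<close> is the centre of the hypersphere: \<open>C = r (f - p\<^sub>0)\<close> with \<open>r\<close> constant.\<close>

definition is_centre :: "'m topology \<Rightarrow> ('m \<Rightarrow> real^4) \<Rightarrow> ('m \<Rightarrow> real^4) \<Rightarrow> real^4 \<Rightarrow> bool" where
  "is_centre X f C p\<^sub>0 \<longleftrightarrow> (\<exists>r. \<forall>p\<in>topspace X. C p = r *\<^sub>R (f p - p\<^sub>0))"


section \<open>The para-complex structure\<close>

definition J :: "real^4 \<Rightarrow> real^4" where
  "J w = vector [w$3, w$4, w$1, w$2]"

definition J_tangent :: "'m chart set \<Rightarrow> ('m \<Rightarrow> real^4) \<Rightarrow> ('m \<Rightarrow> real^4) \<Rightarrow> bool" where
  "J_tangent \<A> f C \<longleftrightarrow>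
     (\<forall>c\<in>\<A>. \<forall>u\<in>chart_range c. J (local_rep c C u) \<in> range (push (local_rep c f) u))"

definition J_tangent_affine_hypersphere :: "'m topology \<Rightarrow> 'm chart set \<Rightarrow> ('m \<Rightarrow> real^4) \<Rightarrow> bool" where
  "J_tangent_affine_hypersphere X \<A> f \<longleftrightarrow> (\<exists>C. affine_hypersphere X \<A> f C \<and> J_tangent \<A> f C)"

text \<open>A distribution on the manifold is given by its representations in the charts of the atlas.\<close>

type_synonym 'm distribution = "'m chart \<Rightarrow> real^3 \<Rightarrow> (real^3) set"

definition line_distribution :: "'m chart set \<Rightarrow> 'm distribution \<Rightarrow> bool" where
  "line_distribution \<A> \<D> \<longleftrightarrow>
     (\<forall>c\<in>\<A>. \<forall>c'\<in>\<A>. \<forall>u\<in>overlap c c'.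
        frechet_derivative (local_rep c (snd c')) (at u) ` \<D> c u = \<D> c' (local_rep c (snd c') u)) \<and>
     (\<forall>c\<in>\<A>. \<forall>u\<in>chart_range c. \<exists>W Y. open W \<and> u \<in> W \<and> W \<subseteq> chart_range c \<and> smooth_on W Y \<and>
        (\<forall>w\<in>W. Y w \<noteq> (0::real^3) \<and> \<D> c w = span {Y w}))"

text \<open>As for nondegeneracy, the choice of the transversal field is immaterial: another choice
  multiplies \<open>h\<close> by a nowhere vanishing function.\<close>

definition null_direction :: "'m chart set \<Rightarrow> ('m \<Rightarrow> real^4) \<Rightarrow> 'm distribution \<Rightarrow> bool" where
  "null_direction \<A> f \<D> \<longleftrightarrow> line_distribution \<A> \<D> \<and>
     (\<forall>c\<in>\<A>. \<exists>C. transversal_on (chart_range c) (local_rep c f) C \<and>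
        (\<forall>u\<in>chart_range c. \<forall>v\<in>\<D> c u. h_at (local_rep c f) C u v v = 0))"

definition D_dist :: "('m \<Rightarrow> real^4) \<Rightarrow> 'm distribution" where
  "D_dist f c u =
     push (local_rep c f) u -` (range (push (local_rep c f) u) \<inter> J ` range (push (local_rep c f) u))"

definition D_minus :: "('m \<Rightarrow> real^4) \<Rightarrow> 'm distribution" where
  "D_minus f c u = {v \<in> D_dist f c u. J (push (local_rep c f) u v) = - push (local_rep c f) u v}"


section \<open>The parametrisation\<close>

definition det2 :: "real^2 \<Rightarrow> real^2 \<Rightarrow> real" where
  "det2 a b = det (vector [a, b] :: real^2^2)"

definition join :: "real^2 \<Rightarrow> real^2 \<Rightarrow> real^4" where
  "join \<mu> \<nu> = vector [\<mu>$1, \<mu>$2, \<nu>$1, \<nu>$2]"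

definition deriv_curve :: "(real \<Rightarrow> real^2) \<Rightarrow> real \<Rightarrow> real^2" where
  "deriv_curve \<mu> x = vector_derivative \<mu> (at x)"

definition B_fun :: "(real \<Rightarrow> real^2) \<Rightarrow> (real \<Rightarrow> real^2) \<Rightarrow> real \<Rightarrow> real \<Rightarrow> real" where
  "B_fun \<alpha> \<beta> E x =
     E / sqrt \<bar>det2 (\<alpha> x) (deriv_curve \<alpha> x) * det2 (\<beta> x) (deriv_curve \<beta> x)\<bar>"

definition g_map ::
  "(real \<Rightarrow> real^2) \<Rightarrow> (real \<Rightarrow> real^2) \<Rightarrow> (real \<Rightarrow> real) \<Rightarrow> real \<Rightarrow> real \<Rightarrow> real \<Rightarrow> real^4" where
  "g_map \<alpha> \<beta> A E x y =
     (y + A x) *\<^sub>R join (\<alpha> x) (- \<alpha> x)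
     + B_fun \<alpha> \<beta> E x *\<^sub>R join (deriv_curve \<alpha> x) (- deriv_curve \<alpha> x)
     + join (\<beta> x) (\<beta> x)"

definition f_map ::
  "(real \<Rightarrow> real^2) \<Rightarrow> (real \<Rightarrow> real^2) \<Rightarrow> (real \<Rightarrow> real) \<Rightarrow> real \<Rightarrow> real^3 \<Rightarrow> real^4" where
  "f_map \<alpha> \<beta> A E v =
     cosh (v$3) *\<^sub>R J (g_map \<alpha> \<beta> A E (v$1) (v$2)) - sinh (v$3) *\<^sub>R g_map \<alpha> \<beta> A E (v$1) (v$2)"

definition admissible ::
  "real set \<Rightarrow> (real \<Rightarrow> real^2) \<Rightarrow> (real \<Rightarrow> real^2) \<Rightarrow> (real \<Rightarrow> real) \<Rightarrow> real \<Rightarrow> bool" where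
  "admissible I \<alpha> \<beta> A E \<longleftrightarrow> open I \<and> is_interval I \<and> I \<noteq> {} \<and>
     smooth_on I \<alpha> \<and> smooth_on I \<beta> \<and> smooth_on I A \<and> E \<noteq> 0 \<and>
     (\<forall>x\<in>I. det2 (\<alpha> x) (deriv_curve \<alpha> x) * det2 (\<beta> x) (deriv_curve \<beta> x) \<noteq> 0)"

definition slab :: "real set \<Rightarrow> (real^3) set" where
  "slab I = {v. v$1 \<in> I}"

end

theory Submission
  imports Defs
begin

text \<open>Split \<open>\<real>\<^sup>4\<close> into the eigenspaces of \<open>J\<close> by \<open>w = PQ P Q = (P + Q, P - Q)\<close>, so that
  \<open>J (PQ P Q) = PQ P (- Q)\<close>. In this splitting the parametrisation of the theorem becomes
  \<open>PQ (e\<^sup>-\<^sup>z p(x)) (e\<^sup>z (y q(x) + n(x)))\<close> with \<open>p = \<beta>\<close>, \<open>q = - \<alpha>\<close>, \<open>n = - (A \<alpha> + B \<alpha>')\<close>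
  (\<open>f_map_eq_ruled\<close>): the coordinate \<open>z\<close> follows the flow of \<open>- J\<close>, and over a fixed first component
  the second one runs along a straight line, in the direction of \<open>\<D>\<^sup>-\<close>.

  Such a ruled map \<open>F\<close> is its own second \<open>z\<close>-derivative, and its \<open>yy\<close>- and \<open>yz\<close>-derivatives are
  tangent. Hence for a field \<open>C = r F\<close> one has \<open>\<tau> = 0\<close>, \<open>S = - r I\<close> and \<open>det h = - a\<^sup>2 / r\<close>, where
  \<open>a\<close> is the \<open>xy\<close>-entry of \<open>h\<close>. The two volume elements agree if and only if
  \<open>det(q, q')\<^sup>2 = 256 \<bar>r\<bar>\<^sup>5 det(p, p')\<^sup>2 det(q, n)\<^sup>4\<close> (\<open>volume_condition_F\<close>). For the parametrised maps
  \<open>det(q, n) = B det(\<alpha>, \<alpha>')\<close>, and the formula for \<open>B\<close> turns this into \<open>256 \<bar>r\<bar>\<^sup>5 E\<^sup>4 = 1\<close>, which is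
  solved by some \<open>r > 0\<close>. That is the second half of the theorem (\<open>parametrised_hypersphere\<close>).

  Conversely, let \<open>S = \<lambda> I\<close>. If \<open>\<lambda>\<close> were \<open>0\<close>, the tangent field \<open>JC\<close> would be parallel in \<open>\<real>\<^sup>4\<close> and
  therefore lie in the kernel of \<open>h\<close> (\<open>J_tangent_sphere_proper\<close>). So \<open>\<lambda> \<noteq> 0\<close>, and as \<open>C + \<lambda> f\<close> is constant,
  \<open>C = r (f - p\<^sub>0)\<close> with \<open>r = - \<lambda>\<close> (\<open>hypersphere_centre\<close>). Write \<open>f - p\<^sub>0 = PQ P Q\<close>. Near a point take
  coordinates \<open>x, z\<close> in the plane of \<open>P\<close> with \<open>P = e\<^sup>-\<^sup>z \<beta>(x)\<close> for a straight line \<open>\<beta>\<close>, put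
  \<open>W = e\<^sup>-\<^sup>z Q\<close>, and complete them by \<open>y = l \<bullet> W\<close> for a vector \<open>l\<close> that is not orthogonal to the
  null direction. The tangent vectors with vanishing first component are the multiples of \<open>f\<^sub>y\<close>.
  Because \<open>J (f - p\<^sub>0)\<close> is tangent, \<open>W\<^sub>z\<close> is a multiple of \<open>W\<^sub>y\<close>; because \<open>\<D>\<^sup>-\<close> is null, so is
  \<open>W\<^sub>y\<^sub>y\<close>. But \<open>l\<close> is orthogonal to both and \<open>l \<bullet> W\<^sub>y = 1\<close>, so both vanish and \<open>W = y q(x) + n(x)\<close>.
  Expanding \<open>n\<close> in the basis \<open>q, q'\<close> yields \<open>A\<close> and \<open>B\<close>, and the relation above determines \<open>B\<close> up to
  the constant \<open>E\<close> (\<open>ruled_eq_f_map\<close>, \<open>local_normal_form\<close>).\<close>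


section \<open>Calculus of smooth maps\<close>

text \<open>Basic rules for \<^const>\<open>Ck_on\<close>, by induction on the order. Over an open set the Frechet derivatives
  that occur in its definition may be replaced by any derivative at hand.\<close>

lemma Ck_on_cong:
  assumes "open S" "\<And>x. x \<in> S \<Longrightarrow> f x = g x"
  shows "Ck_on k f S \<longleftrightarrow> Ck_on k g S"
  using assms(2)
proof (induction k arbitrary: f g)
  case 0
  then show ?case by (simp cong: continuous_on_cong)
next
  case (Suc k)
  have tr: "(f has_derivative D) (at x) \<longleftrightarrow> (g has_derivative D) (at x)" if "x \<in> S" for x D
    using has_derivative_transform_within_open[OF _ assms(1) that] Suc.prems by metis
  have "frechet_derivative f (at x) = frechet_derivative g (at x)" if "x \<in> S" for x
    using tr[OF that] by (simp add: frechet_derivative_def)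
  then have "Ck_on k (\<lambda>x. frechet_derivative f (at x) v) S = Ck_on k (\<lambda>x. frechet_derivative g (at x) v) S" for v
    by (intro Suc.IH) simp
  then show ?case using tr by (auto simp: differentiable_def)
qed

lemma Ck_on_SucI:
  assumes "open S" "\<And>x. x \<in> S \<Longrightarrow> (f has_derivative f' x) (at x)"
    and "\<And>v. Ck_on k (\<lambda>x. f' x v) S"
  shows "Ck_on (Suc k) f S"
proof -
  have "Ck_on k (\<lambda>x. frechet_derivative f (at x) v) S" for v
    using assms(3)[of v] frechet_derivative_at[OF assms(2)]
    by (subst Ck_on_cong[OF assms(1), of _ "\<lambda>x. f' x v"]) auto
  then show ?thesis using assms(2) by (auto simp: differentiable_def)
qed

lemma Ck_on_SucD:
  assumes "Ck_on (Suc k) f S" "x \<in> S"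
  shows "(f has_derivative frechet_derivative f (at x)) (at x)"
  using assms by (simp add: frechet_derivative_works)

lemma Ck_on_subset: "Ck_on k f S \<Longrightarrow> T \<subseteq> S \<Longrightarrow> Ck_on k f T"
  by (induction k arbitrary: f) (auto intro: continuous_on_subset)

lemma Ck_on_decrease: "Ck_on (Suc k) f S \<Longrightarrow> Ck_on k f S"
proof (induction k arbitrary: f)
  case 0
  then show ?case
    by (auto intro!: continuous_at_imp_continuous_on differentiable_imp_continuous_within)
qed auto

lemma Ck_on_const: "open S \<Longrightarrow> Ck_on k (\<lambda>_. c) S"
proof (induction k arbitrary: c)
  case (Suc k)
  then show ?case by (intro Ck_on_SucI[where f' = "\<lambda>_ _. 0"]) auto
qed auto

lemma Ck_on_bounded_linear:
  assumes "bounded_linear L" "open S" "Ck_on k f S"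
  shows "Ck_on k (\<lambda>x. L (f x)) S"
  using assms(3)
proof (induction k arbitrary: f)
  case 0
  then show ?case using assms(1) by (auto intro: bounded_linear.continuous_on)
next
  case (Suc k)
  show ?case
    by (rule Ck_on_SucI[OF assms(2) bounded_linear.has_derivative[OF assms(1) Ck_on_SucD[OF Suc.prems]]])
      (use Suc in auto)
qed

lemma Ck_on_add:
  assumes "open S" "Ck_on k f S" "Ck_on k g S"
  shows "Ck_on k (\<lambda>x. f x + g x) S"
  using assms(2,3)
proof (induction k arbitrary: f g)
  case 0
  then show ?case by (auto intro: continuous_on_add)
next
  case (Suc k)
  show ?case
    by (rule Ck_on_SucI[OF assms(1) has_derivative_add[OF Ck_on_SucD[OF Suc.prems(1)] Ck_on_SucD[OF Suc.prems(2)]]])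
      (use Suc in auto)
qed

lemma Ck_on_bilinear:
  assumes "bounded_bilinear B" "open S" "Ck_on k f S" "Ck_on k g S"
  shows "Ck_on k (\<lambda>x. B (f x) (g x)) S"
  using assms(3,4)
proof (induction k arbitrary: f g)
  case 0
  then show ?case using assms(1) by (auto intro: bounded_bilinear.continuous_on)
next
  case (Suc k)
  show ?case
    by (rule Ck_on_SucI[OF assms(2) bounded_bilinear.FDERIV[OF assms(1) Ck_on_SucD[OF Suc.prems(1)] Ck_on_SucD[OF Suc.prems(2)]]])
      (use Suc Suc.prems[THEN Ck_on_decrease] in \<open>auto intro!: Ck_on_add[OF assms(2)]\<close>)
qed

lemma Ck_on_sum:
  assumes "open S" "\<And>i. i \<in> I \<Longrightarrow> Ck_on k (f i) S"
  shows "Ck_on k (\<lambda>x. \<Sum>i\<in>I. f i x) S"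
  using assms(2)
  by (induction I rule: infinite_finite_induct) (auto intro: Ck_on_const Ck_on_add assms(1))

lemma Ck_on_prod:
  fixes f :: "'i \<Rightarrow> 'a::real_normed_vector \<Rightarrow> real"
  assumes "open S" "\<And>i. i \<in> I \<Longrightarrow> Ck_on k (f i) S"
  shows "Ck_on k (\<lambda>x. \<Prod>i\<in>I. f i x) S"
  using assms(2)
  by (induction I rule: infinite_finite_induct)
    (auto intro: Ck_on_const Ck_on_bilinear[OF bounded_bilinear_mult] assms(1))

text \<open>In the chain rule the inner derivative is expanded in an orthonormal basis, so that the
  derivative of a composition is a sum of products of functions of lower order.\<close>

lemma Ck_on_compose:
  fixes f :: "'a::real_normed_vector \<Rightarrow> 'b::euclidean_space"
  assumes "open S" "open T" "Ck_on k f S" "Ck_on k g T" "f ` S \<subseteq> T"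
  shows "Ck_on k (\<lambda>x. g (f x)) S"
  using assms(3,4)
proof (induction k arbitrary: g)
  case 0
  then show ?case using assms(5) by (auto intro: continuous_on_compose2)
next
  case (Suc k)
  let ?F = "\<lambda>x. frechet_derivative f (at x)" and ?G = "\<lambda>y. frechet_derivative g (at y)"
  have d: "((\<lambda>x. g (f x)) has_derivative (\<lambda>v. ?G (f x) (?F x v))) (at x)" if "x \<in> S" for x
    using diff_chain_at[OF Ck_on_SucD[OF Suc.prems(1) that] Ck_on_SucD[OF Suc.prems(2)]] that assms(5)
    by (auto simp: o_def)
  have e: "?G (f x) (?F x v) = (\<Sum>b\<in>Basis. (?F x v \<bullet> b) *\<^sub>R ?G (f x) b)" if "x \<in> S" for x v
  proof -
    have l: "linear (?G (f x))"
      using Ck_on_SucD[OF Suc.prems(2)] that assms(5) by (auto intro: has_derivative_linear)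
    show ?thesis
      by (subst euclidean_representation[symmetric, of "?F x v"])
        (simp only: linear_sum[OF l] linear_scale[OF l])
  qed
  have "Ck_on k (\<lambda>x. \<Sum>b\<in>Basis. (?F x v \<bullet> b) *\<^sub>R ?G (f x) b) S" for v
  proof (intro Ck_on_sum Ck_on_bilinear[OF bounded_bilinear_scaleR] assms(1)
        Ck_on_bounded_linear[OF bounded_linear_inner_left])
    show "Ck_on k (\<lambda>x. ?F x v) S" using Suc.prems(1) by simp
    show "Ck_on k (\<lambda>x. ?G (f x) b) S" for b
      using Suc.prems(2) by (intro Suc.IH Ck_on_decrease[OF Suc.prems(1)]) simp
  qed
  then have "Ck_on k (\<lambda>x. ?G (f x) (?F x v)) S" for v
    by (subst Ck_on_cong[OF assms(1) e]) auto
  then show ?case by (intro Ck_on_SucI[OF assms(1) d])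
qed

lemma smooth_on_cong:
  "open S \<Longrightarrow> (\<And>x. x \<in> S \<Longrightarrow> f x = g x) \<Longrightarrow> smooth_on S f \<longleftrightarrow> smooth_on S g"
  unfolding smooth_on_def using Ck_on_cong by blast

lemma smooth_on_subset: "smooth_on S f \<Longrightarrow> T \<subseteq> S \<Longrightarrow> smooth_on T f"
  unfolding smooth_on_def using Ck_on_subset by blast

lemma smooth_on_const [simp]: "open S \<Longrightarrow> smooth_on S (\<lambda>_. c)"
  unfolding smooth_on_def using Ck_on_const by blast

lemma smooth_on_bounded_linear:
  "bounded_linear L \<Longrightarrow> open S \<Longrightarrow> smooth_on S f \<Longrightarrow> smooth_on S (\<lambda>x. L (f x))"
  unfolding smooth_on_def using Ck_on_bounded_linear by blast

lemma smooth_on_id [simp]: "open S \<Longrightarrow> smooth_on S (\<lambda>x. x)"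
  unfolding smooth_on_def
proof
  fix k assume "open S"
  then show "Ck_on k (\<lambda>x. x) S"
    by (cases k) (auto intro!: Ck_on_SucI[where f' = "\<lambda>_ v. v"] Ck_on_const continuous_intros)
qed

lemma smooth_on_linear: "bounded_linear L \<Longrightarrow> open S \<Longrightarrow> smooth_on S L"
  using smooth_on_bounded_linear[OF _ _ smooth_on_id] .

lemma smooth_on_add: "open S \<Longrightarrow> smooth_on S f \<Longrightarrow> smooth_on S g \<Longrightarrow> smooth_on S (\<lambda>x. f x + g x)"
  unfolding smooth_on_def using Ck_on_add by blast

lemma smooth_on_bilinear:
  "bounded_bilinear B \<Longrightarrow> open S \<Longrightarrow> smooth_on S f \<Longrightarrow> smooth_on S g \<Longrightarrow> smooth_on S (\<lambda>x. B (f x) (g x))"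
  unfolding smooth_on_def using Ck_on_bilinear by blast

lemmas smooth_on_mult = smooth_on_bilinear[OF bounded_bilinear_mult]
lemmas smooth_on_scaleR = smooth_on_bilinear[OF bounded_bilinear_scaleR]
lemmas smooth_on_inner = smooth_on_bilinear[OF bounded_bilinear_inner]
lemmas smooth_on_vec_nth = smooth_on_bounded_linear[OF bounded_linear_vec_nth]
lemmas smooth_on_minus = smooth_on_bounded_linear[OF bounded_linear_minus[OF bounded_linear_ident]]

lemma smooth_on_diff: "open S \<Longrightarrow> smooth_on S f \<Longrightarrow> smooth_on S g \<Longrightarrow> smooth_on S (\<lambda>x. f x - g x)"
  using smooth_on_add[of S f "\<lambda>x. - g x"] smooth_on_minus[of S g] by simp

lemma smooth_on_sum:
  "open S \<Longrightarrow> (\<And>i. i \<in> I \<Longrightarrow> smooth_on S (f i)) \<Longrightarrow> smooth_on S (\<lambda>x. \<Sum>i\<in>I. f i x)"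
  unfolding smooth_on_def by (blast intro: Ck_on_sum)

lemma smooth_on_prod:
  fixes f :: "'i \<Rightarrow> 'a::real_normed_vector \<Rightarrow> real"
  shows "open S \<Longrightarrow> (\<And>i. i \<in> I \<Longrightarrow> smooth_on S (f i)) \<Longrightarrow> smooth_on S (\<lambda>x. \<Prod>i\<in>I. f i x)"
  unfolding smooth_on_def by (blast intro: Ck_on_prod)

lemma smooth_on_compose:
  fixes f :: "'a::real_normed_vector \<Rightarrow> 'b::euclidean_space"
  shows "open S \<Longrightarrow> open T \<Longrightarrow> smooth_on S f \<Longrightarrow> smooth_on T g \<Longrightarrow> f ` S \<subseteq> T \<Longrightarrow> smooth_on S (\<lambda>x. g (f x))"
  unfolding smooth_on_def using Ck_on_compose by blast

lemma smooth_on_vec: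
  fixes f :: "'a::real_normed_vector \<Rightarrow> real^'n"
  assumes "open S" "\<And>i. smooth_on S (\<lambda>x. f x $ i)"
  shows "smooth_on S f"
proof -
  have "smooth_on S (\<lambda>x. \<Sum>i\<in>UNIV. f x $ i *\<^sub>R (axis i 1 :: real^'n))"
    by (intro smooth_on_sum smooth_on_scaleR assms smooth_on_const)
  moreover have "(\<lambda>x. \<Sum>i\<in>UNIV. f x $ i *\<^sub>R (axis i 1 :: real^'n)) = f"
  proof
    show "(\<Sum>i\<in>UNIV. f x $ i *\<^sub>R (axis i 1 :: real^'n)) = f x" for x
      using basis_expansion[of "f x"] by (simp add: scalar_mult_eq_scaleR)
  qed
  ultimately show ?thesis by (simp only:)
qed

lemma smooth_on_has_derivative:
  "smooth_on S f \<Longrightarrow> x \<in> S \<Longrightarrow> (f has_derivative frechet_derivative f (at x)) (at x)"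
  using Ck_on_SucD smooth_on_def by blast

lemma smooth_on_frechet: "smooth_on S f \<Longrightarrow> smooth_on S (\<lambda>x. frechet_derivative f (at x) v)"
  unfolding smooth_on_def
proof
  fix k assume "\<forall>k. Ck_on k f S"
  then have "Ck_on (Suc k) f S" by blast
  then show "Ck_on k (\<lambda>x. frechet_derivative f (at x) v) S" by simp
qed

lemma smooth_on_continuous: "smooth_on S f \<Longrightarrow> continuous_on S f"
  unfolding smooth_on_def using Ck_on.simps(1) by blast

lemma smooth_on_det:
  fixes M :: "'a::real_normed_vector \<Rightarrow> real^'n^'n"
  assumes "open S" "\<And>i j. smooth_on S (\<lambda>x. M x $ i $ j)"
  shows "smooth_on S (\<lambda>x. det (M x))"
  unfolding det_def
  by (intro smooth_on_sum smooth_on_mult smooth_on_prod smooth_on_const assms)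


subsection \<open>Elementary functions\<close>

lemma Ck_on_field_SucI:
  fixes f :: "real \<Rightarrow> real"
  assumes "open S" "\<And>x. x \<in> S \<Longrightarrow> (f has_field_derivative f' x) (at x)" "Ck_on k f' S"
  shows "Ck_on (Suc k) f S"
  using assms
  by (intro Ck_on_SucI[where f' = "\<lambda>x v. f' x * v"] Ck_on_bilinear[OF bounded_bilinear_mult] Ck_on_const)
    (auto simp: has_field_derivative_def)

lemma smooth_on_real_exp: "smooth_on UNIV (exp :: real \<Rightarrow> real)"
  unfolding smooth_on_def
proof
  fix k show "Ck_on k (exp :: real \<Rightarrow> real) UNIV"
  proof (induction k)
    case (Suc k)
    show ?case by (rule Ck_on_field_SucI[OF _ _ Suc]) auto
  qed (simp add: continuous_on_exp)
qed

lemma smooth_on_real_inverse: "smooth_on (- {0}) (inverse :: real \<Rightarrow> real)"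
  unfolding smooth_on_def
proof
  fix k show "Ck_on k (inverse :: real \<Rightarrow> real) (- {0})"
  proof (induction k)
    case (Suc k)
    have "Ck_on k (\<lambda>x::real. - (inverse x * inverse x)) (- {0})"
      by (intro Ck_on_bounded_linear[OF bounded_linear_minus[OF bounded_linear_ident]]
          Ck_on_bilinear[OF bounded_bilinear_mult] Suc) auto
    then show ?case
      by (rule Ck_on_field_SucI[rotated 2]) (auto intro!: DERIV_inverse[THEN DERIV_cong] simp: power2_eq_square)
  qed (simp, intro continuous_intros, auto)
qed

lemma smooth_on_real_ln: "smooth_on {0<..} (ln :: real \<Rightarrow> real)"
  unfolding smooth_on_def
proof
  fix k show "Ck_on k (ln :: real \<Rightarrow> real) {0<..}"
  proof (cases k)
    case (Suc m)
    have "smooth_on {0<..} (inverse :: real \<Rightarrow> real)"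
      by (rule smooth_on_subset[OF smooth_on_real_inverse]) auto
    then have "Ck_on m (inverse :: real \<Rightarrow> real) {0<..}" by (simp add: smooth_on_def)
    then show ?thesis unfolding Suc
      by (rule Ck_on_field_SucI[rotated 2]) (auto simp: DERIV_ln)
  qed (simp, intro continuous_intros, auto)
qed

lemma smooth_on_real_sqrt: "smooth_on {0<..} sqrt"
  unfolding smooth_on_def
proof
  fix k show "Ck_on k sqrt {0<..}"
  proof (induction k)
    case (Suc k)
    have inv: "Ck_on k (inverse :: real \<Rightarrow> real) (- {0})"
      using smooth_on_real_inverse by (simp add: smooth_on_def)
    have "Ck_on k (\<lambda>x. inverse (sqrt x)) {0<..}"
      by (rule Ck_on_compose[OF _ _ Suc inv]) auto
    then have "Ck_on k (\<lambda>x. inverse (sqrt x) / 2) {0<..}"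
      by (rule Ck_on_bounded_linear[OF bounded_linear_divide, rotated]) auto
    then show ?case
      by (rule Ck_on_field_SucI[rotated 2]) (auto intro!: DERIV_real_sqrt[THEN DERIV_cong] simp: field_simps)
  qed (auto intro: continuous_on_real_sqrt continuous_on_id)
qed

lemma smooth_on_real_abs: "smooth_on (- {0}) (abs :: real \<Rightarrow> real)"
  unfolding smooth_on_def
proof
  fix k
  have sgn0: "(sgn has_field_derivative 0) (at x)" if "x \<noteq> 0" for x :: real
  proof (rule has_field_derivative_transform_within[of "\<lambda>_. sgn x" 0 x UNIV "\<bar>x\<bar>"])
    show "sgn x = sgn y" if "dist y x < \<bar>x\<bar>" for y
      using that by (auto simp: dist_real_def sgn_if)
  qed (use that in auto)
  have abs0: "(abs has_field_derivative sgn x) (at x)" if "x \<noteq> 0" for x :: real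
  proof (rule has_field_derivative_transform_within[of "\<lambda>y. sgn x * y" _ x UNIV "\<bar>x\<bar>"])
    show "sgn x * y = \<bar>y\<bar>" if "dist y x < \<bar>x\<bar>" for y
      using that by (auto simp: dist_real_def sgn_if)
  qed (use that in \<open>auto intro!: derivative_eq_intros\<close>)
  have sgnk: "Ck_on k (sgn :: real \<Rightarrow> real) (- {0})" for k
  proof (cases k)
    case (Suc m)
    show ?thesis unfolding Suc
      by (rule Ck_on_field_SucI[where f' = "\<lambda>_. 0"]) (auto intro: sgn0 Ck_on_const)
  qed (simp, intro continuous_intros, auto)
  show "Ck_on k (abs :: real \<Rightarrow> real) (- {0})"
  proof (cases k)
    case (Suc m)
    show ?thesis unfolding Suc
      by (rule Ck_on_field_SucI[OF _ abs0 sgnk]) auto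
  qed (simp, intro continuous_intros)
qed

lemma smooth_on_exp: "open S \<Longrightarrow> smooth_on S f \<Longrightarrow> smooth_on S (\<lambda>x. exp (f x :: real))"
  by (rule smooth_on_compose[OF _ open_UNIV _ smooth_on_real_exp]) auto

lemma smooth_on_divide:
  "open S \<Longrightarrow> smooth_on S f \<Longrightarrow> smooth_on S g \<Longrightarrow> (\<And>x. x \<in> S \<Longrightarrow> g x \<noteq> 0)
    \<Longrightarrow> smooth_on S (\<lambda>x. f x / g x :: real)"
  unfolding divide_inverse
  by (intro smooth_on_mult smooth_on_compose[OF _ _ _ smooth_on_real_inverse]) auto

lemma smooth_on_ln:
  "open S \<Longrightarrow> smooth_on S f \<Longrightarrow> (\<And>x. x \<in> S \<Longrightarrow> f x > 0) \<Longrightarrow> smooth_on S (\<lambda>x. ln (f x :: real))"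
  by (rule smooth_on_compose[OF _ _ _ smooth_on_real_ln]) auto

lemma smooth_on_sqrt_abs:
  "open S \<Longrightarrow> smooth_on S f \<Longrightarrow> (\<And>x. x \<in> S \<Longrightarrow> f x \<noteq> 0) \<Longrightarrow> smooth_on S (\<lambda>x. sqrt \<bar>f x\<bar>)"
  by (intro smooth_on_compose[OF _ _ _ smooth_on_real_sqrt] smooth_on_compose[OF _ _ _ smooth_on_real_abs]) auto


subsection \<open>The inverse function theorem for smooth maps\<close>

text \<open>By Cramer's rule the derivative of the inverse map is a rational expression in the derivative
  of the map, evaluated along the inverse; so the inverse inherits one order of differentiability
  after the other.\<close>

lemma smooth_inverse:
  fixes \<Phi> :: "real^'n \<Rightarrow> real^'n"
  assumes S: "open S" "smooth_on S \<Phi>" and T: "open T" "\<Psi> ` T \<subseteq> S"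
    and d: "\<And>y. y \<in> T \<Longrightarrow> (\<Psi> has_derivative \<Psi>' y) (at y)"
    and inv: "\<And>y v. y \<in> T \<Longrightarrow> frechet_derivative \<Phi> (at (\<Psi> y)) (\<Psi>' y v) = v"
  shows "smooth_on T \<Psi>"
  unfolding smooth_on_def
proof
  define M where "M x = matrix (frechet_derivative \<Phi> (at x))" for x
  have Mv: "M (\<Psi> y) *v w = frechet_derivative \<Phi> (at (\<Psi> y)) w" if "y \<in> T" for y w
  proof -
    have "linear (frechet_derivative \<Phi> (at (\<Psi> y)))"
      using smooth_on_has_derivative[OF S(2), of "\<Psi> y"] that T(2) by (auto intro: has_derivative_linear)
    then show ?thesis unfolding M_def by (simp add: matrix_vector_mul(2) fun_eq_iff)
  qed
  have det: "det (M (\<Psi> y)) \<noteq> 0" if "y \<in> T" for y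
  proof -
    have "surj ((*v) (M (\<Psi> y)))"
      using inv[OF that] Mv[OF that] by (intro surjI[where f = "\<Psi>' y"]) auto
    then have "invertible (M (\<Psi> y))"
      by (simp add: invertible_right_inverse matrix_right_invertible_surjective)
    then show ?thesis by (simp add: invertible_det_nz)
  qed
  have der: "\<Psi>' y v = (\<chi> k. det (\<chi> i j. if j = k then v $ i else M (\<Psi> y) $ i $ j) / det (M (\<Psi> y)))"
    if "y \<in> T" for y v
    using cramer[OF det[OF that]] Mv[OF that] inv[OF that] by auto
  have Msm: "smooth_on S (\<lambda>x. M x $ i $ j)" for i j
    unfolding M_def matrix_def by (auto intro!: smooth_on_vec_nth smooth_on_frechet S)
  have N: "open (S \<inter> {x. det (M x) \<noteq> 0})" (is "open ?N")
  proof -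
    have "continuous_on S (\<lambda>x. det (M x))"
      by (intro smooth_on_continuous smooth_on_det S(1) Msm)
    then have "open (S \<inter> (\<lambda>x. det (M x)) -` (- {0}))"
      by (intro continuous_open_preimage S(1)) auto
    then show ?thesis by (simp add: vimage_def)
  qed
  have sm: "smooth_on ?N (\<lambda>x. det (\<chi> i j. if j = k then v $ i else M x $ i $ j) / det (M x))" for k v
  proof (intro smooth_on_divide N smooth_on_det)
    show "smooth_on ?N (\<lambda>x. (\<chi> i j. if j = k then v $ i else M x $ i $ j) $ i $ j)" for i j
      by (cases "j = k") (auto intro!: smooth_on_const N smooth_on_subset[OF Msm])
  qed (auto intro!: smooth_on_subset[OF Msm])
  fix m show "Ck_on m \<Psi> T"
  proof (induction m)
    case 0
    then show ?case
      using d by (auto intro!: continuous_at_imp_continuous_on has_derivative_continuous)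
  next
    case (Suc m)
    show ?case
    proof (rule Ck_on_SucI[OF T(1) d])
      fix v
      have "Ck_on m (\<lambda>y. \<Sum>k\<in>UNIV. (det (\<chi> i j. if j = k then v $ i else M (\<Psi> y) $ i $ j) / det (M (\<Psi> y)))
          *\<^sub>R (axis k 1 :: real^'n)) T"
      proof (intro Ck_on_sum Ck_on_bilinear[OF bounded_bilinear_scaleR] Ck_on_const T(1))
        show "Ck_on m (\<lambda>y. det (\<chi> i j. if j = k then v $ i else M (\<Psi> y) $ i $ j) / det (M (\<Psi> y))) T" for k
          by (rule Ck_on_compose[OF T(1) N Suc, where g = "\<lambda>x. det (\<chi> i j. if j = k then v $ i else M x $ i $ j) / det (M x)"])
            (use sm T det in \<open>auto simp: smooth_on_def\<close>)
      qed
      moreover have "(\<Sum>k\<in>UNIV. (det (\<chi> i j. if j = k then v $ i else M (\<Psi> y) $ i $ j) / det (M (\<Psi> y)))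
          *\<^sub>R (axis k 1 :: real^'n)) = \<Psi>' y v" if "y \<in> T" for y
        using basis_expansion[of "\<Psi>' y v"] der[OF that] by (simp add: scalar_mult_eq_scaleR)
      ultimately show "Ck_on m (\<lambda>y. \<Psi>' y v) T"
        by (subst Ck_on_cong[OF T(1)]) (auto simp: eq_commute)
    qed
  qed
qed

text \<open>The \<open>C\<^sup>1\<close> inverse function theorem yields the inverse with its derivative; the preceding lemma
  raises the regularity to all orders.\<close>

lemma smooth_local_inverse:
  fixes \<Phi> :: "real^'n \<Rightarrow> real^'n"
  assumes "open S" "smooth_on S \<Phi>" "u \<in> S" "inj (frechet_derivative \<Phi> (at u))"
  obtains U V \<Psi> where "open U" "U \<subseteq> S" "u \<in> U" "open V" "\<Phi> u \<in> V" "homeomorphism U V \<Phi> \<Psi>"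
    "smooth_on V \<Psi>" "\<And>y v. y \<in> V \<Longrightarrow> frechet_derivative \<Phi> (at (\<Psi> y)) (frechet_derivative \<Psi> (at y) v) = v"
proof -
  define \<Phi>' where "\<Phi>' x = Blinfun (frechet_derivative \<Phi> (at x))" for x
  have app: "blinfun_apply (\<Phi>' x) = frechet_derivative \<Phi> (at x)" if "x \<in> S" for x
    unfolding \<Phi>'_def
    using bounded_linear_Blinfun_apply has_derivative_bounded_linear smooth_on_has_derivative[OF assms(2) that]
    by blast
  have lin: "linear (frechet_derivative \<Phi> (at x))" if "x \<in> S" for x
    using has_derivative_linear smooth_on_has_derivative[OF assms(2) that] by blast
  obtain L where L: "linear L" "L \<circ> frechet_derivative \<Phi> (at u) = id"
    using linear_injective_left_inverse[OF lin[OF assms(3)] assms(4)] by blast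
  have bL: "blinfun_apply (Blinfun L) = L"
    by (simp add: L(1) bounded_linear_Blinfun_apply linear_conv_bounded_linear[symmetric])
  have "continuous_on S \<Phi>'"
    by (intro continuous_on_blinfun_componentwise)
      (auto simp: app intro!: smooth_on_continuous smooth_on_frechet assms(2) cong: continuous_on_cong)
  moreover have "Blinfun L o\<^sub>L \<Phi>' u = id_blinfun"
    using L(2) by (intro blinfun_eqI) (simp add: bL app[OF assms(3)] fun_eq_iff)
  ultimately obtain U V \<Psi> \<Psi>' where r: "open U" "U \<subseteq> S" "u \<in> U" "open V" "\<Phi> u \<in> V" "homeomorphism U V \<Phi> \<Psi>"
    "\<And>y. y \<in> V \<Longrightarrow> (\<Psi> has_derivative (\<Psi>' y)) (at y)"
    "\<And>y. y \<in> V \<Longrightarrow> \<Psi>' y = inv (blinfun_apply (\<Phi>' (\<Psi> y)))"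
    "\<And>y. y \<in> V \<Longrightarrow> bij (blinfun_apply (\<Phi>' (\<Psi> y)))"
    using inverse_function_theorem[OF assms(1) _ _ assms(3), of \<Phi> \<Phi>' "Blinfun L"]
      smooth_on_has_derivative[OF assms(2)] app by metis
  have S: "\<Psi> ` V \<subseteq> S" using r(2,6) by (auto simp: homeomorphism_def)
  have inv: "frechet_derivative \<Phi> (at (\<Psi> y)) (\<Psi>' y v) = v" if "y \<in> V" for y v
    using r(8,9)[OF that] app[of "\<Psi> y"] S that
    by (metis bij_is_surj image_subset_iff surj_f_inv_f)
  have "smooth_on V \<Psi>"
    by (rule smooth_inverse[OF assms(1,2) r(4) S r(7) inv])
  moreover have "frechet_derivative \<Psi> (at y) = \<Psi>' y" if "y \<in> V" for y
    using frechet_derivative_at[OF r(7)[OF that]] by simp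
  ultimately show thesis using that[OF r(1-6)] inv by simp
qed


section \<open>Linear algebra in \<open>\<real>\<^sup>4\<close>\<close>

lemma vector_4 [simp]:
  "(vector [a, b, c, d] :: 'a::zero^4) $ 1 = a"
  "(vector [a, b, c, d] :: 'a^4) $ 2 = b"
  "(vector [a, b, c, d] :: 'a^4) $ 3 = c"
  "(vector [a, b, c, d] :: 'a^4) $ 4 = d"
  unfolding vector_def by auto

lemma det_4:
  "det (A :: 'a::comm_ring_1^4^4) =
     A$1$1 * A$2$2 * A$3$3 * A$4$4 - A$1$1 * A$2$2 * A$3$4 * A$4$3
   - A$1$1 * A$2$3 * A$3$2 * A$4$4 + A$1$1 * A$2$3 * A$3$4 * A$4$2
   + A$1$1 * A$2$4 * A$3$2 * A$4$3 - A$1$1 * A$2$4 * A$3$3 * A$4$2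
   - A$1$2 * A$2$1 * A$3$3 * A$4$4 + A$1$2 * A$2$1 * A$3$4 * A$4$3
   + A$1$2 * A$2$3 * A$3$1 * A$4$4 - A$1$2 * A$2$3 * A$3$4 * A$4$1
   - A$1$2 * A$2$4 * A$3$1 * A$4$3 + A$1$2 * A$2$4 * A$3$3 * A$4$1
   + A$1$3 * A$2$1 * A$3$2 * A$4$4 - A$1$3 * A$2$1 * A$3$4 * A$4$2
   - A$1$3 * A$2$2 * A$3$1 * A$4$4 + A$1$3 * A$2$2 * A$3$4 * A$4$1
   + A$1$3 * A$2$4 * A$3$1 * A$4$2 - A$1$3 * A$2$4 * A$3$2 * A$4$1
   - A$1$4 * A$2$1 * A$3$2 * A$4$3 + A$1$4 * A$2$1 * A$3$3 * A$4$2
   + A$1$4 * A$2$2 * A$3$1 * A$4$3 - A$1$4 * A$2$2 * A$3$3 * A$4$1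
   - A$1$4 * A$2$3 * A$3$1 * A$4$2 + A$1$4 * A$2$3 * A$3$2 * A$4$1"
proof -
  have f1: "finite {2::4, 3, 4}" "1 \<notin> {2::4, 3, 4}"
    and f2: "finite {3::4, 4}" "2 \<notin> {3::4, 4}"
    and f3: "finite {4::4}" "3 \<notin> {4::4}"
    by auto
  show ?thesis
    unfolding det_def UNIV_4
    unfolding sum_over_permutations_insert[OF f1]
    unfolding sum_over_permutations_insert[OF f2]
    unfolding sum_over_permutations_insert[OF f3]
    unfolding permutes_sing
    by (simp add: sign_swap_id permutation_swap_id permutation_compose sign_compose sign_id swap_id_eq algebra_simps)
qed

definition det4 :: "real^4 \<Rightarrow> real^4 \<Rightarrow> real^4 \<Rightarrow> real^4 \<Rightarrow> real" where
  "det4 a b c d = det (vector [a, b, c, d] :: real^4^4)"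

lemma det4_expand:
  "det4 a b c d =
     a$1 * b$2 * c$3 * d$4 - a$1 * b$2 * c$4 * d$3
   - a$1 * b$3 * c$2 * d$4 + a$1 * b$3 * c$4 * d$2
   + a$1 * b$4 * c$2 * d$3 - a$1 * b$4 * c$3 * d$2
   - a$2 * b$1 * c$3 * d$4 + a$2 * b$1 * c$4 * d$3
   + a$2 * b$3 * c$1 * d$4 - a$2 * b$3 * c$4 * d$1
   - a$2 * b$4 * c$1 * d$3 + a$2 * b$4 * c$3 * d$1
   + a$3 * b$1 * c$2 * d$4 - a$3 * b$1 * c$4 * d$2
   - a$3 * b$2 * c$1 * d$4 + a$3 * b$2 * c$4 * d$1
   + a$3 * b$4 * c$1 * d$2 - a$3 * b$4 * c$2 * d$1
   - a$4 * b$1 * c$2 * d$3 + a$4 * b$1 * c$3 * d$2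
   + a$4 * b$2 * c$1 * d$3 - a$4 * b$2 * c$3 * d$1
   - a$4 * b$3 * c$1 * d$2 + a$4 * b$3 * c$2 * d$1"
  unfolding det4_def det_4 by simp

lemma det4_add_scale: "det4 a b c (v + k *\<^sub>R w) = det4 a b c v + k * det4 a b c w"
  unfolding det4_expand by (simp add: algebra_simps)

lemma det4_zero: "det4 a b c 0 = 0"
  unfolding det4_expand by simp

lemma det4_swap: "det4 b a c d = - det4 a b c d"
  unfolding det4_expand by simp

lemma axis_nth_if: "axis i x $ j = (if j = i then x else 0)"
  by (simp add: axis_def)

lemma matrix_vector_eq_0_det:
  fixes M :: "real^'n^'n"
  assumes "M *v w = 0" "w \<noteq> 0"
  shows "det M = 0"
proof (rule ccontr)
  assume "det M \<noteq> 0"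
  then have "inj ((*v) M)" using det_nz_iff_inj[of "(*v) M"] by simp
  then show False using assms injD[of "(*v) M" w 0] by simp
qed

lemma real3_eq: "(v :: real^3) = (\<Sum>i\<in>UNIV. v $ i *\<^sub>R axis i 1)"
  using basis_expansion[of v] by (simp add: scalar_mult_eq_scaleR)

lemma linear_real3:
  assumes "linear (L :: real^3 \<Rightarrow> 'b::real_vector)"
  shows "L v = v$1 *\<^sub>R L (axis 1 1) + v$2 *\<^sub>R L (axis 2 1) + v$3 *\<^sub>R L (axis 3 1)"
  by (subst real3_eq) (simp add: sum_3 linear_add[OF assms] linear_scale[OF assms])

text \<open>The matrix of the four vectors is the product of the block matrix of \<open>T\<close> and \<open>1\<close> with the matrix
  that belongs to the standard frame.\<close>

lemma det4_frame:
  fixes T :: "real^3^3"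
  assumes L: "linear (L :: real^3 \<Rightarrow> real^4)"
  shows "det4 (L (T$1)) (L (T$2)) (L (T$3)) c
    = det T * det4 (L (axis 1 1)) (L (axis 2 1)) (L (axis 3 1)) c"
proof -
  let ?B = "vector [vector [T$1$1, T$1$2, T$1$3, 0], vector [T$2$1, T$2$2, T$2$3, 0],
    vector [T$3$1, T$3$2, T$3$3, 0], vector [0, 0, 0, 1]] :: real^4^4"
  let ?M = "vector [L (axis 1 1), L (axis 2 1), L (axis 3 1), c] :: real^4^4"
  have "vector [L (T$1), L (T$2), L (T$3), c] = ?B ** ?M"
    unfolding linear_real3[OF L, of "T$1"] linear_real3[OF L, of "T$2"] linear_real3[OF L, of "T$3"]
    by (simp add: vec_eq_iff forall_4 matrix_matrix_mult_def sum_4)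
  moreover have "det ?B = det T"
    by (simp add: det_4 det_3)
  ultimately show ?thesis by (simp add: det4_def det_mul)
qed

lemma bilinear_frame_det:
  fixes T H :: "real^3^3"
  assumes "\<And>a b. h a b = (\<Sum>i\<in>UNIV. \<Sum>j\<in>UNIV. a$i * H$i$j * b$j)"
  shows "det (\<chi> i j. h (T$i) (T$j)) = (det T)\<^sup>2 * det H"
proof -
  have "(\<chi> i j. h (T$i) (T$j)) = T ** H ** transpose T"
    by (simp add: vec_eq_iff matrix_matrix_mult_def transpose_def assms sum_distrib_right)
      (subst sum.swap, simp)
  then show ?thesis by (simp add: det_mul power2_eq_square)
qed


text \<open>The range of \<open>L\<close> has dimension at most 3; a vector orthogonal to it is in the kernel of the matrix.\<close>

lemma det4_range_eq_0:
  assumes L: "linear (L :: real^3 \<Rightarrow> real^4)"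
  shows "det4 (L a) (L b) (L c) (L d) = 0"
proof -
  have "dim (range L) \<le> 3"
    using dim_image_le[OF L, of UNIV] by simp
  then have "dim (range L) < DIM(real^4)"
    by simp
  then obtain w where w: "w \<noteq> 0" "\<And>y. y \<in> span (range L) \<Longrightarrow> orthogonal w y"
    using orthogonal_to_subspace_exists by blast
  let ?M = "vector [L a, L b, L c, L d] :: real^4^4"
  have "?M *v w = 0"
    using w(2)[OF span_base[OF rangeI]]
    by (simp add: vec_eq_iff forall_4 matrix_vector_mul_component orthogonal_def inner_commute)
  then have "det ?M = 0"
    using w(1) matrix_vector_eq_0_det by blast
  then show ?thesis by (simp add: det4_def)
qed

text \<open>With the next two lemmas, nonvanishing of the determinant is the same as transversality of \<open>c\<close> to
  an immersion with differential \<open>L\<close>.\<close>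

lemma det4_nonzero:
  assumes "det4 (L (axis 1 1)) (L (axis 2 1)) (L (axis 3 1)) c \<noteq> 0" "linear (L :: real^3 \<Rightarrow> real^4)"
  shows "inj L" "c \<notin> range L"
proof -
  show "c \<notin> range L"
    using assms det4_range_eq_0[OF assms(2)] by auto
  show "inj L"
  proof (subst linear_injective_0[OF assms(2)], safe)
    fix v assume v: "L v = 0"
    let ?M = "vector [L (axis 1 1), L (axis 2 1), L (axis 3 1), c] :: real^4^4"
    have "transpose ?M *v vector [v$1, v$2, v$3, 0] = L v"
      using linear_real3[OF assms(2), of v]
      by (simp add: vec_eq_iff forall_4 matrix_vector_mult_def transpose_def sum_4)
    moreover have "det (transpose ?M) \<noteq> 0"
      using assms(1) by (simp add: det4_def)
    ultimately have "vector [v$1, v$2, v$3, 0] = (0 :: real^4)"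
      using v matrix_vector_eq_0_det by metis
    then show "v = 0"
      by (simp add: vec_eq_iff forall_3 forall_4)
  qed
qed

lemma transversal_decomposition:
  assumes "linear (L :: real^3 \<Rightarrow> real^4)" "inj L" "c \<notin> range L"
  shows "\<exists>!v. \<exists>a. w = L v + a *\<^sub>R c" "\<exists>!a. \<exists>v. w = L v + a *\<^sub>R c" "\<exists>v a. w = L v + a *\<^sub>R c"
    and "det4 (L (axis 1 1)) (L (axis 2 1)) (L (axis 3 1)) c \<noteq> 0"
proof -
  \<comment> \<open>the map \<open>(v, a) \<mapsto> L v + a c\<close>, read as an endomorphism of \<open>\<real>\<^sup>4\<close>, is injective, hence bijective\<close>
  define pr :: "real^4 \<Rightarrow> real^3" where "pr x = vector [x$1, x$2, x$3]" for x
  have pr: "linear pr"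
    unfolding pr_def by (rule linearI) (auto simp: vec_eq_iff forall_3)
  define K where "K x = L (pr x) + x$4 *\<^sub>R c" for x :: "real^4"
  have lin: "linear K"
    unfolding K_def using pr assms(1)
    by (intro linearI) (auto simp: linear_add linear_scale algebra_simps)
  have uniq: "v = v' \<and> a = a'" if "L v + a *\<^sub>R c = L v' + a' *\<^sub>R c" for v v' a a'
  proof -
    have e: "L (v - v') = (a' - a) *\<^sub>R c"
      unfolding linear_diff[OF assms(1)] using that by (simp add: algebra_simps)
    have "a' = a"
    proof (rule ccontr)
      assume "a' \<noteq> a"
      then have "c = L ((1 / (a' - a)) *\<^sub>R (v - v'))"
        using e by (simp add: linear_scale[OF assms(1)])
      then show False using assms(3) by auto
    qed
    then show ?thesis
      using e that assms(2) by (auto dest: injD)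
  qed
  have "inj K"
  proof (rule injI)
    fix x y assume "K x = K y"
    then have "pr x = pr y" "x$4 = y$4" using uniq unfolding K_def by blast+
    then show "x = y" by (auto simp: pr_def vec_eq_iff forall_3 forall_4)
  qed
  then have "surj K" using linear_inj_imp_surj[OF lin] by blast
  then obtain x where "w = K x" by (metis surjD)
  then show ex: "\<exists>v a. w = L v + a *\<^sub>R c" unfolding K_def by blast
  show "\<exists>!v. \<exists>a. w = L v + a *\<^sub>R c" using ex uniq by metis
  show "\<exists>!a. \<exists>v. w = L v + a *\<^sub>R c" using ex uniq by metis
  have "matrix K = transpose (vector [L (axis 1 1), L (axis 2 1), L (axis 3 1), c] :: real^4^4)"
  proof -
    have "pr (axis 1 1) = axis 1 1" "pr (axis 2 1) = axis 2 1" "pr (axis 3 1) = axis 3 1" "pr (axis 4 1) = 0"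
      by (auto simp: pr_def vec_eq_iff forall_3 axis_def)
    then show ?thesis
      by (simp add: vec_eq_iff[where 'a = "real^4"] vec_eq_iff[where 'a = real and 'b = 4] forall_4 matrix_def transpose_def K_def linear_0[OF assms(1)])
        (simp add: axis_def)
  qed
  then show "det4 (L (axis 1 1)) (L (axis 2 1)) (L (axis 3 1)) c \<noteq> 0"
    using det_nz_iff_inj[OF lin] \<open>inj K\<close> by (simp add: det4_def)
qed

text \<open>The vector with component \<open>p\<close> in the eigenspace of \<open>J\<close> for \<open>1\<close> and \<open>q\<close> in that for \<open>- 1\<close>.\<close>

definition PQ :: "real^2 \<Rightarrow> real^2 \<Rightarrow> real^4" where
  "PQ p q = join (p + q) (p - q)"

lemma PQ_nth [simp]: "PQ p q $ 1 = p$1 + q$1" "PQ p q $ 2 = p$2 + q$2" "PQ p q $ 3 = p$1 - q$1" "PQ p q $ 4 = p$2 - q$2"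
  by (simp_all add: PQ_def join_def)

lemma PQ_eq_iff [simp]: "PQ p q = PQ p' q' \<longleftrightarrow> p = p' \<and> q = q'"
  by (auto simp: vec_eq_iff forall_4 forall_2)

lemma PQ_add: "PQ p q + PQ p' q' = PQ (p + p') (q + q')"
  and PQ_diff: "PQ p q - PQ p' q' = PQ (p - p') (q - q')"
  and PQ_scale: "k *\<^sub>R PQ p q = PQ (k *\<^sub>R p) (k *\<^sub>R q)"
  and PQ_minus: "- PQ p q = PQ (- p) (- q)"
  and PQ_zero: "PQ 0 0 = 0"
  by (auto simp: vec_eq_iff forall_4 algebra_simps)

lemma J_PQ: "J (PQ p q) = PQ p (- q)"
  by (simp add: J_def vec_eq_iff forall_4)

lemma J_PQ_eq_minus_iff: "J (PQ a b) = - PQ a b \<longleftrightarrow> a = 0"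
proof -
  have "(a = - a) = (a = 0)" by (auto simp: vec_eq_iff)
  then show ?thesis by (auto simp: J_PQ PQ_minus)
qed

lemma linear_J: "linear J"
  by (rule linearI) (auto simp: J_def vec_eq_iff forall_4)

lemma bounded_bilinear_det2: "bounded_bilinear det2"
  unfolding bilinear_conv_bounded_bilinear[symmetric] bilinear_def det2_def
  by (auto intro!: linearI simp: det_2 algebra_simps)

lemma det2_expand: "det2 a b = a$1 * b$2 - a$2 * b$1"
  by (simp add: det2_def det_2)

section \<open>Second derivatives of a hypersurface\<close>

text \<open>The field \<open>w\<close> is extended with constant coordinates before it is differentiated in the direction \<open>v\<close>.\<close>

definition push2 :: "(real^3 \<Rightarrow> real^4) \<Rightarrow> real^3 \<Rightarrow> real^3 \<Rightarrow> real^3 \<Rightarrow> real^4" where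
  "push2 F u v w = frechet_derivative (\<lambda>q. push F q w) (at u) v"

lemma h_at_push2: "h_at F C u v w = transversal_part F C u (push2 F u v w)"
  by (simp add: h_at_def second_fundamental_form_def flat_D_def push2_def)

lemma push_eqI: "(F has_derivative F') (at u) \<Longrightarrow> push F u = F'"
  unfolding push_def by (rule frechet_derivative_at[symmetric])

lemma push2_eqI:
  assumes "open V" "u \<in> V" "\<And>q. q \<in> V \<Longrightarrow> push F q w = G q" "(G has_derivative G') (at u)"
  shows "push2 F u v w = G' v"
proof -
  have "((\<lambda>q. push F q w) has_derivative G') (at u)"
    using has_derivative_transform_within_open[OF assms(4,1,2)] assms(3) by simp
  then show ?thesis unfolding push2_def by (simp add: frechet_derivative_at[symmetric])
qed

lemma has_derivative_push:
  "smooth_on V F \<Longrightarrow> u \<in> V \<Longrightarrow> (F has_derivative push F u) (at u)"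
  unfolding push_def by (rule smooth_on_has_derivative)

lemma smooth_on_push: "smooth_on V F \<Longrightarrow> smooth_on V (\<lambda>q. push F q w)"
  unfolding push_def by (rule smooth_on_frechet)

lemma has_derivative_push2:
  "smooth_on V F \<Longrightarrow> u \<in> V \<Longrightarrow> ((\<lambda>q. push F q w) has_derivative (\<lambda>v. push2 F u v w)) (at u)"
  unfolding push2_def using smooth_on_has_derivative[OF smooth_on_push] by (simp add: eta_contract_eq)

lemma linear_push: "smooth_on V F \<Longrightarrow> u \<in> V \<Longrightarrow> linear (push F u)"
  using has_derivative_push has_derivative_linear by blast

text \<open>The Leibniz rule is used in two ways: with a change of coordinates \<open>\<phi>\<close> and the field \<open>Y\<close> of images of
  a fixed vector under its differential, and with \<open>\<phi>\<close> the identity and \<open>Y\<close> the tangent field whose image is \<open>JC\<close>.\<close>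

lemma has_derivative_push_field:
  assumes V: "open V" "smooth_on V F" "\<phi> q \<in> V"
    and \<phi>: "(\<phi> has_derivative \<phi>') (at q)" and Y: "(Y has_derivative Y') (at q)"
  shows "((\<lambda>x. push F (\<phi> x) (Y x)) has_derivative
      (\<lambda>v. push2 F (\<phi> q) (\<phi>' v) (Y q) + push F (\<phi> q) (Y' v))) (at q)"
    and "linear (push2 F (\<phi> q) a)"
proof -
  \<comment> \<open>expanding \<open>Y\<close> in coordinates reduces the claim to the product rule for scalar times vector\<close>
  let ?R = "\<lambda>x w::real^3. \<Sum>i\<in>UNIV. w $ i *\<^sub>R push F x (axis i 1)"
  have rep: "push F x w = ?R x w" if "x \<in> V" for x w
    using linear_real3[OF linear_push[OF V(2) that], of w] by (simp add: sum_3)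
  have comp: "((\<lambda>x. push F (\<phi> x) w) has_derivative (\<lambda>v. push2 F (\<phi> q) (\<phi>' v) w)) (at q)" for w
    using diff_chain_at[OF \<phi> has_derivative_push2[OF V(2,3)]] by (simp add: o_def)
  have rep2: "push2 F (\<phi> q) v w = (\<Sum>i\<in>UNIV. w $ i *\<^sub>R push2 F (\<phi> q) v (axis i 1))" for v w
    by (rule push2_eqI[OF V(1,3) rep])
      (auto intro!: derivative_eq_intros has_derivative_push2[OF V(2,3)])
  show "linear (push2 F (\<phi> q) a)"
  proof (rule linearI)
    show "push2 F (\<phi> q) a (x + y) = push2 F (\<phi> q) a x + push2 F (\<phi> q) a y" for x y
      unfolding rep2[of a x] rep2[of a y] rep2[of a "x + y"] by (simp add: sum.distrib algebra_simps)
    show "push2 F (\<phi> q) a (k *\<^sub>R x) = k *\<^sub>R push2 F (\<phi> q) a x" for x k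
      unfolding rep2[of a x] rep2[of a "k *\<^sub>R x"] by (simp add: scaleR_sum_right)
  qed
  have lin: "linear (push F (\<phi> q))" by (rule linear_push[OF V(2,3)])
  have Yi: "((\<lambda>x. Y x $ i) has_derivative (\<lambda>v. Y' v $ i)) (at q)" for i
    by (rule bounded_linear.has_derivative[OF bounded_linear_vec_nth Y])
  have "((\<lambda>x. ?R (\<phi> x) (Y x)) has_derivative
      (\<lambda>v. \<Sum>i\<in>UNIV. Y q $ i *\<^sub>R push2 F (\<phi> q) (\<phi>' v) (axis i 1) + Y' v $ i *\<^sub>R push F (\<phi> q) (axis i 1))) (at q)"
    by (rule has_derivative_sum) (rule has_derivative_scaleR[OF Yi comp])
  moreover have "(\<Sum>i\<in>UNIV. Y q $ i *\<^sub>R push2 F (\<phi> q) (\<phi>' v) (axis i 1) + Y' v $ i *\<^sub>R push F (\<phi> q) (axis i 1))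
      = push2 F (\<phi> q) (\<phi>' v) (Y q) + push F (\<phi> q) (Y' v)" for v
    unfolding rep2[of _ "Y q"] rep[OF V(3), of "Y' v"] by (simp add: sum.distrib)
  ultimately have d: "((\<lambda>x. ?R (\<phi> x) (Y x)) has_derivative
      (\<lambda>v. push2 F (\<phi> q) (\<phi>' v) (Y q) + push F (\<phi> q) (Y' v))) (at q)"
    by simp
  have "(\<phi> \<longlongrightarrow> \<phi> q) (at q)"
    using has_derivative_continuous[OF \<phi>] by (simp add: continuous_within)
  then have "eventually (\<lambda>x. \<phi> x \<in> V) (at q)"
    by (rule topological_tendstoD[OF _ V(1,3)])
  then have ev: "eventually (\<lambda>x. ?R (\<phi> x) (Y x) = push F (\<phi> x) (Y x)) (at q)"
    by eventually_elim (rule rep[symmetric])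
  show "((\<lambda>x. push F (\<phi> x) (Y x)) has_derivative
      (\<lambda>v. push2 F (\<phi> q) (\<phi>' v) (Y q) + push F (\<phi> q) (Y' v))) (at q)"
    by (rule has_derivative_transform_eventually[OF d ev rep[OF V(3), symmetric]]) simp
qed

lemma linear_push2_right: "open V \<Longrightarrow> smooth_on V F \<Longrightarrow> u \<in> V \<Longrightarrow> linear (push2 F u a)"
  using has_derivative_push_field(2)[of V F "\<lambda>x. x" u "\<lambda>x. x" "\<lambda>x. x" "\<lambda>x. x"] by auto


subsection \<open>Splitting along a transversal field\<close>

definition transversal_at :: "(real^3 \<Rightarrow> real^4) \<Rightarrow> (real^3 \<Rightarrow> real^4) \<Rightarrow> real^3 \<Rightarrow> bool" where
  "transversal_at F C u \<longleftrightarrow> linear (push F u) \<and> inj (push F u) \<and> C u \<notin> range (push F u)"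

lemma transversal_atI:
  "immersion_on V F \<Longrightarrow> transversal_on V F C \<Longrightarrow> u \<in> V \<Longrightarrow> transversal_at F C u"
  unfolding transversal_at_def immersion_on_def transversal_on_def using linear_push by blast

lemma transversal_part_eqI:
  assumes "transversal_at F C u" "w = push F u v + a *\<^sub>R C u"
  shows "transversal_part F C u w = a" "tangential_part F C u w = v"
proof -
  have t: "linear (push F u)" "inj (push F u)" "C u \<notin> range (push F u)"
    using assms(1) by (auto simp: transversal_at_def)
  show "transversal_part F C u w = a" unfolding transversal_part_def
    by (rule the1_equality[OF transversal_decomposition(2)[OF t]]) (use assms(2) in blast)
  show "tangential_part F C u w = v" unfolding tangential_part_def
    by (rule the1_equality[OF transversal_decomposition(1)[OF t]]) (use assms(2) in blast)
qed

lemma transversal_split: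
  assumes "transversal_at F C u"
  shows "w = push F u (tangential_part F C u w) + transversal_part F C u w *\<^sub>R C u"
proof -
  obtain v a where "w = push F u v + a *\<^sub>R C u"
    using transversal_decomposition(3) assms unfolding transversal_at_def by meson
  with transversal_part_eqI[OF assms this] show ?thesis by simp
qed

lemma linear_transversal_part:
  assumes "transversal_at F C u"
  shows "linear (transversal_part F C u)"
proof -
  let ?v = "tangential_part F C u" and ?a = "transversal_part F C u"
  have lin: "linear (push F u)" using assms by (simp add: transversal_at_def)
  show ?thesis
  proof (rule linearI)
    show "?a (x + y) = ?a x + ?a y" for x y
    proof (rule transversal_part_eqI(1)[OF assms, of _ "?v x + ?v y"])
      show "x + y = push F u (?v x + ?v y) + (?a x + ?a y) *\<^sub>R C u"
        using transversal_split[OF assms, of x] transversal_split[OF assms, of y]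
        by (simp add: linear_add[OF lin] algebra_simps)
    qed
    show "?a (k *\<^sub>R x) = k *\<^sub>R ?a x" for x k
    proof (rule transversal_part_eqI(1)[OF assms, of _ "k *\<^sub>R ?v x"])
      have "k *\<^sub>R x = k *\<^sub>R (push F u (?v x) + ?a x *\<^sub>R C u)"
        using transversal_split[OF assms, of x] by simp
      then show "k *\<^sub>R x = push F u (k *\<^sub>R ?v x) + (k *\<^sub>R ?a x) *\<^sub>R C u"
        by (simp add: linear_scale[OF lin] algebra_simps)
    qed
  qed
qed

text \<open>Tangential parts do not contribute to the determinant, so \<open>h\<close> can be read off from second
  derivatives by determinants.\<close>

lemma det4_transversal_part:
  assumes "transversal_at F C u"
  shows "det4 (push F u a) (push F u b) (push F u c) w
    = transversal_part F C u w * det4 (push F u a) (push F u b) (push F u c) (C u)"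
proof -
  let ?D = "det4 (push F u a) (push F u b) (push F u c)"
  have "linear (push F u)" using assms by (simp add: transversal_at_def)
  then have "?D (push F u (tangential_part F C u w) + transversal_part F C u w *\<^sub>R C u)
      = transversal_part F C u w * ?D (C u)"
    by (simp add: det4_add_scale det4_range_eq_0)
  then show ?thesis using transversal_split[OF assms, of w] by simp
qed

lemma transversal_part_eq_0_iff:
  assumes "transversal_at F C u"
  shows "transversal_part F C u w = 0 \<longleftrightarrow> w \<in> range (push F u)"
proof
  show "transversal_part F C u w = 0 \<Longrightarrow> w \<in> range (push F u)"
    using transversal_split[OF assms, of w] by auto
  show "w \<in> range (push F u) \<Longrightarrow> transversal_part F C u w = 0"
    using transversal_part_eqI(1)[OF assms, of w _ 0] by auto
qed


section \<open>The ruled normal form\<close>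

text \<open>In the eigenspaces of \<open>J\<close> the coordinate \<open>z\<close> acts by the factors \<open>e\<^sup>-\<^sup>z\<close> and \<open>e\<^sup>z\<close>, the flow of
  \<open>- J\<close>, and \<open>y\<close> moves the second component along a line.\<close>

definition ruled :: "(real \<Rightarrow> real^2) \<Rightarrow> (real \<Rightarrow> real^2) \<Rightarrow> (real \<Rightarrow> real^2) \<Rightarrow> real^3 \<Rightarrow> real^4" where
  "ruled p q n v = PQ (exp (- (v$3)) *\<^sub>R p (v$1)) (exp (v$3) *\<^sub>R ((v$2) *\<^sub>R q (v$1) + n (v$1)))"

lemma open_slab: "open I \<Longrightarrow> open (slab I)"
  unfolding slab_def using open_vimage[of I "\<lambda>v::real^3. v$1"]
  by (simp add: vimage_def continuous_on_component)

lemma deriv_curve_frechet: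
  assumes "smooth_on I \<mu>" "x \<in> I"
  shows "(\<mu> has_derivative (\<lambda>t. t *\<^sub>R deriv_curve \<mu> x)) (at x)" "deriv_curve \<mu> x = frechet_derivative \<mu> (at x) 1"
proof -
  have d: "(\<mu> has_derivative frechet_derivative \<mu> (at x)) (at x)"
    by (rule smooth_on_has_derivative[OF assms])
  have e: "frechet_derivative \<mu> (at x) = (\<lambda>t. t *\<^sub>R frechet_derivative \<mu> (at x) 1)"
  proof
    show "frechet_derivative \<mu> (at x) t = t *\<^sub>R frechet_derivative \<mu> (at x) 1" for t
      using linear_scale[OF has_derivative_linear[OF d], of t 1] by simp
  qed
  have d': "(\<mu> has_derivative (\<lambda>t. t *\<^sub>R frechet_derivative \<mu> (at x) 1)) (at x)"
    using has_derivative_eq_rhs[OF d e] .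
  then show v: "deriv_curve \<mu> x = frechet_derivative \<mu> (at x) 1"
    unfolding deriv_curve_def by (intro vector_derivative_at) (simp add: has_vector_derivative_def)
  show "(\<mu> has_derivative (\<lambda>t. t *\<^sub>R deriv_curve \<mu> x)) (at x)"
    unfolding v by (rule d')
qed

lemma deriv_curve_minus:
  assumes "smooth_on I \<mu>" "x \<in> I"
  shows "deriv_curve (\<lambda>x. - \<mu> x) x = - deriv_curve \<mu> x"
proof -
  have "((\<lambda>x. - \<mu> x) has_vector_derivative - deriv_curve \<mu> x) (at x)"
    using has_derivative_minus[OF deriv_curve_frechet(1)[OF assms]] by (simp add: has_vector_derivative_def)
  then show ?thesis unfolding deriv_curve_def[of "\<lambda>x. - \<mu> x"] by (rule vector_derivative_at)
qed

lemma smooth_on_deriv_curve: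
  assumes "open I" "smooth_on I \<mu>"
  shows "smooth_on I (deriv_curve \<mu>)"
proof -
  have "smooth_on I (\<lambda>x. frechet_derivative \<mu> (at x) 1)"
    by (rule smooth_on_frechet[OF assms(2)])
  then show ?thesis
    by (subst smooth_on_cong[OF assms(1) deriv_curve_frechet(2)[OF assms(2)]])
qed

lemma bounded_linear_PQ_left: "bounded_linear (\<lambda>p. PQ p 0)"
  and bounded_linear_PQ_right: "bounded_linear (PQ 0)"
  by (auto intro!: linearI simp: linear_conv_bounded_linear[symmetric] PQ_add PQ_scale)

lemma PQ_split: "PQ p q = PQ p 0 + PQ 0 q"
  by (simp add: PQ_add)

lemma has_derivative_PQ:
  assumes "(p has_derivative p') F" "(q has_derivative q') F"
  shows "((\<lambda>x. PQ (p x) (q x)) has_derivative (\<lambda>h. PQ (p' h) (q' h))) F"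
  using has_derivative_add[OF bounded_linear.has_derivative[OF bounded_linear_PQ_left assms(1)]
      bounded_linear.has_derivative[OF bounded_linear_PQ_right assms(2)]]
  by (simp add: PQ_split[symmetric])

lemma smooth_on_PQ:
  assumes "open V" "smooth_on V p" "smooth_on V q"
  shows "smooth_on V (\<lambda>x. PQ (p x) (q x))"
  using smooth_on_add[OF assms(1) smooth_on_bounded_linear[OF bounded_linear_PQ_left assms(1,2)]
      smooth_on_bounded_linear[OF bounded_linear_PQ_right assms(1,3)]]
  by (simp add: PQ_split[symmetric])

lemma smooth_on_coord:
  "open I \<Longrightarrow> smooth_on I \<mu> \<Longrightarrow> smooth_on (slab I) (\<lambda>v. \<mu> (v$1))"
  by (rule smooth_on_compose[OF open_slab _ smooth_on_linear[OF bounded_linear_vec_nth open_slab]])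
    (auto simp: slab_def)

lemma smooth_on_ruled:
  assumes "open I" "smooth_on I p" "smooth_on I q" "smooth_on I n"
  shows "smooth_on (slab I) (ruled p q n)"
  unfolding ruled_def
  by (intro smooth_on_PQ smooth_on_scaleR smooth_on_add smooth_on_exp smooth_on_minus smooth_on_coord
      smooth_on_linear[OF bounded_linear_vec_nth] open_slab assms)

text \<open>All partial derivatives are again of the form \<^const>\<open>ruled\<close>, with other curves; so derivatives of
  every order come from this one rule.\<close>

lemma has_derivative_ruled:
  assumes "(p has_derivative (\<lambda>t. t *\<^sub>R p')) (at (v$1))" "(q has_derivative (\<lambda>t. t *\<^sub>R q')) (at (v$1))"
    "(n has_derivative (\<lambda>t. t *\<^sub>R n')) (at (v$1))"
  shows "(ruled p q n has_derivative (\<lambda>h. (h$1) *\<^sub>R ruled (\<lambda>_. p') (\<lambda>_. q') (\<lambda>_. n') v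
    + (h$2) *\<^sub>R ruled (\<lambda>_. 0) (\<lambda>_. 0) q v + (h$3) *\<^sub>R ruled (\<lambda>x. - p x) q n v)) (at v)"
proof -
  have c: "((\<lambda>v::real^3. \<mu> (v$1)) has_derivative (\<lambda>h. (h$1) *\<^sub>R \<mu>')) (at v)"
    if "(\<mu> has_derivative (\<lambda>t. t *\<^sub>R \<mu>')) (at (v$1))" for \<mu> :: "real \<Rightarrow> real^2" and \<mu>'
    using diff_chain_at[OF bounded_linear.has_derivative[OF bounded_linear_vec_nth has_derivative_ident] that]
    by (simp add: o_def)
  note d = c[OF assms(1)] c[OF assms(2)] c[OF assms(3)]
  have "(ruled p q n has_derivative (\<lambda>h.
    PQ (exp (- (v$3)) *\<^sub>R (h$1) *\<^sub>R p' + (- (h$3) * exp (- (v$3))) *\<^sub>R p (v$1))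
      (exp (v$3) *\<^sub>R ((v$2) *\<^sub>R (h$1) *\<^sub>R q' + (h$2) *\<^sub>R q (v$1) + (h$1) *\<^sub>R n')
        + (h$3 * exp (v$3)) *\<^sub>R ((v$2) *\<^sub>R q (v$1) + n (v$1))))) (at v)"
    unfolding ruled_def
    by (rule has_derivative_PQ)
      (auto intro!: derivative_eq_intros d bounded_linear.has_derivative[OF bounded_linear_vec_nth] simp: algebra_simps)
  then show ?thesis
    by (rule has_derivative_eq_rhs) (auto simp: ruled_def PQ_add PQ_scale fun_eq_iff algebra_simps)
qed

text \<open>After row operations and the change of basis by \<^const>\<open>PQ\<close> the matrices are block triangular, so
  their determinants are products of planar ones.\<close>

lemma det4_PQ:
  "det4 (PQ a b) (PQ 0 c) (PQ (- d) e) (PQ d e) = - 8 * (det2 d a * det2 c e)"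
  "det4 (PQ a b) (PQ 0 c) (PQ (- d) e) (PQ 0 f) = - 4 * (det2 d a * det2 c f)"
  unfolding det4_expand det2_expand PQ_nth by (simp_all add: algebra_simps)

text \<open>The determinants that belong to the frame \<open>F\<^sub>x, F\<^sub>y, F\<^sub>z\<close>, completed by \<open>F\<close> and by \<open>F\<^sub>x\<^sub>y\<close>. They are
  independent of \<open>z\<close> because the factors \<open>e\<^sup>z\<close> and \<open>e\<^sup>-\<^sup>z\<close> cancel, and of \<open>y\<close> because adding
  multiples of \<open>q\<close> to \<open>n\<close> does not change \<open>det(q, n)\<close>.\<close>

lemma det4_ruled:
  defines "R \<equiv> \<lambda>p q n v. ruled (\<lambda>_. p) (\<lambda>_. q) (\<lambda>_. n) v"
  shows "det4 (R p' q' n' v) (R 0 0 q v) (R (- p) q n v) (R p q n v) = - 8 * (det2 p p' * det2 q n)"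
    "det4 (R p' q' n' v) (R 0 0 q v) (R (- p) q n v) (R 0 0 q' v) = - 4 * (det2 p p' * det2 q q')"
proof -
  define s t y where "s = exp (- (v$3))" and "t = exp (v$3)" and "y = v$2"
  have st: "s * t = 1" by (simp add: s_def t_def exp_minus)
  have R: "R p q n v = PQ (s *\<^sub>R p) (t *\<^sub>R (y *\<^sub>R q + n))" for p q n
    by (simp add: R_def ruled_def s_def t_def y_def)
  have d: "det2 (s *\<^sub>R p) (s *\<^sub>R p') * det2 (t *\<^sub>R q) (t *\<^sub>R n) = det2 p p' * det2 q n" for p p' q n
  proof -
    have "det2 (s *\<^sub>R p) (s *\<^sub>R p') * det2 (t *\<^sub>R q) (t *\<^sub>R n) = (s * t)\<^sup>2 * (det2 p p' * det2 q n)"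
      by (simp add: det2_expand power2_eq_square algebra_simps)
    then show ?thesis using st by simp
  qed
  have e: "det2 (t *\<^sub>R q) (t *\<^sub>R (y *\<^sub>R q + n)) = det2 (t *\<^sub>R q) (t *\<^sub>R n)" for q n
    by (simp add: det2_expand algebra_simps)
  show "det4 (R p' q' n' v) (R 0 0 q v) (R (- p) q n v) (R p q n v) = - 8 * (det2 p p' * det2 q n)"
    using det4_PQ(1)[of "s *\<^sub>R p'" _ "t *\<^sub>R q" "s *\<^sub>R p"] unfolding R by (simp add: e d)
  show "det4 (R p' q' n' v) (R 0 0 q v) (R (- p) q n v) (R 0 0 q' v) = - 4 * (det2 p p' * det2 q q')"
    using det4_PQ(2)[of "s *\<^sub>R p'" _ "t *\<^sub>R q" "s *\<^sub>R p"] unfolding R by (simp add: d)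
qed


subsection \<open>Hypersurfaces in normal form\<close>

text \<open>The map is prescribed on \<open>V\<close> only, since coordinate representations have arbitrary values outside
  the range of the chart. The domain \<open>V\<close> is the whole slab for the parametrised hypersurfaces and a
  coordinate box for the local normal form.\<close>

locale ruled_hypersurface =
  fixes I :: "real set" and p q n :: "real \<Rightarrow> real^2" and V :: "(real^3) set" and F :: "real^3 \<Rightarrow> real^4"
  assumes I: "open I" and smooth: "smooth_on I p" "smooth_on I q" "smooth_on I n"
    and V: "open V" "V \<subseteq> slab I" and F_eq: "\<And>v. v \<in> V \<Longrightarrow> F v = ruled p q n v"
begin

abbreviation "d1 \<equiv> deriv_curve"
abbreviation "d2 \<mu> \<equiv> deriv_curve (deriv_curve \<mu>)"

lemma smooth_d1: "smooth_on I (d1 p)" "smooth_on I (d1 q)" "smooth_on I (d1 n)"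
  using smooth_on_deriv_curve I smooth by auto

lemma smooth_F: "smooth_on V F"
  by (subst smooth_on_cong[OF V(1), of F "ruled p q n"])
    (auto simp: F_eq intro: smooth_on_subset[OF smooth_on_ruled[OF I smooth] V(2)])

lemma has_derivative_ruled_curve:
  assumes "smooth_on I p'" "smooth_on I q'" "smooth_on I n'" "v \<in> V"
  shows "(ruled p' q' n' has_derivative (\<lambda>h. (h$1) *\<^sub>R ruled (d1 p') (d1 q') (d1 n') v
    + (h$2) *\<^sub>R ruled (\<lambda>_. 0) (\<lambda>_. 0) q' v + (h$3) *\<^sub>R ruled (\<lambda>x. - p' x) q' n' v)) (at v)"
proof -
  have "v$1 \<in> I" using assms(4) V(2) by (auto simp: slab_def)
  note d = deriv_curve_frechet(1)[OF _ this]
  show ?thesis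
    using has_derivative_ruled[OF d[OF assms(1)] d[OF assms(2)] d[OF assms(3)]] by (simp add: ruled_def)
qed

lemma push_F:
  assumes "v \<in> V"
  shows "push F v a = (a$1) *\<^sub>R ruled (d1 p) (d1 q) (d1 n) v
    + (a$2) *\<^sub>R ruled (\<lambda>_. 0) (\<lambda>_. 0) q v + (a$3) *\<^sub>R ruled (\<lambda>x. - p x) q n v"
  by (subst push_eqI[OF has_derivative_transform_within_open[OF has_derivative_ruled_curve[OF smooth assms] V(1) assms]])
    (simp_all add: F_eq)

lemma push_axis:
  assumes "v \<in> V"
  shows "push F v (axis 1 1) = ruled (d1 p) (d1 q) (d1 n) v"
    "push F v (axis 2 1) = ruled (\<lambda>_. 0) (\<lambda>_. 0) q v"
    "push F v (axis 3 1) = ruled (\<lambda>x. - p x) q n v"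
  unfolding push_F[OF assms] by (simp_all add: axis_def)

text \<open>The coefficient of \<open>a\<^sub>2 b\<^sub>2\<close> is zero, that of the \<open>yz\<close>-term is \<open>F\<^sub>y\<close>, and \<open>F\<^sub>z\<^sub>z = F\<close>. Everything about
  \<open>h\<close> follows from this.\<close>

lemma push2_F:
  assumes "v \<in> V"
  shows "push2 F v a b =
    (a$1 * b$1) *\<^sub>R ruled (d2 p) (d2 q) (d2 n) v
    + (a$1 * b$2 + a$2 * b$1) *\<^sub>R ruled (\<lambda>_. 0) (\<lambda>_. 0) (d1 q) v
    + (a$1 * b$3 + a$3 * b$1) *\<^sub>R ruled (\<lambda>x. - d1 p x) (d1 q) (d1 n) v
    + (a$2 * b$3 + a$3 * b$2) *\<^sub>R ruled (\<lambda>_. 0) (\<lambda>_. 0) q v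
    + (a$3 * b$3) *\<^sub>R F v"
proof -
  have x: "v$1 \<in> I" using assms V(2) by (auto simp: slab_def)
  have z: "smooth_on I (\<lambda>_. 0 :: real^2)" using I by simp
  have mp: "smooth_on I (\<lambda>x. - p x)" by (rule smooth_on_minus[OF I smooth(1)])
  have d0: "d1 (\<lambda>_. 0 :: real^2) = (\<lambda>_. 0)" by (simp add: deriv_curve_def fun_eq_iff)
  have dm: "d1 (\<lambda>x. - p x) (v$1) = - d1 p (v$1)"
    by (rule deriv_curve_minus[OF smooth(1) x])
  note D = has_derivative_ruled_curve[OF smooth_d1 assms]
    has_derivative_ruled_curve[OF z z smooth(2) assms] has_derivative_ruled_curve[OF mp smooth(2,3) assms]
  show ?thesis
    by (rule trans[OF push2_eqI[OF V(1) assms push_F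
          has_derivative_add[OF has_derivative_add[OF has_derivative_scaleR_right[OF D(1)]
            has_derivative_scaleR_right[OF D(2)]] has_derivative_scaleR_right[OF D(3)]]]])
      (simp_all add: F_eq[OF assms] d0 dm ruled_def PQ_zero[symmetric] PQ_scale PQ_add algebra_simps)
qed

lemma det4_frame_F:
  assumes "v \<in> V"
  shows "det4 (push F v (axis 1 1)) (push F v (axis 2 1)) (push F v (axis 3 1)) (F v)
      = - 8 * (det2 (p (v$1)) (d1 p (v$1)) * det2 (q (v$1)) (n (v$1)))" (is ?A)
    "det4 (push F v (axis 1 1)) (push F v (axis 2 1)) (push F v (axis 3 1)) (push2 F v (axis 1 1) (axis 2 1))
      = - 4 * (det2 (p (v$1)) (d1 p (v$1)) * det2 (q (v$1)) (d1 q (v$1)))" (is ?B)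
proof -
  have c: "ruled p' q' n' v = ruled (\<lambda>_. p' (v$1)) (\<lambda>_. q' (v$1)) (\<lambda>_. n' (v$1)) v" for p' q' n'
    by (simp add: ruled_def)
  show ?A unfolding push_axis[OF assms] F_eq[OF assms]
    by (subst (1 2 3 4) c) (rule det4_ruled(1))
  have xy: "push2 F v (axis 1 1) (axis 2 1) = ruled (\<lambda>_. 0) (\<lambda>_. 0) (d1 q) v"
    unfolding push2_F[OF assms] by (simp add: axis_def)
  show ?B unfolding push_axis[OF assms] xy
    by (subst (1 2 3 4) c) (rule det4_ruled(2))
qed

lemma linear_push_F: "v \<in> V \<Longrightarrow> linear (push F v)"
  by (rule linear_push[OF smooth_F])

lemma transversal_F:
  assumes "v \<in> V" "C v = r *\<^sub>R F v" "r \<noteq> 0"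
    and "det2 (p (v$1)) (d1 p (v$1)) \<noteq> 0" "det2 (q (v$1)) (n (v$1)) \<noteq> 0"
  shows "transversal_at F C v"
proof -
  have "det4 (push F v (axis 1 1)) (push F v (axis 2 1)) (push F v (axis 3 1)) (C v) \<noteq> 0"
    using det4_frame_F(1)[OF assms(1)] assms(2-5) det4_add_scale[of _ _ _ 0 r "F v"]
    by (simp add: det4_zero)
  from det4_nonzero[OF this linear_push_F[OF assms(1)]] show ?thesis
    unfolding transversal_at_def using linear_push_F[OF assms(1)] by blast
qed

text \<open>By the formula for the second derivatives, the only entries of \<open>h\<close> in the rows of \<open>y\<close> and \<open>z\<close> that
  can be nonzero are \<open>h\<^sub>y\<^sub>x\<close>, \<open>h\<^sub>z\<^sub>x\<close> and \<open>h\<^sub>z\<^sub>z = 1/r\<close>. The entry \<open>h\<^sub>x\<^sub>y\<close> is the quotient of the two determinants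
  computed above.\<close>

lemma h_at_F:
  assumes v: "v \<in> V" and C: "C v = r *\<^sub>R F v" "r \<noteq> 0" and t: "transversal_at F C v"
  defines "h \<equiv> h_at F C v"
  shows "h a b = h (axis 1 1) (axis 1 1) * (a$1 * b$1) + h (axis 1 1) (axis 2 1) * (a$1 * b$2 + a$2 * b$1)
      + h (axis 1 1) (axis 3 1) * (a$1 * b$3 + a$3 * b$1) + (a$3 * b$3) / r"
    "h (axis 1 1) (axis 2 1) * (- 8 * r * (det2 (p (v$1)) (d1 p (v$1)) * det2 (q (v$1)) (n (v$1))))
      = - 4 * (det2 (p (v$1)) (d1 p (v$1)) * det2 (q (v$1)) (d1 q (v$1)))"
proof -
  note lin = linear_transversal_part[OF t]
  have "transversal_part F C v (F v) = 1 / r"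
    by (rule transversal_part_eqI(1)[OF t, of _ 0]) (simp add: C linear_0[OF linear_push_F[OF v]])
  moreover have "transversal_part F C v (ruled (\<lambda>_. 0) (\<lambda>_. 0) q v) = 0"
    unfolding transversal_part_eq_0_iff[OF t] push_axis(2)[OF v, symmetric] by simp
  ultimately show "h a b = h (axis 1 1) (axis 1 1) * (a$1 * b$1) + h (axis 1 1) (axis 2 1) * (a$1 * b$2 + a$2 * b$1)
      + h (axis 1 1) (axis 3 1) * (a$1 * b$3 + a$3 * b$1) + (a$3 * b$3) / r"
    unfolding h_def h_at_push2 push2_F[OF v]
    by (simp add: linear_add[OF lin] linear_scale[OF lin] axis_def)
  show "h (axis 1 1) (axis 2 1) * (- 8 * r * (det2 (p (v$1)) (d1 p (v$1)) * det2 (q (v$1)) (n (v$1))))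
      = - 4 * (det2 (p (v$1)) (d1 p (v$1)) * det2 (q (v$1)) (d1 q (v$1)))"
    unfolding h_def h_at_push2
    using det4_frame_F[OF v] det4_add_scale[of _ _ _ 0 r "F v"]
      det4_transversal_part[OF t, of "axis 1 1" "axis 2 1" "axis 3 1" "push2 F v (axis 1 1) (axis 2 1)"]
    by (simp add: C det4_zero mult.assoc mult.left_commute)
qed

lemma det_h_at_F:
  assumes v: "v \<in> V" and C: "C v = r *\<^sub>R F v" "r \<noteq> 0" and t: "transversal_at F C v"
  shows "det (\<chi> i j. h_at F C v (axis i 1) (axis j 1)) = - (h_at F C v (axis 1 1) (axis 2 1))\<^sup>2 / r"
proof -
  let ?h = "\<lambda>i j. h_at F C v (axis i 1) (axis j 1)"
  note h = h_at_F(1)[OF assms]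
  have "?h 2 1 = ?h 1 2" "?h 2 2 = 0" "?h 2 3 = 0" "?h 3 2 = 0" "?h 3 3 = 1 / r"
    using h[of "axis 2 1" "axis 1 1"] h[of "axis 2 1" "axis 2 1"] h[of "axis 2 1" "axis 3 1"]
      h[of "axis 3 1" "axis 2 1"] h[of "axis 3 1" "axis 3 1"]
    by (simp_all add: axis_nth_if)
  then show ?thesis unfolding det_3 by (simp add: power2_eq_square)
qed

text \<open>The equation \<open>\<bar>det h\<bar> = \<Theta>\<^sup>2\<close> on the coordinate frame, which is what equality of the two volume
  elements means there, becomes a relation between three planar determinants: \<open>\<Theta> = - 8 r pp qn\<close>,
  \<open>h\<^sub>x\<^sub>y = qq / (2 r qn)\<close> and \<open>det h = - h\<^sub>x\<^sub>y\<^sup>2 / r\<close>.\<close>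

lemma volume_condition_F:
  assumes v: "v \<in> V" and C: "C v = r *\<^sub>R F v" "r \<noteq> 0" and t: "transversal_at F C v"
  defines "pp \<equiv> det2 (p (v$1)) (d1 p (v$1))" and "qq \<equiv> det2 (q (v$1)) (d1 q (v$1))"
    and "qn \<equiv> det2 (q (v$1)) (n (v$1))"
  shows "pp \<noteq> 0" "qn \<noteq> 0"
    and "\<bar>det (\<chi> i j. h_at F C v (axis i 1) (axis j 1))\<bar>
        = (det4 (push F v (axis 1 1)) (push F v (axis 2 1)) (push F v (axis 3 1)) (C v))\<^sup>2
      \<longleftrightarrow> qq\<^sup>2 = 256 * \<bar>r\<bar>^5 * pp\<^sup>2 * qn^4" (is "\<bar>?det\<bar> = ?D\<^sup>2 \<longleftrightarrow> _")
proof -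
  have D: "?D = - 8 * r * (pp * qn)"
    using det4_frame_F(1)[OF v] det4_add_scale[of _ _ _ 0 r "F v"] by (simp add: C det4_zero pp_def qn_def)
  have "?D \<noteq> 0"
    using t transversal_decomposition(4) unfolding transversal_at_def by blast
  then show nz: "pp \<noteq> 0" "qn \<noteq> 0" using D by auto
  define x where "x = h_at F C v (axis 1 1) (axis 2 1)"
  have "x * (- 8 * r * (pp * qn)) = - 4 * (pp * qq)"
    using h_at_F(2)[OF v C t] unfolding pp_def qn_def qq_def x_def .
  then have "pp * (2 * r * qn * x) = pp * qq" by (simp add: algebra_simps)
  then have qq: "qq = 2 * r * qn * x" using nz(1) by simp
  have d: "\<bar>?det\<bar> = x\<^sup>2 / \<bar>r\<bar>"
    unfolding det_h_at_F[OF v C t] x_def by (simp add: abs_mult abs_divide)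
  have "\<bar>?det\<bar> = ?D\<^sup>2 \<longleftrightarrow> x\<^sup>2 = \<bar>r\<bar> * (64 * r\<^sup>2 * pp\<^sup>2 * qn\<^sup>2)"
    using C(2) unfolding D d by (simp add: field_simps power_mult_distrib)
  also have "\<dots> \<longleftrightarrow> (4 * r\<^sup>2 * qn\<^sup>2) * x\<^sup>2 = (4 * r\<^sup>2 * qn\<^sup>2) * (\<bar>r\<bar> * (64 * r\<^sup>2 * pp\<^sup>2 * qn\<^sup>2))"
    by (rule mult_left_cancel[symmetric]) (use C(2) nz(2) in simp)
  also have "(4 * r\<^sup>2 * qn\<^sup>2) * x\<^sup>2 = qq\<^sup>2"
    unfolding qq by (simp add: power_mult_distrib)
  also have "(4 * r\<^sup>2 * qn\<^sup>2) * (\<bar>r\<bar> * (64 * r\<^sup>2 * pp\<^sup>2 * qn\<^sup>2)) = 256 * \<bar>r\<bar>^5 * pp\<^sup>2 * qn^4"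
    using power2_abs[of r] by (simp add: power_numeral_reduce flip: power2_abs[of r])
  finally show "\<bar>?det\<bar> = ?D\<^sup>2 \<longleftrightarrow> qq\<^sup>2 = 256 * \<bar>r\<bar>^5 * pp\<^sup>2 * qn^4" .
qed


lemma flat_D_F:
  assumes "v \<in> V" "\<And>v. v \<in> V \<Longrightarrow> C v = r *\<^sub>R F v"
  shows "flat_D (\<lambda>_. a) C v = r *\<^sub>R push F v a"
proof -
  have "((\<lambda>v. r *\<^sub>R F v) has_derivative (\<lambda>a. r *\<^sub>R push F v a)) (at v)"
    by (rule has_derivative_scaleR_right[OF has_derivative_push[OF smooth_F assms(1)]])
  then have "(C has_derivative (\<lambda>a. r *\<^sub>R push F v a)) (at v)"
    by (rule has_derivative_transform_within_open[OF _ V(1) assms(1)]) (simp add: assms(2))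
  then show ?thesis
    unfolding flat_D_def by (simp add: frechet_derivative_at[symmetric])
qed

text \<open>A ruled map with the volume relation is an affine hypersphere centred at the origin. Since \<open>h\<close> is
  bilinear, both volume elements on a frame \<open>T\<close> are those on the coordinate frame multiplied by \<open>\<bar>det T\<bar>\<close>
  and \<open>det T\<close>, so the relation on the coordinate frame is enough. The field \<open>JC\<close> is tangent because
  \<open>JF = - F\<^sub>z\<close>. A tangent vector lies in the eigenspace for \<open>- 1\<close> iff its component along the independent
  vectors \<open>p, p'\<close> vanishes, which leaves the multiples of \<open>F\<^sub>y\<close>.\<close>

lemma equiaffine_sphere_F:
  assumes r: "r \<noteq> 0" and C: "\<And>v. v \<in> V \<Longrightarrow> C v = r *\<^sub>R F v"
    and pp: "\<And>v. v \<in> V \<Longrightarrow> det2 (p (v$1)) (d1 p (v$1)) \<noteq> 0"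
    and qn: "\<And>v. v \<in> V \<Longrightarrow> det2 (q (v$1)) (n (v$1)) \<noteq> 0"
    and vol: "\<And>v. v \<in> V \<Longrightarrow> (det2 (q (v$1)) (d1 q (v$1)))\<^sup>2
        = 256 * \<bar>r\<bar>^5 * (det2 (p (v$1)) (d1 p (v$1)))\<^sup>2 * (det2 (q (v$1)) (n (v$1)))^4"
  shows "immersion_on V F" "transversal_on V F C" "nondegenerate_on V F" "blaschke_on V F C"
    and "\<And>v a. v \<in> V \<Longrightarrow> shape_operator F C v a = (- r) *\<^sub>R a"
    and "\<And>v. v \<in> V \<Longrightarrow> J (C v) \<in> range (push F v)"
    and "\<And>v. v \<in> V \<Longrightarrow> {a. J (push F v a) = - push F v a} = span {axis 2 1}"
    and "\<And>v a. v \<in> V \<Longrightarrow> a \<in> span {axis 2 1} \<Longrightarrow> h_at F C v a a = 0"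
proof -
  have t: "transversal_at F C v" if "v \<in> V" for v
    by (rule transversal_F[of v C r]) (use that C r pp qn in auto)
  show imm: "immersion_on V F"
    unfolding immersion_on_def using smooth_F t by (auto simp: transversal_at_def)
  have "smooth_on V (\<lambda>v. r *\<^sub>R F v)"
    using smooth_F V(1) by (intro smooth_on_scaleR smooth_on_const)
  then have smC: "smooth_on V C"
    by (subst smooth_on_cong[OF V(1) C])
  then show tr: "transversal_on V F C"
    unfolding transversal_on_def using t by (auto simp: transversal_at_def)
  note h = h_at_F(1)[of _ C r, OF _ C r t]
  have xy: "h_at F C v (axis 1 1) (axis 2 1) \<noteq> 0" if "v \<in> V" for v
    using h_at_F(2)[of v C r, OF that C[OF that] r t[OF that]] pp[OF that] qn[OF that] vol[OF that] r by auto
  have "a = 0" if v: "v \<in> V" and a: "\<And>w. h_at F C v a w = 0" for v a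
  proof -
    have 1: "a$1 = 0"
      using a[of "axis 2 1"] h[OF v v v, of a "axis 2 1"] xy[OF v] by (simp add: axis_nth_if)
    have 3: "a$3 = 0"
      using a[of "axis 3 1"] h[OF v v v, of a "axis 3 1"] 1 r by (simp add: axis_nth_if)
    have "a$2 = 0"
      using a[of "axis 1 1"] h[OF v v v, of a "axis 1 1"] xy[OF v] 1 3 by (simp add: axis_nth_if)
    with 1 3 show "a = 0" by (simp add: vec_eq_iff forall_3)
  qed
  then show "nondegenerate_on V F"
    unfolding nondegenerate_on_def using tr by blast
  have shape: "transversal_connection_form F C v a = 0" "shape_operator F C v a = (- r) *\<^sub>R a" if v: "v \<in> V" for v a
  proof -
    have "flat_D (\<lambda>_. a) C v = r *\<^sub>R push F v a"
      by (rule flat_D_F[OF v C])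
    then have "flat_D (\<lambda>_. a) C v = push F v (r *\<^sub>R a) + 0 *\<^sub>R C v"
      by (simp add: linear_scale[OF linear_push_F[OF v]])
    from transversal_part_eqI[OF t[OF v] this]
    show "transversal_connection_form F C v a = 0" "shape_operator F C v a = (- r) *\<^sub>R a"
      by (simp_all add: transversal_connection_form_def shape_operator_def)
  qed
  then show "\<And>v a. v \<in> V \<Longrightarrow> shape_operator F C v a = (- r) *\<^sub>R a" by blast
  have "metric_volume F C v T = induced_volume F C v T" if v: "v \<in> V" and pos: "induced_volume F C v T > 0" for v T
  proof -
    define H :: "real^3^3" where "H = (\<chi> i j. h_at F C v (axis i 1) (axis j 1))"
    define D where "D = det4 (push F v (axis 1 1)) (push F v (axis 2 1)) (push F v (axis 3 1)) (C v)"
    have "h_at F C v a b = (\<Sum>i\<in>UNIV. \<Sum>j\<in>UNIV. a$i * H$i$j * b$j)" for a b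
      using h[OF v v v, of a b] h[OF v v v, of "axis 2 1" "axis 1 1"] h[OF v v v, of "axis 2 1" "axis 2 1"]
        h[OF v v v, of "axis 2 1" "axis 3 1"] h[OF v v v, of "axis 3 1" "axis 1 1"]
        h[OF v v v, of "axis 3 1" "axis 2 1"] h[OF v v v, of "axis 3 1" "axis 3 1"]
      by (simp add: sum_3 H_def axis_nth_if algebra_simps)
    then have "det (\<chi> i j. h_at F C v (T$i) (T$j)) = (det T)\<^sup>2 * det H"
      by (rule bilinear_frame_det)
    moreover have "\<bar>det H\<bar> = D\<^sup>2"
      using volume_condition_F(3)[of v C r, OF v C[OF v] r t[OF v]] vol[OF v] by (simp add: H_def D_def)
    ultimately have "\<bar>det (\<chi> i j. h_at F C v (T$i) (T$j))\<bar> = (det T * D)\<^sup>2"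
      by (simp add: abs_mult power_mult_distrib)
    moreover have "induced_volume F C v T = det T * D"
      using det4_frame[OF linear_push_F[OF v]] by (simp add: induced_volume_def det4_def D_def)
    ultimately show ?thesis
      using pos by (simp add: metric_volume_def)
  qed
  then show "blaschke_on V F C"
    unfolding blaschke_on_def using tr shape by blast
  show "J (C v) \<in> range (push F v)" if v: "v \<in> V" for v
  proof -
    have "J (C v) = push F v (- r *\<^sub>R axis 3 1)"
      unfolding linear_scale[OF linear_push_F[OF v]] push_axis[OF v] C[OF v] linear_scale[OF linear_J] F_eq[OF v]
      by (simp add: ruled_def J_PQ PQ_scale)
    then show ?thesis by simp
  qed
  show D: "{a. J (push F v a) = - push F v a} = span {axis 2 1}" if v: "v \<in> V" for v
  proof -
    have "J (push F v a) = - push F v a \<longleftrightarrow> a$1 = 0 \<and> a$3 = 0" for a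
    proof -
      define x where "x = v$1"
      have "push F v a = PQ (exp (- (v$3)) *\<^sub>R (a$1 *\<^sub>R d1 p x - a$3 *\<^sub>R p x))
        (exp (v$3) *\<^sub>R (a$1 *\<^sub>R (v$2 *\<^sub>R d1 q x + d1 n x) + a$2 *\<^sub>R q x + a$3 *\<^sub>R (v$2 *\<^sub>R q x + n x)))"
        unfolding push_F[OF v] by (simp add: ruled_def x_def PQ_scale PQ_add algebra_simps)
      then have "J (push F v a) = - push F v a \<longleftrightarrow> a$1 *\<^sub>R d1 p x - a$3 *\<^sub>R p x = 0"
        by (simp add: J_PQ_eq_minus_iff)
      also have "\<dots> \<longleftrightarrow> a$1 = 0 \<and> a$3 = 0"
      proof
        assume e: "a$1 *\<^sub>R d1 p x - a$3 *\<^sub>R p x = 0"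
        have "a$1 * det2 (p x) (d1 p x) = det2 (p x) (a$1 *\<^sub>R d1 p x - a$3 *\<^sub>R p x)"
          "a$3 * det2 (p x) (d1 p x) = det2 (a$3 *\<^sub>R p x - a$1 *\<^sub>R d1 p x) (d1 p x)"
          by (simp_all add: det2_expand algebra_simps)
        moreover have "a$3 *\<^sub>R p x - a$1 *\<^sub>R d1 p x = 0" using e by simp
        ultimately have "a$1 * det2 (p x) (d1 p x) = 0" "a$3 * det2 (p x) (d1 p x) = 0"
          using e by (simp_all add: det2_expand)
        then show "a$1 = 0 \<and> a$3 = 0"
          using pp[OF v] by (simp add: x_def)
      qed auto
      finally show ?thesis .
    qed
    moreover have "a \<in> span {axis 2 1} \<longleftrightarrow> a$1 = 0 \<and> a$3 = 0" for a :: "real^3"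
    proof
      assume "a$1 = 0 \<and> a$3 = 0"
      then have "a = a$2 *\<^sub>R axis 2 1" by (simp add: vec_eq_iff forall_3 axis_nth_if)
      then show "a \<in> span {axis 2 1}" by (metis insertI1 span_base span_scale)
    qed (auto simp: span_singleton axis_nth_if)
    ultimately show ?thesis by blast
  qed
  show "h_at F C v a a = 0" if "v \<in> V" "a \<in> span {axis 2 1}" for v a
    using h[OF that(1) that(1) that(1), of a a] that(2) by (auto simp: span_singleton axis_nth_if)
qed

end


section \<open>The parametrised hypersurfaces\<close>

text \<open>An eigenvector of \<open>J\<close> in the tangent space automatically lies in the largest \<open>J\<close>-invariant
  subspace of it.\<close>

lemma D_minus_eq:
  assumes "linear (push (local_rep c f) u)"
  shows "D_minus f c u = {v. J (push (local_rep c f) u v) = - push (local_rep c f) u v}"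
proof -
  have "push (local_rep c f) u v = J (push (local_rep c f) u (- v))"
    if "J (push (local_rep c f) u v) = - push (local_rep c f) u v" for v
    using that by (simp add: linear_neg[OF assms] linear_neg[OF linear_J])
  then show ?thesis unfolding D_minus_def D_dist_def by blast
qed

lemma smooth_on_B_fun:
  assumes "admissible I \<alpha> \<beta> A E"
  shows "smooth_on I (B_fun \<alpha> \<beta> E)"
  unfolding B_fun_def
proof (rule smooth_on_divide)
  have *: "open I" "smooth_on I \<alpha>" "smooth_on I \<beta>"
    and nz: "\<And>x. x \<in> I \<Longrightarrow> det2 (\<alpha> x) (deriv_curve \<alpha> x) * det2 (\<beta> x) (deriv_curve \<beta> x) \<noteq> 0"
    using assms by (auto simp: admissible_def)
  show "open I" "smooth_on I (\<lambda>_. E)" using * by auto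
  show "smooth_on I (\<lambda>x. sqrt \<bar>det2 (\<alpha> x) (deriv_curve \<alpha> x) * det2 (\<beta> x) (deriv_curve \<beta> x)\<bar>)"
    by (intro smooth_on_sqrt_abs smooth_on_mult smooth_on_bilinear[OF bounded_bilinear_det2]
        smooth_on_deriv_curve * nz)
  show "sqrt \<bar>det2 (\<alpha> x) (deriv_curve \<alpha> x) * det2 (\<beta> x) (deriv_curve \<beta> x)\<bar> \<noteq> 0" if "x \<in> I" for x
    using nz[OF that] by simp
qed

lemma f_map_eq_ruled:
  "f_map \<alpha> \<beta> A E = ruled \<beta> (\<lambda>x. - \<alpha> x) (\<lambda>x. - (A x *\<^sub>R \<alpha> x + B_fun \<alpha> \<beta> E x *\<^sub>R deriv_curve \<alpha> x))"
proof
  fix v :: "real^3"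
  define x y z where "x = v$1" and "y = v$2" and "z = v$3"
  define c where "c = (y + A x) *\<^sub>R \<alpha> x + B_fun \<alpha> \<beta> E x *\<^sub>R deriv_curve \<alpha> x"
  have g: "g_map \<alpha> \<beta> A E x y = PQ (\<beta> x) c"
  proof -
    have "join \<mu> (- \<mu>) = PQ 0 \<mu>" "join \<mu> \<mu> = PQ \<mu> 0" for \<mu> by (simp_all add: PQ_def)
    then show ?thesis by (simp add: g_map_def PQ_scale PQ_add c_def)
  qed
  have "f_map \<alpha> \<beta> A E v = PQ ((cosh z - sinh z) *\<^sub>R \<beta> x) (- (cosh z + sinh z) *\<^sub>R c)"
    unfolding f_map_def by (simp add: g[unfolded x_def y_def] x_def y_def z_def J_PQ PQ_scale PQ_diff algebra_simps)
  then show "f_map \<alpha> \<beta> A E v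
      = ruled \<beta> (\<lambda>x. - \<alpha> x) (\<lambda>x. - (A x *\<^sub>R \<alpha> x + B_fun \<alpha> \<beta> E x *\<^sub>R deriv_curve \<alpha> x)) v"
    by (simp add: cosh_minus_sinh cosh_plus_sinh ruled_def c_def x_def y_def z_def algebra_simps)
qed

lemma local_rep_id: "v \<in> S \<Longrightarrow> local_rep (S, id) f v = f v"
  by (simp add: local_rep_def inv_into_f_f)

lemma second_countable_euclidean:
  "second_countable (euclidean :: 'a::second_countable_topology topology)"
proof -
  obtain B :: "'a set set" where "countable B" "topological_basis B"
    using ex_countable_basis by blast
  moreover have "open V" if "V \<in> B" for V
    using topological_basis_open[OF calculation(2) that] .
  moreover have "\<exists>V\<in>B. x \<in> V \<and> V \<subseteq> U" if "open U" "x \<in> U" for U x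
    using topological_basisE[OF calculation(2) that] by metis
  ultimately show ?thesis
    unfolding second_countable_def by (intro exI[of _ B]) auto
qed

lemma manifold_of_open_convex:
  assumes "open (S :: (real^3) set)" "convex S"
  shows "connected_orientable_3manifold (top_of_set S) {(S, id)}"
    and "u \<in> S \<Longrightarrow> frechet_derivative (local_rep (S, id) id) (at u) = (\<lambda>h. h)"
proof -
  have d: "frechet_derivative (local_rep (S, id) id) (at u) = (\<lambda>h. h)" if "u \<in> S" for u
  proof -
    have "(local_rep (S, id) id has_derivative (\<lambda>h. h)) (at u)"
      using has_derivative_transform_within_open[OF has_derivative_ident[of "at u"] assms(1) that, of "local_rep (S, id) id"]
      by (simp add: local_rep_id)
    then show ?thesis by (rule frechet_derivative_at[symmetric])
  qed
  then show "u \<in> S \<Longrightarrow> frechet_derivative (local_rep (S, id) id) (at u) = (\<lambda>h. h)" .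
  have "smooth_on S (local_rep (S, id) id)"
    using smooth_on_cong[OF assms(1), of "local_rep (S, id) id" "\<lambda>x. x"] assms(1) by (simp add: local_rep_id)
  then have comp: "compatible (S, id) (S, id)"
    by (simp add: compatible_def overlap_def)
  have chart: "is_chart (top_of_set S) (S, id)"
    using assms(1) by (simp add: is_chart_def chart_range_def subtopology_subtopology)
  have atlas: "smooth_atlas (top_of_set S) {(S, id)}"
    using comp chart by (simp add: smooth_atlas_def)
  have "orientable (top_of_set S) {(S, id)}"
    unfolding orientable_def using atlas comp chart d
    by (intro exI[of _ "{(S, id)}"])
      (auto simp: coordinate_chart_def overlap_def matrix_id_mat_1[unfolded id_def])
  then show "connected_orientable_3manifold (top_of_set S) {(S, id)}"
    unfolding connected_orientable_3manifold_def
    using atlas convex_connected[OF assms(2)]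
    by (simp add: Hausdorff_space_subtopology second_countable_subtopology second_countable_euclidean
        connected_space_subtopology)
qed

text \<open>The Blaschke field is \<open>r f\<close> with \<open>256 r\<^sup>5 E\<^sup>4 = 1\<close>: by the definition of \<open>B\<close> one has
  \<open>B\<^sup>4 (det(\<alpha>, \<alpha>') det(\<beta>, \<beta>'))\<^sup>2 = E\<^sup>4\<close>, which makes the volume relation hold for this \<open>r\<close>.\<close>

lemma parametrised_hypersphere:
  assumes adm: "admissible I \<alpha> \<beta> A E"
  shows "J_tangent_affine_hypersphere (top_of_set (slab I)) {(slab I, id)} (f_map \<alpha> \<beta> A E)"
    and "null_direction {(slab I, id)} (f_map \<alpha> \<beta> A E) (D_minus (f_map \<alpha> \<beta> A E))"
proof -
  let ?c = "(slab I, id) :: (real^3) chart"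
  have opI: "open I" "is_interval I" and sm: "smooth_on I \<alpha>" "smooth_on I \<beta>" "smooth_on I A" and E: "E \<noteq> 0"
    and nz: "\<And>x. x \<in> I \<Longrightarrow> det2 (\<alpha> x) (deriv_curve \<alpha> x) * det2 (\<beta> x) (deriv_curve \<beta> x) \<noteq> 0"
    using adm by (auto simp: admissible_def)
  define f where "f = f_map \<alpha> \<beta> A E"
  define q n where "q = (\<lambda>x. - \<alpha> x)"
    and "n = (\<lambda>x. - (A x *\<^sub>R \<alpha> x + B_fun \<alpha> \<beta> E x *\<^sub>R deriv_curve \<alpha> x))"
  define F where "F = local_rep ?c f"
  have range [simp]: "chart_range ?c = slab I" by (simp add: chart_range_def)
  have smq: "smooth_on I q" unfolding q_def by (rule smooth_on_minus[OF opI(1) sm(1)])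
  have smn: "smooth_on I n" unfolding n_def
    by (intro smooth_on_minus smooth_on_add smooth_on_scaleR smooth_on_deriv_curve opI sm smooth_on_B_fun[OF adm])
  interpret ruled_hypersurface I \<beta> q n "slab I" F
    by unfold_locales
      (use opI sm smq smn in \<open>auto simp: open_slab F_def local_rep_id f_def f_map_eq_ruled q_def n_def\<close>)
  have dq: "deriv_curve q x = - deriv_curve \<alpha> x" if "x \<in> I" for x
    unfolding q_def by (rule deriv_curve_minus[OF sm(1) that])
  have qn: "det2 (q x) (n x) = B_fun \<alpha> \<beta> E x * det2 (\<alpha> x) (deriv_curve \<alpha> x)" for x
    by (simp add: q_def n_def det2_expand algebra_simps)
  have qq: "det2 (q x) (deriv_curve q x) = det2 (\<alpha> x) (deriv_curve \<alpha> x)" if "x \<in> I" for x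
    unfolding dq[OF that] by (simp add: q_def det2_expand)
  have B4: "B_fun \<alpha> \<beta> E x ^ 4 * (det2 (\<alpha> x) (deriv_curve \<alpha> x) * det2 (\<beta> x) (deriv_curve \<beta> x))\<^sup>2 = E ^ 4"
    if "x \<in> I" for x
  proof -
    let ?d = "det2 (\<alpha> x) (deriv_curve \<alpha> x) * det2 (\<beta> x) (deriv_curve \<beta> x)"
    have "sqrt \<bar>?d\<bar> ^ 4 = ((sqrt \<bar>?d\<bar>)\<^sup>2)\<^sup>2" by (simp only: power_mult[symmetric]) simp
    also have "\<dots> = ?d\<^sup>2" by simp
    finally show ?thesis using nz[OF that] by (simp add: B_fun_def power_divide)
  qed
  define r where "r = root 5 (1 / (256 * E ^ 4))"
  have r: "r > 0" "256 * \<bar>r\<bar>^5 * E ^ 4 = 1"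
  proof -
    have pos: "1 / (256 * E ^ 4) > 0" using E by simp
    then show "r > 0" unfolding r_def by (subst real_root_gt_0_iff) auto
    then have "\<bar>r\<bar>^5 = 1 / (256 * E ^ 4)" unfolding r_def using pos by (simp add: odd_real_root_pow)
    then show "256 * \<bar>r\<bar>^5 * E ^ 4 = 1" using E by simp
  qed
  define C where "C = (\<lambda>v. r *\<^sub>R f v)"
  define C' where "C' = local_rep ?c C"
  have vol: "(det2 (q (v$1)) (d1 q (v$1)))\<^sup>2
        = 256 * \<bar>r\<bar>^5 * (det2 (\<beta> (v$1)) (d1 \<beta> (v$1)))\<^sup>2 * (det2 (q (v$1)) (n (v$1)))^4"
    if "v \<in> slab I" for v
  proof -
    define x where "x = v$1"
    have x: "x \<in> I" using that by (simp add: x_def slab_def)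
    define aa bb where "aa = det2 (\<alpha> x) (deriv_curve \<alpha> x)" and "bb = det2 (\<beta> x) (deriv_curve \<beta> x)"
    have "256 * \<bar>r\<bar>^5 * bb\<^sup>2 * (B_fun \<alpha> \<beta> E x * aa)^4 = 256 * \<bar>r\<bar>^5 * (B_fun \<alpha> \<beta> E x ^ 4 * (aa * bb)\<^sup>2) * aa\<^sup>2"
      by (simp add: power_mult_distrib power_numeral_reduce)
    also have "\<dots> = aa\<^sup>2"
      using B4[OF x] r(2) by (simp add: aa_def bb_def)
    finally show ?thesis
      using qq[OF x] qn[of x] by (simp add: aa_def bb_def x_def)
  qed
  have Bnz: "B_fun \<alpha> \<beta> E x \<noteq> 0" if "x \<in> I" for x
    using nz[OF that] E by (simp add: B_fun_def)
  have pp0: "det2 (\<beta> (v$1)) (d1 \<beta> (v$1)) \<noteq> 0" and qn0: "det2 (q (v$1)) (n (v$1)) \<noteq> 0" if "v \<in> slab I" for v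
    using nz[of "v$1"] Bnz[of "v$1"] that by (auto simp: qn slab_def)
  note S = equiaffine_sphere_F[of r C', OF _ _ pp0 qn0 vol]
  have C': "C' v = r *\<^sub>R F v" if "v \<in> slab I" for v
    using that by (simp add: C'_def C_def F_def local_rep_id)
  have r0: "r \<noteq> 0" using r(1) by simp
  note S = S[OF r0 C', simplified]
  have "convex (slab I)"
    using is_interval_convex[OF opI(2)] unfolding slab_def
    by (auto simp: convex_def)
  note M = manifold_of_open_convex[OF open_slab[OF opI(1)] this]
  have "affine_hypersphere (top_of_set (slab I)) {?c} f C"
    unfolding affine_hypersphere_def nondegenerate_hypersurface_def blaschke_field_def
    using M(1) S(1,3,4) S(5) by (auto simp: F_def[symmetric] C'_def[symmetric] intro!: exI[of _ "- r"])
  moreover have "J_tangent {?c} f C"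
    unfolding J_tangent_def using S(6) by (auto simp: F_def[symmetric] C'_def[symmetric])
  ultimately show "J_tangent_affine_hypersphere (top_of_set (slab I)) {?c} (f_map \<alpha> \<beta> A E)"
    unfolding J_tangent_affine_hypersphere_def f_def by blast
  have D: "D_minus f ?c u = span {axis 2 1}" if "u \<in> slab I" for u
    using D_minus_eq[of ?c f u] linear_push_F[OF that] S(7)[OF that] by (simp add: F_def)
  have "line_distribution {?c} (D_minus f)"
    unfolding line_distribution_def
  proof (intro conjI ballI)
    fix c c' u assume cc: "c \<in> {?c}" "c' \<in> {?c}" "u \<in> overlap c c'"
    then have u: "u \<in> slab I" by (auto simp: overlap_def)
    show "frechet_derivative (local_rep c (snd c')) (at u) ` D_minus f c u = D_minus f c' (local_rep c (snd c') u)"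
      using cc u M(2)[OF u] by (simp add: local_rep_id)
  next
    fix c u assume c: "c \<in> {?c}" "u \<in> chart_range c"
    then show "\<exists>W Y. open W \<and> u \<in> W \<and> W \<subseteq> chart_range c \<and> smooth_on W Y \<and>
        (\<forall>w\<in>W. Y w \<noteq> (0::real^3) \<and> D_minus f c w = span {Y w})"
      using D open_slab[OF opI(1)]
      by (intro exI[of _ "slab I"] exI[of _ "\<lambda>_. axis 2 1"]) (auto simp: axis_eq_0_iff)
  qed
  then show "null_direction {?c} (f_map \<alpha> \<beta> A E) (D_minus (f_map \<alpha> \<beta> A E))"
    unfolding null_direction_def f_def[symmetric]
    using S(2) S(8) D by (auto simp: F_def[symmetric] intro!: exI[of _ C'])
qed


section \<open>Change of coordinates\<close>

text \<open>In these lemmas \<open>\<Psi>\<close> is a change of coordinates and the hypersurface is also translated by \<open>p\<^sub>0\<close>, which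
  moves the centre of an affine hypersphere to the origin.\<close>

lemma push_compose:
  assumes "open B" "smooth_on V F" "smooth_on B \<Psi>" "\<Psi> ` B \<subseteq> V" "\<And>v. v \<in> B \<Longrightarrow> G v = F (\<Psi> v) - p\<^sub>0" "y \<in> B"
  shows "(G has_derivative (\<lambda>a. push F (\<Psi> y) (frechet_derivative \<Psi> (at y) a))) (at y)"
    and "push G y a = push F (\<Psi> y) (frechet_derivative \<Psi> (at y) a)"
proof -
  have "(F has_derivative push F (\<Psi> y)) (at (\<Psi> y))"
    using has_derivative_push assms by blast
  from diff_chain_at[OF smooth_on_has_derivative[OF assms(3,6)] this]
  have "((\<lambda>v. F (\<Psi> v) - p\<^sub>0) has_derivative (\<lambda>a. push F (\<Psi> y) (frechet_derivative \<Psi> (at y) a))) (at y)"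
    by (auto intro!: derivative_eq_intros simp: o_def)
  then show *: "(G has_derivative (\<lambda>a. push F (\<Psi> y) (frechet_derivative \<Psi> (at y) a))) (at y)"
    by (rule has_derivative_transform_within_open[OF _ assms(1,6)]) (simp add: assms(5))
  show "push G y a = push F (\<Psi> y) (frechet_derivative \<Psi> (at y) a)"
    by (simp add: push_eqI[OF *])
qed

lemma push2_compose:
  assumes "open B" "open V" "smooth_on V F" "smooth_on B \<Psi>" "\<Psi> ` B \<subseteq> V" "\<And>v. v \<in> B \<Longrightarrow> G v = F (\<Psi> v) - p\<^sub>0" "y \<in> B"
  shows "\<exists>c. push2 G y a b = push2 F (\<Psi> y) (frechet_derivative \<Psi> (at y) a) (frechet_derivative \<Psi> (at y) b)
    + push F (\<Psi> y) c"
proof -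
  have in_V: "\<Psi> y \<in> V" using assms by blast
  note D = has_derivative_push_field(1)[OF assms(2,3) in_V smooth_on_has_derivative[OF assms(4,7)]
      smooth_on_has_derivative[OF smooth_on_frechet[OF assms(4)] assms(7)], of b]
  show ?thesis
    using push2_eqI[OF assms(1,7) push_compose(2)[OF assms(1,3-6)] D, of a] by blast
qed

text \<open>The second derivatives differ by a tangent vector only, and the tangent spaces agree.\<close>

lemma h_at_compose:
  assumes "open B" "open V" "smooth_on V F" "smooth_on B \<Psi>" "\<Psi> ` B \<subseteq> V" "\<And>v. v \<in> B \<Longrightarrow> G v = F (\<Psi> v) - p\<^sub>0" "y \<in> B"
    and t: "transversal_at F C (\<Psi> y)" and C: "C' y = C (\<Psi> y)" and inj: "inj (frechet_derivative \<Psi> (at y))"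
  shows "transversal_at G C' y"
    and "h_at G C' y a b = h_at F C (\<Psi> y) (frechet_derivative \<Psi> (at y) a) (frechet_derivative \<Psi> (at y) b)"
    and "range (push G y) = range (push F (\<Psi> y))"
proof -
  let ?D = "frechet_derivative \<Psi> (at y)"
  have lD: "linear ?D" using smooth_on_has_derivative[OF assms(4,7)] has_derivative_linear by blast
  have surj: "surj ?D" by (rule linear_inj_imp_surj[OF lD inj])
  have tF: "linear (push F (\<Psi> y))" "inj (push F (\<Psi> y))" "C (\<Psi> y) \<notin> range (push F (\<Psi> y))"
    using t by (auto simp: transversal_at_def)
  have G: "push G y = push F (\<Psi> y) \<circ> ?D"
    using push_compose(2)[OF assms(1,3-7)] by (auto simp: fun_eq_iff)
  show r: "range (push G y) = range (push F (\<Psi> y))"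
    unfolding G using surj by (metis image_comp)
  show tG: "transversal_at G C' y"
    unfolding transversal_at_def r C using tF G lD inj by (auto intro: linear_compose inj_compose)
  have tp: "transversal_part G C' y w = transversal_part F C (\<Psi> y) w" for w
  proof -
    obtain v where v: "?D v = tangential_part F C (\<Psi> y) w" using surj by (metis surjD)
    show ?thesis
    proof (rule transversal_part_eqI(1)[OF tG, of _ v])
      show "w = push G y v + transversal_part F C (\<Psi> y) w *\<^sub>R C' y"
        using transversal_split[OF t, of w] by (simp add: G v C)
    qed
  qed
  obtain c where c: "push2 G y a b = push2 F (\<Psi> y) (?D a) (?D b) + push F (\<Psi> y) c"
    using push2_compose[OF assms(1-7)] by blast
  have "transversal_part F C (\<Psi> y) (push F (\<Psi> y) c) = 0"
    using transversal_part_eq_0_iff[OF t] by simp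
  then show "h_at G C' y a b = h_at F C (\<Psi> y) (?D a) (?D b)"
    unfolding h_at_push2 tp c by (simp add: linear_add[OF linear_transversal_part[OF t]])
qed

text \<open>The condition in the definition of a Blaschke field concerns positively oriented frames. Exchanging two
  vectors of the frame changes the sign of \<open>\<Theta>\<close> but not \<open>det h\<close>.\<close>

lemma blaschke_frame:
  fixes T :: "real^3^3"
  assumes "blaschke_on V F C" "immersion_on V F" "u \<in> V"
    and nz: "det4 (push F u (T$1)) (push F u (T$2)) (push F u (T$3)) (C u) \<noteq> 0"
  shows "\<bar>det (\<chi> i j. h_at F C u (T$i) (T$j))\<bar> = (det4 (push F u (T$1)) (push F u (T$2)) (push F u (T$3)) (C u))\<^sup>2"
proof -
  have pos: "\<bar>det (\<chi> i j. h_at F C u (T$i) (T$j))\<bar> = (det4 (push F u (T$1)) (push F u (T$2)) (push F u (T$3)) (C u))\<^sup>2"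
    if "det4 (push F u (T$1)) (push F u (T$2)) (push F u (T$3)) (C u) > 0" for T :: "real^3^3"
  proof -
    have "sqrt \<bar>det (\<chi> i j. h_at F C u (T$i) (T$j))\<bar> = det4 (push F u (T$1)) (push F u (T$2)) (push F u (T$3)) (C u)"
      using assms that unfolding blaschke_on_def by (simp add: induced_volume_def metric_volume_def det4_def)
    then show ?thesis by (metis abs_ge_zero real_sqrt_pow2)
  qed
  show ?thesis
  proof (cases "det4 (push F u (T$1)) (push F u (T$2)) (push F u (T$3)) (C u) > 0")
    case False
    let ?T = "vector [T$2, T$1, T$3] :: real^3^3"
    have "\<bar>det (\<chi> i j. h_at F C u (?T$i) (?T$j))\<bar> = (det4 (push F u (?T$1)) (push F u (?T$2)) (push F u (?T$3)) (C u))\<^sup>2"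
      by (rule pos) (use False nz det4_swap[of "push F u (T$2)"] in simp)
    moreover have "det (\<chi> i j. h_at F C u (?T$i) (?T$j)) = det (\<chi> i j. h_at F C u (T$i) (T$j))"
      unfolding det_3 by (simp add: algebra_simps)
    ultimately show ?thesis using det4_swap[of "push F u (T$2)"] by simp
  qed (rule pos)
qed

lemma blaschke_compose:
  assumes "open B" "open V" "immersion_on V F" "blaschke_on V F C" "smooth_on B \<Psi>" "\<Psi> ` B \<subseteq> V"
    and "\<And>v. v \<in> B \<Longrightarrow> G v = F (\<Psi> v) - p\<^sub>0" "y \<in> B" "C' y = C (\<Psi> y)" "inj (frechet_derivative \<Psi> (at y))"
  shows "transversal_at G C' y"
    and "\<bar>det (\<chi> i j. h_at G C' y (axis i 1) (axis j 1))\<bar>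
      = (det4 (push G y (axis 1 1)) (push G y (axis 2 1)) (push G y (axis 3 1)) (C' y))\<^sup>2"
proof -
  have F: "smooth_on V F" and y: "\<Psi> y \<in> V" using assms by (auto simp: immersion_on_def)
  have t: "transversal_at F C (\<Psi> y)"
    using transversal_atI[OF assms(3) _ y] assms(4) by (simp add: blaschke_on_def)
  note h = h_at_compose[where F = F and C = C and C' = C' and \<Psi> = \<Psi> and y = y and G = G, OF assms(1,2) F assms(5-8) t assms(9,10)]
  have p: "push G y a = push F (\<Psi> y) (frechet_derivative \<Psi> (at y) a)" for a
    by (rule push_compose(2)[OF assms(1) F assms(5-8)])
  have h2: "h_at G C' y a b = h_at F C (\<Psi> y) (frechet_derivative \<Psi> (at y) a) (frechet_derivative \<Psi> (at y) b)" for a b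
    by (rule h(2))
  show tG: "transversal_at G C' y" by (rule h(1))
  have "det4 (push G y (axis 1 1)) (push G y (axis 2 1)) (push G y (axis 3 1)) (C' y) \<noteq> 0"
    using tG transversal_decomposition(4) by (auto simp: transversal_at_def)
  then show "\<bar>det (\<chi> i j. h_at G C' y (axis i 1) (axis j 1))\<bar>
      = (det4 (push G y (axis 1 1)) (push G y (axis 2 1)) (push G y (axis 3 1)) (C' y))\<^sup>2"
    using blaschke_frame[OF assms(4,3) y, of "\<chi> i. frechet_derivative \<Psi> (at y) (axis i 1)"]
    unfolding p h2 assms(9) by simp
qed


section \<open>The centre\<close>

text \<open>The components of \<open>w\<close> with respect to the moving frame \<open>F\<^sub>x, F\<^sub>y, F\<^sub>z, C\<close> are quotients of smooth
  determinants by Cramer's rule.\<close>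

lemma smooth_on_tangential:
  assumes "open V" "immersion_on V F" "transversal_on V F C" "smooth_on V w"
    and \<xi>: "\<And>u. u \<in> V \<Longrightarrow> push F u (\<xi> u) = w u"
  shows "smooth_on V \<xi>"
proof (rule smooth_on_vec[OF assms(1)])
  define M where "M u = (transpose (vector [push F u (axis 1 1), push F u (axis 2 1), push F u (axis 3 1), C u]) :: real^4^4)" for u
  have F: "smooth_on V F" and C: "smooth_on V C" using assms by (auto simp: immersion_on_def transversal_on_def)
  have det: "det (M u) \<noteq> 0" if "u \<in> V" for u
    using transversal_decomposition(4) transversal_atI[OF assms(2,3) that]
    by (simp add: M_def transversal_at_def det4_def)
  have M: "smooth_on V (\<lambda>u. M u $ i $ j)" for i j
    unfolding M_def transpose_def
    using exhaust_4[of j] by (elim disjE) (simp_all add: smooth_on_vec_nth smooth_on_push F C assms(1))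
  have eq: "M u *v vector [\<xi> u $ 1, \<xi> u $ 2, \<xi> u $ 3, 0] = w u" if "u \<in> V" for u
    using linear_real3[OF linear_push[OF F that], of "\<xi> u"] \<xi>[OF that]
    by (simp add: vec_eq_iff forall_4 matrix_vector_mult_def M_def transpose_def sum_4)
  have cr: "vector [\<xi> u $ 1, \<xi> u $ 2, \<xi> u $ 3, 0]
      = ((\<chi> k. det (\<chi> i j. if j = k then w u $ i else M u $ i $ j) / det (M u)) :: real^4)" if "u \<in> V" for u
    using cramer[OF det[OF that]] eq[OF that] by blast
  have sm: "smooth_on V (\<lambda>u. det (\<chi> i j. if j = k then w u $ i else M u $ i $ j) / det (M u))" for k
  proof (intro smooth_on_divide assms(1) smooth_on_det M det)
    show "smooth_on V (\<lambda>u. (\<chi> i j. if j = k then w u $ i else M u $ i $ j) $ i $ j)" for i j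
      using M by (cases "j = k") (auto intro!: smooth_on_vec_nth assms)
  qed
  fix i :: 3
  \<comment> \<open>the index \<open>i\<close> of type \<open>3\<close>, transported to the type \<open>4\<close>\<close>
  obtain k :: 4 where "\<And>u. u \<in> V \<Longrightarrow> \<xi> u $ i = det (\<chi> i j. if j = k then w u $ i else M u $ i $ j) / det (M u)"
  proof -
    have *: "\<xi> u $ 1 = det (\<chi> i j. if j = 1 then w u $ i else M u $ i $ j) / det (M u)"
      "\<xi> u $ 2 = det (\<chi> i j. if j = 2 then w u $ i else M u $ i $ j) / det (M u)"
      "\<xi> u $ 3 = det (\<chi> i j. if j = 3 then w u $ i else M u $ i $ j) / det (M u)" if "u \<in> V" for u
      using cr[OF that] by (auto simp: vec_eq_iff forall_4)
    consider "i = 1" | "i = 2" | "i = 3" using exhaust_3[of i] by blast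
    then show thesis
    proof cases
      case 1
      show ?thesis by (rule that[of 1]) (simp add: 1 *(1))
    next
      case 2
      show ?thesis by (rule that[of 2]) (simp add: 2 *(2))
    next
      case 3
      show ?thesis by (rule that[of 3]) (simp add: 3 *(3))
    qed
  qed
  then show "smooth_on V (\<lambda>u. \<xi> u $ i)"
    using sm[of k] by (subst smooth_on_cong[OF assms(1)])
qed

text \<open>With \<open>\<tau> = 0\<close> and \<open>S = l I\<close> the Weingarten formula determines the differential of \<open>C\<close> completely.\<close>

lemma sphere_derivative:
  assumes "immersion_on V F" "blaschke_on V F C" "\<And>u v. u \<in> V \<Longrightarrow> shape_operator F C u v = l *\<^sub>R v" "u \<in> V"
  shows "(C has_derivative (\<lambda>v. (- l) *\<^sub>R push F u v)) (at u)"
proof -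
  have tr: "transversal_on V F C" using assms(2) by (simp add: blaschke_on_def)
  have t: "transversal_at F C u" by (rule transversal_atI[OF assms(1) tr assms(4)])
  have d: "(C has_derivative frechet_derivative C (at u)) (at u)"
    using smooth_on_has_derivative assms(4) tr by (auto simp: transversal_on_def)
  have "frechet_derivative C (at u) v = (- l) *\<^sub>R push F u v" for v
  proof -
    have a: "transversal_part F C u (frechet_derivative C (at u) v) = 0"
      using assms(2,4) by (simp add: blaschke_on_def transversal_connection_form_def flat_D_def)
    have b: "tangential_part F C u (frechet_derivative C (at u) v) = (- l) *\<^sub>R v"
      using assms(3)[OF assms(4), of v] by (simp add: shape_operator_def flat_D_def minus_equation_iff)
    have "linear (push F u)" using t by (simp add: transversal_at_def)
    then have "push F u ((- l) *\<^sub>R v) = (- l) *\<^sub>R push F u v" by (rule linear_scale)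
    then show ?thesis
      using transversal_split[OF t, of "frechet_derivative C (at u) v"] unfolding a b by simp
  qed
  then have "frechet_derivative C (at u) = (\<lambda>v. (- l) *\<^sub>R push F u v)" by (rule ext)
  with d show ?thesis by (rule has_derivative_eq_rhs)
qed

text \<open>If the shape operator vanished, \<open>C\<close> and hence the tangent field \<open>JC\<close> would be parallel, and
  differentiating \<open>JC = f\<^sub>* \<xi>\<close> would put \<open>\<xi>\<close> into the kernel of \<open>h\<close>.\<close>

lemma J_tangent_sphere_proper:
  assumes V: "open V" "u \<in> V" and imm: "immersion_on V F" and bl: "blaschke_on V F C"
    and l: "\<And>u v. u \<in> V \<Longrightarrow> shape_operator F C u v = l *\<^sub>R v"
    and J: "\<And>u. u \<in> V \<Longrightarrow> J (C u) \<in> range (push F u)"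
  shows "l \<noteq> 0"
proof
  assume "l = 0"
  then have C0: "(C has_derivative (\<lambda>v. 0)) (at u)" if "u \<in> V" for u
    using sphere_derivative[OF imm bl l that] by simp
  have tr: "transversal_on V F C" using bl by (simp add: blaschke_on_def)
  have F: "smooth_on V F" and C: "smooth_on V C" using imm tr by (auto simp: immersion_on_def transversal_on_def)
  have t: "transversal_at F C u" by (rule transversal_atI[OF imm tr V(2)])
  have bJ: "bounded_linear J" using linear_J by (simp add: linear_conv_bounded_linear)
  obtain \<xi> where \<xi>: "\<And>u. u \<in> V \<Longrightarrow> push F u (\<xi> u) = J (C u)"
    using J unfolding image_iff by metis
  have sm: "smooth_on V \<xi>"
    by (rule smooth_on_tangential[OF V(1) imm tr smooth_on_bounded_linear[OF bJ V(1) C] \<xi>])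
  let ?X = "frechet_derivative \<xi> (at u)"
  have d1: "((\<lambda>x. push F x (\<xi> x)) has_derivative (\<lambda>v. push2 F u v (\<xi> u) + push F u (?X v))) (at u)"
    by (rule has_derivative_push_field(1)[OF V(1) F V(2) has_derivative_ident smooth_on_has_derivative[OF sm V(2)]])
  have "((\<lambda>x. J (C x)) has_derivative (\<lambda>v. J 0)) (at u)"
    by (rule bounded_linear.has_derivative[OF bJ C0[OF V(2)]])
  then have "((\<lambda>x. push F x (\<xi> x)) has_derivative (\<lambda>v. J 0)) (at u)"
    by (rule has_derivative_transform_within_open[OF _ V]) (simp add: \<xi>)
  then have "push2 F u v (\<xi> u) + push F u (?X v) = J 0" for v
    using has_derivative_unique[OF d1] by (auto simp: fun_eq_iff)
  then have "push2 F u v (\<xi> u) = push F u (- ?X v)" for v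
    using linear_0[OF linear_J] by (simp add: linear_neg[OF linear_push[OF F V(2)]] add_eq_0_iff)
  then have h0: "h_at F C u v (\<xi> u) = 0" for v
    unfolding h_at_push2 transversal_part_eq_0_iff[OF t] by simp
  have lin: "linear (h_at F C u v)" for v
    unfolding h_at_push2
    using linear_compose[OF linear_push2_right[OF V(1) F V(2)] linear_transversal_part[OF t]] by (simp add: o_def)
  let ?H = "\<chi> i j. h_at F C u (axis i 1) (axis j 1)"
  have "?H *v \<xi> u = 0"
  proof (simp add: vec_eq_iff matrix_vector_mult_def, safe)
    fix i :: 3
    show "(\<Sum>j\<in>UNIV. h_at F C u (axis i 1) (axis j 1) * \<xi> u $ j) = 0"
      using linear_real3[OF lin, of "axis i 1" "\<xi> u"] h0[of "axis i 1"] by (simp add: sum_3 mult.commute)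
  qed
  moreover have "\<xi> u \<noteq> 0"
  proof
    assume "\<xi> u = 0"
    then have "J (C u) = 0" using \<xi>[OF V(2)] linear_0[OF linear_push[OF F V(2)]] by simp
    then have "C u = 0" by (simp add: J_def vec_eq_iff forall_4)
    then show False using t linear_0[OF linear_push[OF F V(2)]] unfolding transversal_at_def
      by (metis rangeI)
  qed
  ultimately have "det ?H = 0" by (rule matrix_vector_eq_0_det)
  moreover have "det4 (push F u (axis 1 1)) (push F u (axis 2 1)) (push F u (axis 3 1)) (C u) \<noteq> 0"
    using t transversal_decomposition(4) by (auto simp: transversal_at_def)
  ultimately show False
    using blaschke_frame[OF bl imm V(2), of "\<chi> i. axis i 1"] by simp
qed


section \<open>Local normal form\<close>

text \<open>Convexity of \<open>B\<close> puts the segment from \<open>v\<close> to \<open>w\<close> inside \<open>B\<close>. The lemma serves for boxes and for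
  their slices by coordinate planes.\<close>

lemma constant_along_coordinate:
  fixes H :: "real^'n \<Rightarrow> 'b::real_normed_vector"
  assumes "convex B" and d: "\<And>v. v \<in> B \<Longrightarrow> (H has_derivative H' v) (at v)"
    and 0: "\<And>v. v \<in> B \<Longrightarrow> H' v (axis i 1) = 0"
    and vw: "v \<in> B" "w \<in> B" "\<And>j. j \<noteq> i \<Longrightarrow> v$j = w$j"
  shows "H v = H w"
proof -
  have wv: "w - v = (w$i - v$i) *\<^sub>R axis i 1"
    using vw(3) by (auto simp: vec_eq_iff axis_nth_if)
  have "((\<lambda>s. H (v + s *\<^sub>R (w - v))) has_derivative (\<lambda>h. 0)) (at s within {0..1})" if s: "s \<in> {0..1}" for s
  proof -
    have in_B: "v + s *\<^sub>R (w - v) \<in> B"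
      using convexD_alt[OF assms(1) vw(1,2), of s] s by (simp add: algebra_simps)
    have "((\<lambda>s. v + s *\<^sub>R (w - v)) has_derivative (\<lambda>h. h *\<^sub>R (w - v))) (at s)"
      by (auto intro!: derivative_eq_intros)
    from diff_chain_at[OF this d[OF in_B]]
    have "((\<lambda>s. H (v + s *\<^sub>R (w - v))) has_derivative (\<lambda>h. H' (v + s *\<^sub>R (w - v)) (h *\<^sub>R (w - v)))) (at s)"
      by (simp add: o_def)
    moreover have "H' (v + s *\<^sub>R (w - v)) (h *\<^sub>R (w - v)) = 0" for h
    proof -
      have "linear (H' (v + s *\<^sub>R (w - v)))" using d[OF in_B] by (rule has_derivative_linear)
      moreover have "h *\<^sub>R (w - v) = (h * (w$i - v$i)) *\<^sub>R axis i 1" by (subst wv) simp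
      ultimately show ?thesis using 0[OF in_B] by (simp add: linear_scale)
    qed
    ultimately show ?thesis by (simp add: has_derivative_at_withinI)
  qed
  then obtain c where "\<And>s. s \<in> {0..1} \<Longrightarrow> H (v + s *\<^sub>R (w - v)) = c"
    using has_derivative_zero_constant[of "{0..1::real}" "\<lambda>s. H (v + s *\<^sub>R (w - v))"] by auto
  from this[of 0] this[of 1] show ?thesis by simp
qed

definition fst_part :: "real^4 \<Rightarrow> real^2" where
  "fst_part w = vector [(w$1 + w$3) / 2, (w$2 + w$4) / 2]"

definition snd_part :: "real^4 \<Rightarrow> real^2" where
  "snd_part w = vector [(w$1 - w$3) / 2, (w$2 - w$4) / 2]"

lemma bounded_linear_parts: "bounded_linear fst_part" "bounded_linear snd_part"
  unfolding linear_conv_bounded_linear[symmetric]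
  by (auto intro!: linearI simp: fst_part_def snd_part_def vec_eq_iff forall_2 field_simps)

lemma PQ_parts [simp]: "PQ (fst_part w) (snd_part w) = w" "fst_part (PQ p q) = p" "snd_part (PQ p q) = q"
  by (auto simp: fst_part_def snd_part_def vec_eq_iff forall_2 forall_4 field_simps)

lemma J_eq_minus_iff: "J w = - w \<longleftrightarrow> fst_part w = 0"
  using J_PQ_eq_minus_iff[of "fst_part w" "snd_part w"] by simp


subsection \<open>Recognising the normal form\<close>

text \<open>On a box, \<open>W\<^sub>z = 0\<close> and \<open>W\<^sub>y\<^sub>y = 0\<close> make \<open>W\<close> independent of \<open>z\<close> and affine in \<open>y\<close>. The coefficients \<open>q\<close>
  and \<open>n\<close> are found by restricting \<open>W\<^sub>y\<close> and \<open>W\<close> to the line \<open>\<kappa>\<close> through a point \<open>c\<close> of the box, and are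
  therefore smooth.\<close>

lemma ruled_of_derivatives:
  fixes W :: "real^3 \<Rightarrow> real^2" and a b :: "real^3"
  assumes W: "smooth_on (box a b) W"
    and z: "\<And>v. v \<in> box a b \<Longrightarrow> frechet_derivative W (at v) (axis 3 1) = 0"
    and tt: "\<And>v. v \<in> box a b \<Longrightarrow> frechet_derivative (\<lambda>v. frechet_derivative W (at v) (axis 2 1)) (at v) (axis 2 1) = 0"
    and ne: "box a b \<noteq> {}"
  obtains q n where "smooth_on {a$1<..<b$1} q" "smooth_on {a$1<..<b$1} n"
    "\<And>v. v \<in> box a b \<Longrightarrow> W v = v$2 *\<^sub>R q (v$1) + n (v$1)"
proof -
  define B where "B = box a b"
  define DW where "DW v = frechet_derivative W (at v) (axis 2 1)" for v
  have DWfun: "DW = (\<lambda>v. frechet_derivative W (at v) (axis 2 1))" by (simp add: fun_eq_iff DW_def)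
  obtain c where c: "c \<in> B" using ne by (auto simp: B_def)
  have cv: "convex B" and B: "open B" by (auto simp: B_def)
  define \<kappa> where "\<kappa> x = (vector [x, c$2, c$3] :: real^3)" for x
  have \<kappa>: "\<kappa> x \<in> B" if "x \<in> {a$1<..<b$1}" for x
    using that c by (auto simp: B_def mem_box_cart forall_3 \<kappa>_def)
  have "smooth_on {a$1<..<b$1} (\<lambda>x. vector [0, c$2, c$3] + x *\<^sub>R axis 1 1 :: real^3)"
    by (intro smooth_on_add smooth_on_scaleR) auto
  moreover have "(\<lambda>x. vector [0, c$2, c$3] + x *\<^sub>R axis 1 1) = \<kappa>"
    by (auto simp: fun_eq_iff \<kappa>_def vec_eq_iff forall_3 axis_nth_if)
  ultimately have sm\<kappa>: "smooth_on {a$1<..<b$1} \<kappa>" by simp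
  have W': "smooth_on B W" using W by (simp add: B_def)
  have DWs: "smooth_on B DW" unfolding DW_def by (rule smooth_on_frechet[OF W'])
  define q where "q x = DW (\<kappa> x)" for x
  define n where "n x = W (\<kappa> x) - c$2 *\<^sub>R q x" for x
  have smq: "smooth_on {a$1<..<b$1} q"
    unfolding q_def by (rule smooth_on_compose[OF _ B sm\<kappa> DWs]) (auto simp: \<kappa>)
  have "smooth_on {a$1<..<b$1} (\<lambda>x. W (\<kappa> x))"
    by (rule smooth_on_compose[OF _ B sm\<kappa> W']) (auto simp: \<kappa>)
  then have smn: "smooth_on {a$1<..<b$1} n"
    unfolding n_def by (intro smooth_on_diff smooth_on_scaleR smq) auto
  have "W v = v$2 *\<^sub>R q (v$1) + n (v$1)" if v: "v \<in> B" for v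
  proof -
    define v' where "v' = (vector [v$1, v$2, c$3] :: real^3)"
    have v': "v' \<in> B" and x: "v$1 \<in> {a$1<..<b$1}"
      using v c by (auto simp: B_def mem_box_cart forall_3 v'_def)
    have three: "j \<noteq> 3 \<Longrightarrow> v$j = v'$j" and two: "j \<noteq> 2 \<Longrightarrow> v'$j = \<kappa> (v$1)$j" for j
      using exhaust_3[of j] by (auto simp: v'_def \<kappa>_def)
    have 1: "W v = W v'"
      by (rule constant_along_coordinate[OF cv smooth_on_has_derivative[OF W'] _ v v' three])
        (use z in \<open>auto simp: B_def\<close>)
    have DW: "DW w = q (v$1)" if w: "w \<in> B" "w$1 = v$1" "w$3 = c$3" for w
    proof -
      have e: "j \<noteq> 2 \<Longrightarrow> w$j = \<kappa> (v$1)$j" for j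
        using exhaust_3[of j] w by (auto simp: \<kappa>_def)
      show ?thesis unfolding q_def
        by (rule constant_along_coordinate[OF cv smooth_on_has_derivative[OF DWs] _ w(1) \<kappa>[OF x] e])
          (use tt in \<open>auto simp: B_def DWfun\<close>)
    qed
    \<comment> \<open>on the slice of fixed \<open>x\<close> and \<open>z\<close> the difference of \<open>W\<close> and its linear part is constant\<close>
    have "W v' - v'$2 *\<^sub>R q (v$1) = W (\<kappa> (v$1)) - \<kappa> (v$1)$2 *\<^sub>R q (v$1)"
    proof (rule constant_along_coordinate[where H = "\<lambda>w. W w - w$2 *\<^sub>R q (v$1)" and i = 2
          and B = "B \<inter> {w. w$1 = v$1 \<and> w$3 = c$3}"
          and H' = "\<lambda>w h. frechet_derivative W (at w) h - h$2 *\<^sub>R q (v$1)"])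
      show "convex (B \<inter> {w. w$1 = v$1 \<and> w$3 = c$3})"
        by (intro convex_Int cv) (auto simp: convex_def simp flip: distrib_right)
      show "((\<lambda>w. W w - w$2 *\<^sub>R q (v$1)) has_derivative
          (\<lambda>h. frechet_derivative W (at w) h - h$2 *\<^sub>R q (v$1))) (at w)"
        if "w \<in> B \<inter> {w. w$1 = v$1 \<and> w$3 = c$3}" for w
        using that
        by (intro has_derivative_diff smooth_on_has_derivative[OF W'] has_derivative_scaleR_left
            bounded_linear.has_derivative[OF bounded_linear_vec_nth] has_derivative_ident) auto
      show "frechet_derivative W (at w) (axis 2 1) - axis 2 1 $ 2 *\<^sub>R q (v$1) = 0"
        if "w \<in> B \<inter> {w. w$1 = v$1 \<and> w$3 = c$3}" for w
        using DW[of w] that by (simp add: DW_def)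
    qed (use v' \<kappa>[OF x] two in \<open>auto simp: v'_def \<kappa>_def\<close>)
    then show ?thesis
      unfolding 1 by (simp add: n_def v'_def \<kappa>_def algebra_simps)
  qed
  then show thesis using that[OF smq smn] by (simp add: B_def)
qed


text \<open>Coordinates adapted to the first component \<open>P\<close>: the curve \<open>\<beta>\<close> is the straight line through
  \<open>P\<^sub>0\<close> orthogonal to \<open>P\<^sub>0\<close>, and \<open>P = e\<^sup>-\<^sup>z \<beta>(x)\<close> on the half-plane around \<open>P\<^sub>0\<close>.\<close>

definition base_line :: "real^2 \<Rightarrow> real \<Rightarrow> real^2" where
  "base_line P\<^sub>0 x = P\<^sub>0 + x *\<^sub>R vector [- (P\<^sub>0$2), P\<^sub>0$1]"

definition x_coord :: "real^2 \<Rightarrow> real^2 \<Rightarrow> real" where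
  "x_coord P\<^sub>0 P = det2 P\<^sub>0 P / (P \<bullet> P\<^sub>0)"

definition z_coord :: "real^2 \<Rightarrow> real^2 \<Rightarrow> real" where
  "z_coord P\<^sub>0 P = - ln ((P \<bullet> P\<^sub>0) / (P\<^sub>0 \<bullet> P\<^sub>0))"

lemma cone_coordinates:
  assumes "P \<bullet> P\<^sub>0 > 0"
  shows "exp (- z_coord P\<^sub>0 P) *\<^sub>R base_line P\<^sub>0 (x_coord P\<^sub>0 P) = P"
proof -
  have "P\<^sub>0 \<noteq> 0" using assms by auto
  then have pos: "P\<^sub>0 \<bullet> P\<^sub>0 > 0" by simp
  then have "exp (- z_coord P\<^sub>0 P) = (P \<bullet> P\<^sub>0) / (P\<^sub>0 \<bullet> P\<^sub>0)"
    using assms by (simp add: z_coord_def)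
  then have "(P\<^sub>0 \<bullet> P\<^sub>0) *\<^sub>R (exp (- z_coord P\<^sub>0 P) *\<^sub>R base_line P\<^sub>0 (x_coord P\<^sub>0 P))
      = (P \<bullet> P\<^sub>0) *\<^sub>R P\<^sub>0 + det2 P\<^sub>0 P *\<^sub>R vector [- (P\<^sub>0$2), P\<^sub>0$1]"
    using assms pos by (simp add: base_line_def x_coord_def algebra_simps)
  also have "\<dots> = (P\<^sub>0 \<bullet> P\<^sub>0) *\<^sub>R P"
    by (simp add: vec_eq_iff forall_2 det2_expand inner_vec_def sum_2 algebra_simps)
  finally show ?thesis using pos by (metis less_irrefl scale_left_imp_eq)
qed

lemma smooth_on_base_line: "open I \<Longrightarrow> smooth_on I (base_line P\<^sub>0)"
  unfolding base_line_def by (intro smooth_on_add smooth_on_scaleR smooth_on_const smooth_on_id)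


lemma nonvanishing_sign:
  fixes g :: "real \<Rightarrow> real"
  assumes "is_interval I" "continuous_on I g" "\<And>x. x \<in> I \<Longrightarrow> g x \<noteq> 0"
  obtains s where "\<bar>s\<bar> = 1" "\<And>x. x \<in> I \<Longrightarrow> g x = s * \<bar>g x\<bar>"
proof -
  have "connected (g ` I)"
    using assms(1,2) by (intro connected_continuous_image) (auto simp: is_interval_connected_1)
  then have "is_interval (g ` I)" by (simp add: is_interval_connected_1)
  moreover have "0 \<notin> g ` I" using assms(3) by auto
  ultimately have "(\<forall>x\<in>I. g x > 0) \<or> (\<forall>x\<in>I. g x < 0)"
    unfolding is_interval_1 by (smt (verit, best) imageI)
  then show thesis
  proof
    assume "\<forall>x\<in>I. g x > 0"
    then show thesis by (intro that[of 1]) (auto simp: order.strict_implies_order)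
  next
    assume "\<forall>x\<in>I. g x < 0"
    then show thesis by (intro that[of "-1"]) (auto simp: order.strict_implies_order)
  qed
qed

text \<open>Put \<open>\<alpha> = - q\<close> and expand \<open>n = A q + (det(q, n) / det(q, q')) q'\<close>. By the volume relation
  \<open>\<bar>det(q, q')\<bar> = K \<bar>det(p, p')\<bar> det(q, n)\<^sup>2\<close> with \<open>K = 16 \<bar>r\<bar>\<^sup>5\<^sup>/\<^sup>2\<close>, the coefficient of \<open>q'\<close> has the absolute
  value of \<open>K\<^sup>-\<^sup>1\<^sup>/\<^sup>2 / sqrt \<bar>det(q, q') det(p, p')\<bar>\<close>. Its sign is constant on the interval; hence it is \<open>B\<close> for a
  constant \<open>E\<close>.\<close>

lemma ruled_eq_f_map:
  assumes I: "open I" "is_interval I" "I \<noteq> {}" and sm: "smooth_on I p" "smooth_on I q" "smooth_on I n"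
    and pp: "\<And>x. x \<in> I \<Longrightarrow> det2 (p x) (deriv_curve p x) \<noteq> 0"
    and qn: "\<And>x. x \<in> I \<Longrightarrow> det2 (q x) (n x) \<noteq> 0"
    and r: "r \<noteq> 0"
    and vol: "\<And>x. x \<in> I \<Longrightarrow> (det2 (q x) (deriv_curve q x))\<^sup>2
        = 256 * \<bar>r\<bar>^5 * (det2 (p x) (deriv_curve p x))\<^sup>2 * (det2 (q x) (n x))^4"
  obtains \<alpha> A E where "admissible I \<alpha> p A E" "\<And>v. v \<in> slab I \<Longrightarrow> f_map \<alpha> p A E v = ruled p q n v"
proof -
  define pp' qn' qq where "pp' x = det2 (p x) (deriv_curve p x)" and "qn' x = det2 (q x) (n x)"
    and "qq x = det2 (q x) (deriv_curve q x)" for x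
  have vol': "(qq x)\<^sup>2 = 256 * \<bar>r\<bar>^5 * (pp' x)\<^sup>2 * qn' x ^4" if "x \<in> I" for x
    using vol[OF that] by (simp add: pp'_def qn'_def qq_def)
  have nz: "pp' x \<noteq> 0" "qn' x \<noteq> 0" if "x \<in> I" for x
    using pp[OF that] qn[OF that] by (auto simp: pp'_def qn'_def)
  have qq0: "qq x \<noteq> 0" if "x \<in> I" for x
    using vol'[OF that] nz[OF that] r by auto
  have sm': "smooth_on I qn'" "smooth_on I qq"
    unfolding qn'_def qq_def
    by (intro smooth_on_bilinear[OF bounded_bilinear_det2] smooth_on_deriv_curve sm I)+
  define K where "K = 16 * sqrt (\<bar>r\<bar>^5)"
  have K: "K > 0" using r by (simp add: K_def)
  have "K\<^sup>2 = 256 * \<bar>r\<bar>^5" by (simp add: K_def power_mult_distrib)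
  have abs_qq: "\<bar>qq x\<bar> = K * \<bar>pp' x\<bar> * (qn' x)\<^sup>2" if "x \<in> I" for x
  proof (rule power2_eq_imp_eq)
    show "\<bar>qq x\<bar>\<^sup>2 = (K * \<bar>pp' x\<bar> * (qn' x)\<^sup>2)\<^sup>2"
      using vol'[OF that] \<open>K\<^sup>2 = _\<close> by (simp add: power_mult_distrib flip: power_mult)
  qed (use K in auto)
  have "continuous_on I (\<lambda>x. qn' x / qq x)"
    by (intro smooth_on_continuous smooth_on_divide sm' I qq0)
  then obtain s where s: "\<bar>s\<bar> = 1" "\<And>x. x \<in> I \<Longrightarrow> qn' x / qq x = s * \<bar>qn' x / qq x\<bar>"
    using nonvanishing_sign[OF I(2), of "\<lambda>x. qn' x / qq x"] nz qq0 by auto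
  define \<alpha> where "\<alpha> x = - q x" for x
  define A where "A x = det2 (n x) (deriv_curve q x) / qq x" for x
  define E where "E = s / sqrt K"
  have d\<alpha>: "deriv_curve \<alpha> x = - deriv_curve q x" if "x \<in> I" for x
    unfolding \<alpha>_def by (rule deriv_curve_minus[OF sm(2) that])
  have \<alpha>\<alpha>: "det2 (\<alpha> x) (deriv_curve \<alpha> x) = qq x" if "x \<in> I" for x
    unfolding d\<alpha>[OF that] by (simp add: \<alpha>_def qq_def det2_expand)
  have E0: "E \<noteq> 0" using s(1) K by (auto simp: E_def)
  have "smooth_on I \<alpha>" unfolding \<alpha>_def by (rule smooth_on_minus[OF I(1) sm(2)])
  moreover have "smooth_on I A" unfolding A_def
    by (intro smooth_on_divide smooth_on_bilinear[OF bounded_bilinear_det2] smooth_on_deriv_curve sm sm' I qq0)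
  ultimately have adm: "admissible I \<alpha> p A E"
    unfolding admissible_def using I sm(1) E0 qq0 nz \<alpha>\<alpha> by (auto simp: pp'_def)
  have B: "B_fun \<alpha> p E x = qn' x / qq x" if x: "x \<in> I" for x
  proof -
    have "\<bar>qq x * pp' x\<bar> = (qq x)\<^sup>2 / (K * (qn' x)\<^sup>2)"
      using abs_qq[OF x] nz[OF x] K power2_abs[of "qq x"] by (simp add: abs_mult power2_eq_square field_simps)
    then have "sqrt \<bar>qq x * pp' x\<bar> = \<bar>qq x\<bar> / (sqrt K * \<bar>qn' x\<bar>)"
      by (simp add: real_sqrt_divide real_sqrt_mult)
    then have "B_fun \<alpha> p E x = s * \<bar>qn' x / qq x\<bar>"
      unfolding B_fun_def \<alpha>\<alpha>[OF x] pp'_def[symmetric] using K by (simp add: E_def)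
    then show ?thesis using s(2)[OF x] by simp
  qed
  have n: "- (A x *\<^sub>R \<alpha> x + B_fun \<alpha> p E x *\<^sub>R deriv_curve \<alpha> x) = n x" if x: "x \<in> I" for x
  proof -
    have "det2 (n x) (deriv_curve q x) *\<^sub>R q x + det2 (q x) (n x) *\<^sub>R deriv_curve q x = qq x *\<^sub>R n x"
      by (simp add: qq_def vec_eq_iff forall_2 det2_expand algebra_simps)
    moreover have "- (A x *\<^sub>R \<alpha> x + B_fun \<alpha> p E x *\<^sub>R deriv_curve \<alpha> x)
        = (1 / qq x) *\<^sub>R (det2 (n x) (deriv_curve q x) *\<^sub>R q x + det2 (q x) (n x) *\<^sub>R deriv_curve q x)"
      unfolding B[OF x] d\<alpha>[OF x] by (simp add: A_def \<alpha>_def qn'_def algebra_simps)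
    ultimately show ?thesis using qq0[OF x] by simp
  qed
  have "f_map \<alpha> p A E v = ruled p q n v" if "v \<in> slab I" for v
    unfolding f_map_eq_ruled using n[of "v$1"] that by (simp add: ruled_def slab_def \<alpha>_def)
  then show thesis using that adm by blast
qed

lemma box_neighbourhood:
  assumes "open V'" "homeomorphism U' V' \<Phi> \<Psi>" "open U'" "(u :: real^3) \<in> U'"
  obtains a b :: "real^3" and U where "box a b \<subseteq> V'" "open U" "u \<in> U" "U \<subseteq> U'" "homeomorphism U (box a b) \<Phi> \<Psi>"
proof -
  have "\<Phi> u \<in> V'" using assms by (auto simp: homeomorphism_def)
  then obtain a b where ab: "box a b \<subseteq> V'" "\<Phi> u \<in> box a b" using open_contains_box[OF assms(1)] by metis
  have "continuous_on U' \<Phi>" using assms(2) by (simp add: homeomorphism_def)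
  then have op: "open (U' \<inter> \<Phi> -` box a b)" by (intro continuous_open_preimage assms) auto
  have "\<Phi> ` (U' \<inter> \<Phi> -` box a b) = box a b"
  proof (safe)
    fix y assume "y \<in> box a b"
    then have "\<Psi> y \<in> U'" "\<Phi> (\<Psi> y) = y"
      using ab(1) assms(2) by (auto simp: homeomorphism_def)
    then show "y \<in> \<Phi> ` (U' \<inter> \<Phi> -` box a b)"
      using \<open>y \<in> box a b\<close> by (intro image_eqI[of _ _ "\<Psi> y"]) auto
  qed
  then have "homeomorphism (U' \<inter> \<Phi> -` box a b) (box a b) \<Phi> \<Psi>"
    using homeomorphism_of_subsets[OF assms(2), of "U' \<inter> \<Phi> -` box a b" "box a b"] ab(1) by blast
  then show thesis using that[OF ab(1) op] assms(4) ab(2) by auto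
qed


text \<open>The hypersurface near \<open>u\<^sub>0\<close> in the coordinates \<open>\<Phi> = (x, y, z)\<close>, where \<open>P = e\<^sup>-\<^sup>z \<beta>(x)\<close> is the first
  component of \<open>F - p\<^sub>0\<close> and \<open>y = l \<bullet> W\<close> with \<open>W = e\<^sup>-\<^sup>z Q\<close>. The vector \<open>l\<close> is the second component of
  the null vector at \<open>u\<^sub>0\<close>, which makes the differential of \<open>\<Phi>\<close> injective there: a vector in its kernel
  leaves \<open>P\<close> fixed, so it is a null vector, and \<open>y\<close> detects those. In these coordinates \<open>l \<bullet> W = y\<close>
  holds identically, and this normalisation turns the two tangency conditions into \<open>W\<^sub>z = 0\<close> and \<open>W\<^sub>y\<^sub>y = 0\<close>.\<close>

lemma local_normal_form:
  assumes V: "open V" and imm: "immersion_on V F" and bl: "blaschke_on V F C" and r: "r \<noteq> 0"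
    and C: "\<And>u. u \<in> V \<Longrightarrow> C u = r *\<^sub>R (F u - p\<^sub>0)"
    and Jt: "\<And>u. u \<in> V \<Longrightarrow> J (C u) \<in> range (push F u)"
    and tr': "transversal_on V F C'"
    and null: "\<And>u v. u \<in> V \<Longrightarrow> J (push F u v) = - push F u v \<Longrightarrow> h_at F C' u v v = 0"
    and line: "\<And>u. u \<in> V \<Longrightarrow> \<exists>Y. Y \<noteq> 0 \<and> {v. J (push F u v) = - push F u v} = span {Y}"
    and u0: "u\<^sub>0 \<in> V"
  obtains I \<alpha> \<beta> A E U B \<Phi> \<Psi> where "admissible I \<alpha> \<beta> A E" "open U" "u\<^sub>0 \<in> U" "U \<subseteq> V" "open B" "B \<subseteq> slab I"
    "homeomorphism U B \<Phi> \<Psi>" "smooth_on U \<Phi>" "smooth_on B \<Psi>" "\<And>u. u \<in> U \<Longrightarrow> F u = p\<^sub>0 + f_map \<alpha> \<beta> A E (\<Phi> u)"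
proof -
  note openV = V
  have F: "smooth_on V F" using imm by (simp add: immersion_on_def)
  have tr: "transversal_on V F C" using bl by (simp add: blaschke_on_def)
  have lin: "linear (push F u)" and inj: "inj (push F u)" if "u \<in> V" for u
    using linear_push[OF F that] imm that by (auto simp: immersion_on_def)
  have sub: "subspace (range (push F u))" if "u \<in> V" for u
    by (rule linear_subspace_image[OF lin[OF that]]) simp
  have F0: "smooth_on V (\<lambda>u. F u - p\<^sub>0)" by (intro smooth_on_diff smooth_on_const V F)
  define P Q where "P u = fst_part (F u - p\<^sub>0)" and "Q u = snd_part (F u - p\<^sub>0)" for u
  have smP: "smooth_on V P" and smQ: "smooth_on V Q"
    unfolding P_def Q_def by (intro smooth_on_bounded_linear[OF _ V F0] bounded_linear_parts)+
  have dF0: "((\<lambda>u. F u - p\<^sub>0) has_derivative push F u) (at u)" if "u \<in> V" for u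
    using has_derivative_diff[OF has_derivative_push[OF F that] has_derivative_const] by simp
  have dP: "(P has_derivative (\<lambda>h. fst_part (push F u h))) (at u)"
    and dQ: "(Q has_derivative (\<lambda>h. snd_part (push F u h))) (at u)" if "u \<in> V" for u
    unfolding P_def Q_def by (intro bounded_linear.has_derivative[OF _ dF0[OF that]] bounded_linear_parts)+
  define P\<^sub>0 where "P\<^sub>0 = P u\<^sub>0"
  \<comment> \<open>if \<open>P\<^sub>0\<close> were \<open>0\<close>, the transversal vector \<open>C\<close> would be \<open>- JC\<close>, which is tangent\<close>
  have P0: "P\<^sub>0 \<noteq> 0"
  proof
    assume "P\<^sub>0 = 0"
    then have "J (F u\<^sub>0 - p\<^sub>0) = - (F u\<^sub>0 - p\<^sub>0)" unfolding J_eq_minus_iff by (simp add: P\<^sub>0_def P_def)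
    then have "J (C u\<^sub>0) = - C u\<^sub>0"
      unfolding C[OF u0] linear_scale[OF linear_J] by (simp only: scaleR_minus_right)
    then have "C u\<^sub>0 \<in> range (push F u\<^sub>0)"
      using subspace_neg[OF sub[OF u0] Jt[OF u0]] by simp
    then show False using tr u0 by (simp add: transversal_on_def)
  qed
  \<comment> \<open>the half-plane on which the coordinates \<open>x\<close> and \<open>z\<close> of \<open>P\<close> are defined\<close>
  define V1 where "V1 = V \<inter> P -` {p. p \<bullet> P\<^sub>0 > 0}"
  have V1: "open V1"
    unfolding V1_def by (intro continuous_open_preimage smooth_on_continuous[OF smP] V open_halfspace_gt[of _ P\<^sub>0, unfolded inner_commute[of P\<^sub>0]])
  have V1V: "V1 \<subseteq> V" and u01: "u\<^sub>0 \<in> V1" using u0 P0 by (auto simp: V1_def P\<^sub>0_def)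
  have pos: "P u \<bullet> P\<^sub>0 > 0" if "u \<in> V1" for u using that by (simp add: V1_def)
  define X Z where "X u = x_coord P\<^sub>0 (P u)" and "Z u = z_coord P\<^sub>0 (P u)" for u
  have smP1: "smooth_on V1 P" and smQ1: "smooth_on V1 Q" using smooth_on_subset V1V smP smQ by auto
  have dot: "smooth_on V1 (\<lambda>u. P u \<bullet> P\<^sub>0)" by (intro smooth_on_inner smooth_on_const V1 smP1)
  have smX: "smooth_on V1 X" unfolding X_def x_coord_def
  proof (rule smooth_on_divide[OF V1 _ dot])
    show "smooth_on V1 (\<lambda>u. det2 P\<^sub>0 (P u))"
      by (intro smooth_on_bilinear[OF bounded_bilinear_det2] smooth_on_const V1 smP1)
    show "P u \<bullet> P\<^sub>0 \<noteq> 0" if "u \<in> V1" for u using pos[OF that] by simp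
  qed
  have smZ: "smooth_on V1 Z" unfolding Z_def z_coord_def
  proof (intro smooth_on_minus smooth_on_ln V1)
    show "smooth_on V1 (\<lambda>u. P u \<bullet> P\<^sub>0 / (P\<^sub>0 \<bullet> P\<^sub>0))"
      by (rule smooth_on_divide[OF V1 dot]) (use P0 V1 in auto)
    show "P u \<bullet> P\<^sub>0 / (P\<^sub>0 \<bullet> P\<^sub>0) > 0" if "u \<in> V1" for u using pos[OF that] P0 by simp
  qed
  define W where "W u = exp (- Z u) *\<^sub>R Q u" for u
  have smW: "smooth_on V1 W" unfolding W_def
    by (intro smooth_on_scaleR smooth_on_exp smooth_on_minus V1 smZ smQ1)
  obtain Y\<^sub>0 where Y0: "Y\<^sub>0 \<noteq> 0" "{v. J (push F u\<^sub>0 v) = - push F u\<^sub>0 v} = span {Y\<^sub>0}" using line[OF u0] by blast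
  define l where "l = snd_part (push F u\<^sub>0 Y\<^sub>0)"
  have pY: "push F u\<^sub>0 Y\<^sub>0 = PQ 0 l"
  proof -
    have "Y\<^sub>0 \<in> {v. J (push F u\<^sub>0 v) = - push F u\<^sub>0 v}" unfolding Y0(2) by (simp add: span_base)
    then have "fst_part (push F u\<^sub>0 Y\<^sub>0) = 0" unfolding mem_Collect_eq J_eq_minus_iff .
    then show ?thesis using PQ_parts(1)[of "push F u\<^sub>0 Y\<^sub>0"] by (simp add: l_def)
  qed
  have l0: "l \<noteq> 0"
  proof
    assume "l = 0"
    then have "push F u\<^sub>0 Y\<^sub>0 = push F u\<^sub>0 0" using pY by (simp add: PQ_zero linear_0[OF lin[OF u0]])
    then show False using injD[OF inj[OF u0]] Y0(1) by blast
  qed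
  define \<Phi> where "\<Phi> u = (vector [X u, l \<bullet> W u, Z u] :: real^3)" for u
  have sm\<Phi>: "smooth_on V1 \<Phi>"
  proof (rule smooth_on_vec[OF V1])
    fix i :: 3
    show "smooth_on V1 (\<lambda>u. \<Phi> u $ i)"
      using exhaust_3[of i]
      by (elim disjE) (simp_all add: \<Phi>_def smX smZ smooth_on_inner[OF V1 smooth_on_const[OF V1] smW])
  qed
  have P_cone: "P u = exp (- (\<Phi> u $ 3)) *\<^sub>R base_line P\<^sub>0 (\<Phi> u $ 1)" if "u \<in> V1" for u
    using cone_coordinates[OF pos[OF that]] by (simp add: \<Phi>_def X_def Z_def)
  have Q_W: "Q u = exp (\<Phi> u $ 3) *\<^sub>R W u" for u
    by (simp add: \<Phi>_def W_def exp_minus)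
  have FPQ: "F u - p\<^sub>0 = PQ (P u) (Q u)" for u by (simp add: P_def Q_def)
  let ?\<rho> = "vector [- (P\<^sub>0$2), P\<^sub>0$1] :: real^2"
  have dbase: "(base_line P\<^sub>0 has_derivative (\<lambda>t. t *\<^sub>R ?\<rho>)) (at x)" for x
    unfolding base_line_def by (auto intro!: derivative_eq_intros)
  have "inj (frechet_derivative \<Phi> (at u\<^sub>0))"
  proof -
    let ?D = "frechet_derivative \<Phi> (at u\<^sub>0)"
    have d: "(\<Phi> has_derivative ?D) (at u\<^sub>0)" by (rule smooth_on_has_derivative[OF sm\<Phi> u01])
    have di: "((\<lambda>u. \<Phi> u $ i) has_derivative (\<lambda>h. ?D h $ i)) (at u\<^sub>0)" for i
      by (rule bounded_linear.has_derivative[OF bounded_linear_vec_nth d])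
    have lD: "linear ?D" using d by (rule has_derivative_linear)
    have "h = 0" if h: "?D h = 0" for h
    proof -
      have db: "((\<lambda>u. base_line P\<^sub>0 (\<Phi> u $ 1)) has_derivative (\<lambda>h. (?D h $ 1) *\<^sub>R ?\<rho>)) (at u\<^sub>0)"
        using diff_chain_at[OF di dbase] by (simp add: o_def)
      have de: "((\<lambda>u. exp (- (\<Phi> u $ 3))) has_derivative (\<lambda>h. - (?D h $ 3) * exp (- (\<Phi> u\<^sub>0 $ 3)))) (at u\<^sub>0)"
        by (auto intro!: derivative_eq_intros di)
      have "(P has_derivative (\<lambda>h. exp (- (\<Phi> u\<^sub>0 $ 3)) *\<^sub>R ((?D h $ 1) *\<^sub>R ?\<rho>)
          + (- (?D h $ 3) * exp (- (\<Phi> u\<^sub>0 $ 3))) *\<^sub>R base_line P\<^sub>0 (\<Phi> u\<^sub>0 $ 1))) (at u\<^sub>0)"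
        by (rule has_derivative_transform_within_open[OF has_derivative_scaleR[OF de db] V1 u01]) (simp add: P_cone)
      from fun_cong[OF has_derivative_unique[OF this dP[OF u0]], of h]
      have "fst_part (push F u\<^sub>0 h) = 0" using h by simp
      then have "h \<in> span {Y\<^sub>0}" using Y0(2) J_eq_minus_iff by blast
      then obtain k where k: "h = k *\<^sub>R Y\<^sub>0" by (auto simp: span_singleton)
      have "((\<lambda>u. l \<bullet> W u) has_derivative (\<lambda>h. l \<bullet> (exp (- (\<Phi> u\<^sub>0 $ 3)) *\<^sub>R snd_part (push F u\<^sub>0 h)
          + (- (?D h $ 3) * exp (- (\<Phi> u\<^sub>0 $ 3))) *\<^sub>R Q u\<^sub>0))) (at u\<^sub>0)"
        using has_derivative_inner_right[OF has_derivative_scaleR[OF de dQ[OF u0]], of l]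
        by (simp add: W_def \<Phi>_def)
      moreover have "((\<lambda>u. l \<bullet> W u) has_derivative (\<lambda>h. ?D h $ 2)) (at u\<^sub>0)"
        using di[of 2] by (simp add: \<Phi>_def)
      ultimately have "l \<bullet> (exp (- (\<Phi> u\<^sub>0 $ 3)) *\<^sub>R snd_part (push F u\<^sub>0 h)
          + (- (?D h $ 3) * exp (- (\<Phi> u\<^sub>0 $ 3))) *\<^sub>R Q u\<^sub>0) = ?D h $ 2"
        using has_derivative_unique by (metis (no_types, lifting))
      then have "l \<bullet> snd_part (push F u\<^sub>0 h) = 0" using h by simp
      then have "k * (l \<bullet> l) = 0"
        unfolding k linear_scale[OF lin[OF u0]] pY PQ_scale by simp
      then show "h = 0" using l0 k by simp
    qed
    then show ?thesis using linear_injective_0[OF lD] by blast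
  qed
  from smooth_local_inverse[OF V1 sm\<Phi> u01 this]
  obtain U' V' \<Psi> where U': "open U'" "U' \<subseteq> V1" "u\<^sub>0 \<in> U'" and V': "open V'" and hom': "homeomorphism U' V' \<Phi> \<Psi>"
    and sm\<Psi>': "smooth_on V' \<Psi>"
    and D\<Psi>: "\<And>y v. y \<in> V' \<Longrightarrow> frechet_derivative \<Phi> (at (\<Psi> y)) (frechet_derivative \<Psi> (at y) v) = v"
    by metis
  from box_neighbourhood[OF V' hom' U'(1,3)]
  obtain a b U where ab: "box a b \<subseteq> V'" and U: "open U" "u\<^sub>0 \<in> U" "U \<subseteq> U'" and hom: "homeomorphism U (box a b) \<Phi> \<Psi>"
    by metis
  define B where "B = box a b"
  have B: "open B" by (simp add: B_def open_box)
  have sm\<Psi>: "smooth_on B \<Psi>" using smooth_on_subset[OF sm\<Psi>'] ab by (simp add: B_def)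
  have \<Psi>U: "\<Psi> v \<in> U" "\<Phi> (\<Psi> v) = v" if "v \<in> B" for v
    using hom that by (auto simp: homeomorphism_def B_def)
  have \<Psi>1: "\<Psi> ` B \<subseteq> V1" using \<Psi>U(1) U(3) U'(2) by blast
  then have \<Psi>V: "\<Psi> ` B \<subseteq> V" using V1V by blast
  define G where "G v = F (\<Psi> v) - p\<^sub>0" for v
  define Wb where "Wb v = W (\<Psi> v)" for v
  have smWb: "smooth_on B Wb" unfolding Wb_def by (rule smooth_on_compose[OF B V1 sm\<Psi> smW \<Psi>1])
  have G: "G v = PQ (exp (- (v$3)) *\<^sub>R base_line P\<^sub>0 (v$1)) (exp (v$3) *\<^sub>R Wb v)" if "v \<in> B" for v
    using FPQ[of "\<Psi> v"] P_cone[of "\<Psi> v"] Q_W[of "\<Psi> v"] \<Psi>1 that \<Psi>U(2)[OF that] by (auto simp: G_def Wb_def)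
  have lW: "l \<bullet> Wb v = v$2" if "v \<in> B" for v
    using \<Psi>U(2)[OF that] by (auto simp: Wb_def \<Phi>_def vec_eq_iff forall_3)
  let ?DP = "\<lambda>v. frechet_derivative \<Psi> (at v)" and ?DW = "\<lambda>v. frechet_derivative Wb (at v)"
  have injP: "inj (?DP v)" if "v \<in> B" for v
    using D\<Psi>[of v] that ab by (intro inj_on_inverseI[where g = "frechet_derivative \<Phi> (at (\<Psi> v))"]) (auto simp: B_def)
  have dWb: "(Wb has_derivative ?DW v) (at v)" if "v \<in> B" for v by (rule smooth_on_has_derivative[OF smWb that])
  have lDW: "l \<bullet> ?DW v h = h$2" if v: "v \<in> B" for v h
  proof -
    have "((\<lambda>v. l \<bullet> Wb v) has_derivative (\<lambda>h. l \<bullet> ?DW v h)) (at v)"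
      by (rule has_derivative_inner_right[OF dWb[OF v]])
    moreover have "((\<lambda>v. l \<bullet> Wb v) has_derivative (\<lambda>h. h$2)) (at v)"
      by (rule has_derivative_transform_within_open[OF bounded_linear.has_derivative[OF bounded_linear_vec_nth has_derivative_ident] B v])
        (simp add: lW)
    ultimately show ?thesis using has_derivative_unique by (metis (no_types, lifting))
  qed
  have pushG: "push G v h = push F (\<Psi> v) (?DP v h)" if "v \<in> B" for v h
    by (rule push_compose(2)[OF B F sm\<Psi> \<Psi>V G_def that])
  have pushG': "push G v h = PQ (exp (- (v$3)) *\<^sub>R ((h$1) *\<^sub>R ?\<rho>) + (- (h$3) * exp (- (v$3))) *\<^sub>R base_line P\<^sub>0 (v$1))
      (exp (v$3) *\<^sub>R ?DW v h + (h$3 * exp (v$3)) *\<^sub>R Wb v)" if v: "v \<in> B" for v h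
  proof -
    have n: "((\<lambda>v::real^3. v$i) has_derivative (\<lambda>h. h$i)) (at v)" for i
      by (rule bounded_linear.has_derivative[OF bounded_linear_vec_nth has_derivative_ident])
    have e: "((\<lambda>v::real^3. exp (- (v$3))) has_derivative (\<lambda>h. - (h$3) * exp (- (v$3)))) (at v)"
      "((\<lambda>v::real^3. exp (v$3)) has_derivative (\<lambda>h. h$3 * exp (v$3))) (at v)"
      by (auto intro!: derivative_eq_intros n)
    have db: "((\<lambda>v. base_line P\<^sub>0 (v$1)) has_derivative (\<lambda>h. (h$1) *\<^sub>R ?\<rho>)) (at v)"
      using diff_chain_at[OF n dbase] by (simp add: o_def)
    have "(G has_derivative (\<lambda>h. PQ (exp (- (v$3)) *\<^sub>R ((h$1) *\<^sub>R ?\<rho>) + (- (h$3) * exp (- (v$3))) *\<^sub>R base_line P\<^sub>0 (v$1))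
      (exp (v$3) *\<^sub>R ?DW v h + (h$3 * exp (v$3)) *\<^sub>R Wb v))) (at v)"
      by (rule has_derivative_transform_within_open[OF has_derivative_PQ[OF has_derivative_scaleR[OF e(1) db]
          has_derivative_scaleR[OF e(2) dWb[OF v]]] B v]) (simp add: G)
    from push_eqI[OF this] show ?thesis by simp
  qed
  have pushG2: "push G v (axis 2 1) = PQ 0 (exp (v$3) *\<^sub>R ?DW v (axis 2 1))" if "v \<in> B" for v
    unfolding pushG'[OF that] by (simp add: axis_nth_if)
  \<comment> \<open>the tangent vectors with vanishing first component form the null line, which contains \<open>G\<^sub>y\<close>\<close>
  have key: "\<exists>k. w = k *\<^sub>R ?DW v (axis 2 1)"
    if v: "v \<in> B" and w: "PQ 0 (exp (v$3) *\<^sub>R w) \<in> range (push F (\<Psi> v))" for v w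
  proof -
    have in_V: "\<Psi> v \<in> V" using \<Psi>V v by blast
    obtain Y where Y: "{h. J (push F (\<Psi> v) h) = - push F (\<Psi> v) h} = span {Y}" using line[OF in_V] by blast
    obtain h where h: "PQ 0 (exp (v$3) *\<^sub>R w) = push F (\<Psi> v) h" using w by blast
    have "h \<in> span {Y}" unfolding Y[symmetric] mem_Collect_eq J_eq_minus_iff h[symmetric] by simp
    then obtain k2 where k2: "h = k2 *\<^sub>R Y" by (auto simp: span_singleton)
    have "?DP v (axis 2 1) \<in> span {Y}"
      unfolding Y[symmetric] mem_Collect_eq J_eq_minus_iff pushG[OF v, symmetric] pushG2[OF v] by simp
    then obtain k1 where k1: "?DP v (axis 2 1) = k1 *\<^sub>R Y" by (auto simp: span_singleton)
    have "?DP v (axis 2 1) \<noteq> 0"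
    proof
      assume "?DP v (axis 2 1) = 0"
      also have "0 = ?DP v 0"
        using linear_0[OF has_derivative_linear[OF smooth_on_has_derivative[OF sm\<Psi> v]]] by simp
      finally show False using injD[OF injP[OF v]] by (metis axis_eq_0_iff zero_neq_one)
    qed
    then have "h = (k2 / k1) *\<^sub>R ?DP v (axis 2 1)" using k1 k2 by auto
    then have "PQ 0 (exp (v$3) *\<^sub>R w) = (k2 / k1) *\<^sub>R push G v (axis 2 1)"
      unfolding h pushG[OF v] by (simp only: linear_scale[OF lin[OF in_V]])
    then have "exp (v$3) *\<^sub>R w = exp (v$3) *\<^sub>R ((k2 / k1) *\<^sub>R ?DW v (axis 2 1))"
      unfolding pushG2[OF v] PQ_scale by (simp add: mult.commute)
    then have "w = (k2 / k1) *\<^sub>R ?DW v (axis 2 1)" by (metis exp_not_eq_zero scale_left_imp_eq)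
    then show ?thesis by blast
  qed
  \<comment> \<open>\<open>G\<^sub>z + J G\<close> is tangent and has vanishing first component\<close>
  have z: "?DW v (axis 3 1) = 0" if v: "v \<in> B" for v
  proof -
    have in_V: "\<Psi> v \<in> V" using \<Psi>V v by blast
    have "J (C (\<Psi> v)) = r *\<^sub>R J (G v)" by (simp add: C[OF in_V] G_def linear_scale[OF linear_J])
    then have "r *\<^sub>R J (G v) \<in> range (push F (\<Psi> v))" using Jt[OF in_V] by simp
    from subspace_scale[OF sub[OF in_V] this, of "1 / r"] have "J (G v) \<in> range (push F (\<Psi> v))" using r by simp
    moreover have "push G v (axis 3 1) \<in> range (push F (\<Psi> v))" using pushG[OF v] by auto
    ultimately have "push G v (axis 3 1) + J (G v) \<in> range (push F (\<Psi> v))" by (intro subspace_add[OF sub[OF in_V]])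
    moreover have "push G v (axis 3 1) + J (G v) = PQ 0 (exp (v$3) *\<^sub>R ?DW v (axis 3 1))"
      unfolding pushG'[OF v] G[OF v] J_PQ PQ_add by (simp add: axis_nth_if)
    ultimately obtain k where k: "?DW v (axis 3 1) = k *\<^sub>R ?DW v (axis 2 1)" using key[OF v] by metis
    then have "l \<bullet> ?DW v (axis 3 1) = k * (l \<bullet> ?DW v (axis 2 1))" by simp
    then have "k = 0" unfolding lDW[OF v] by (simp add: axis_nth_if)
    then show ?thesis using k by simp
  qed
  \<comment> \<open>\<open>G\<^sub>y\<^sub>y\<close> is tangent because \<open>G\<^sub>y\<close> is null, and has vanishing first component\<close>
  have tt: "frechet_derivative (\<lambda>v. ?DW v (axis 2 1)) (at v) (axis 2 1) = 0" if v: "v \<in> B" for v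
  proof -
    let ?DD = "frechet_derivative (\<lambda>v. ?DW v (axis 2 1)) (at v)"
    have in_V: "\<Psi> v \<in> V" using \<Psi>V v by blast
    have t': "transversal_at F C' (\<Psi> v)" by (rule transversal_atI[OF imm tr' in_V])
    have dd: "((\<lambda>v. ?DW v (axis 2 1)) has_derivative ?DD) (at v)"
      by (rule smooth_on_has_derivative[OF smooth_on_frechet[OF smWb] v])
    have e: "((\<lambda>v::real^3. exp (v$3)) has_derivative (\<lambda>h. h$3 * exp (v$3))) (at v)"
      by (auto intro!: derivative_eq_intros bounded_linear.has_derivative[OF bounded_linear_vec_nth has_derivative_ident])
    have "push2 G v (axis 2 1) (axis 2 1) = PQ 0 (exp (v$3) *\<^sub>R ?DD (axis 2 1)
        + ((axis 2 1 :: real^3) $ 3 * exp (v$3)) *\<^sub>R ?DW v (axis 2 1))"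
      by (rule push2_eqI[OF B v pushG2 has_derivative_PQ[OF has_derivative_const has_derivative_scaleR[OF e dd]]])
    then have p2: "push2 G v (axis 2 1) (axis 2 1) = PQ 0 (exp (v$3) *\<^sub>R ?DD (axis 2 1))" by (simp add: axis_nth_if)
    obtain c where c: "push2 G v (axis 2 1) (axis 2 1)
        = push2 F (\<Psi> v) (?DP v (axis 2 1)) (?DP v (axis 2 1)) + push F (\<Psi> v) c"
      using push2_compose[OF B V F sm\<Psi> \<Psi>V G_def v] by blast
    have "J (push F (\<Psi> v) (?DP v (axis 2 1))) = - push F (\<Psi> v) (?DP v (axis 2 1))"
      unfolding J_eq_minus_iff pushG[OF v, symmetric] pushG2[OF v] by simp
    then have "push2 F (\<Psi> v) (?DP v (axis 2 1)) (?DP v (axis 2 1)) \<in> range (push F (\<Psi> v))"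
      using null[OF in_V] unfolding h_at_push2 transversal_part_eq_0_iff[OF t'] by blast
    then have "PQ 0 (exp (v$3) *\<^sub>R ?DD (axis 2 1)) \<in> range (push F (\<Psi> v))"
      using subspace_add[OF sub[OF in_V]] c p2 by auto
    then obtain k where k: "?DD (axis 2 1) = k *\<^sub>R ?DW v (axis 2 1)" using key[OF v] by blast
    have "((\<lambda>v. l \<bullet> ?DW v (axis 2 1)) has_derivative (\<lambda>h. 0)) (at v)"
      by (rule has_derivative_transform_within_open[OF has_derivative_const B v, of 1]) (simp add: lDW axis_nth_if)
    moreover have "((\<lambda>v. l \<bullet> ?DW v (axis 2 1)) has_derivative (\<lambda>h. l \<bullet> ?DD h)) (at v)"
      by (rule has_derivative_inner_right[OF dd])
    ultimately have "l \<bullet> ?DD (axis 2 1) = 0" using has_derivative_unique by (metis (no_types, lifting))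
    then have "k = 0" unfolding k inner_scaleR_right lDW[OF v] by (simp add: axis_nth_if)
    then show ?thesis using k by simp
  qed
  have "box a b \<noteq> {}" using hom U(2) by (auto simp: homeomorphism_def)
  from ruled_of_derivatives[OF smWb[unfolded B_def] z[unfolded B_def] tt[unfolded B_def] this]
  obtain q n where sm: "smooth_on {a$1<..<b$1} q" "smooth_on {a$1<..<b$1} n"
    and Wqn: "\<And>v. v \<in> B \<Longrightarrow> Wb v = v$2 *\<^sub>R q (v$1) + n (v$1)"
    unfolding B_def by metis
  let ?I = "{a$1<..<b$1}"
  have BI: "B \<subseteq> slab ?I" by (auto simp: B_def slab_def mem_box_cart)
  interpret ruled_hypersurface ?I "base_line P\<^sub>0" q n B G
    by unfold_locales (use sm B BI in \<open>auto intro: smooth_on_base_line simp: G Wqn ruled_def\<close>)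
  have vol: "det2 (base_line P\<^sub>0 (v$1)) (deriv_curve (base_line P\<^sub>0) (v$1)) \<noteq> 0" "det2 (q (v$1)) (n (v$1)) \<noteq> 0"
    "(det2 (q (v$1)) (deriv_curve q (v$1)))\<^sup>2 = 256 * \<bar>r\<bar>^5
      * (det2 (base_line P\<^sub>0 (v$1)) (deriv_curve (base_line P\<^sub>0) (v$1)))\<^sup>2 * (det2 (q (v$1)) (n (v$1)))^4"
    if v: "v \<in> B" for v
  proof -
    define C2 where "C2 v = r *\<^sub>R G v" for v
    have C2: "C2 v = C (\<Psi> v)" using C[of "\<Psi> v"] \<Psi>V v by (auto simp: C2_def G_def)
    have t2: "transversal_at G C2 v"
      by (rule blaschke_compose(1)[where C = C and C' = C2 and y = v and \<Psi> = \<Psi> and G = G, OF B openV imm bl sm\<Psi> \<Psi>V G_def v C2 injP[OF v]])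
    have d2: "\<bar>det (\<chi> i j. h_at G C2 v (axis i 1) (axis j 1))\<bar>
      = (det4 (push G v (axis 1 1)) (push G v (axis 2 1)) (push G v (axis 3 1)) (C2 v))\<^sup>2"
      by (rule blaschke_compose(2)[where C = C and C' = C2 and y = v and \<Psi> = \<Psi> and G = G, OF B openV imm bl sm\<Psi> \<Psi>V G_def v C2 injP[OF v]])
    note vc = volume_condition_F[where C = C2 and r = r, OF v _ r t2]
    show "det2 (base_line P\<^sub>0 (v$1)) (deriv_curve (base_line P\<^sub>0) (v$1)) \<noteq> 0" "det2 (q (v$1)) (n (v$1)) \<noteq> 0"
      by (rule vc(1) vc(2), simp add: C2_def)+
    have "C2 v = r *\<^sub>R G v" by (simp add: C2_def)
    from vc(3)[OF this] d2 show "(det2 (q (v$1)) (deriv_curve q (v$1)))\<^sup>2 = 256 * \<bar>r\<bar>^5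
      * (det2 (base_line P\<^sub>0 (v$1)) (deriv_curve (base_line P\<^sub>0) (v$1)))\<^sup>2 * (det2 (q (v$1)) (n (v$1)))^4"
      by blast
  qed
  obtain c where c: "c \<in> B" using \<open>box a b \<noteq> {}\<close> by (auto simp: B_def)
  have slice: "\<exists>v\<in>B. v$1 = x" if "x \<in> ?I" for x
    using that c by (intro bexI[of _ "vector [x, c$2, c$3]"]) (auto simp: B_def mem_box_cart forall_3)
  have "a$1 < c$1" "c$1 < b$1" using c by (auto simp: B_def mem_box_cart)
  then have ne: "?I \<noteq> {}" by auto
  have vol1: "det2 (base_line P\<^sub>0 x) (deriv_curve (base_line P\<^sub>0) x) \<noteq> 0" if "x \<in> ?I" for x
    using slice[OF that] vol(1) by auto
  have vol2: "det2 (q x) (n x) \<noteq> 0" if "x \<in> ?I" for x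
    using slice[OF that] vol(2) by auto
  have vol3: "(det2 (q x) (deriv_curve q x))\<^sup>2 = 256 * \<bar>r\<bar>^5
      * (det2 (base_line P\<^sub>0 x) (deriv_curve (base_line P\<^sub>0) x))\<^sup>2 * (det2 (q x) (n x))^4" if "x \<in> ?I" for x
    using slice[OF that] vol(3) by auto
  obtain \<alpha> A E where adm: "admissible ?I \<alpha> (base_line P\<^sub>0) A E"
    and f: "\<And>v. v \<in> slab ?I \<Longrightarrow> f_map \<alpha> (base_line P\<^sub>0) A E v = ruled (base_line P\<^sub>0) q n v"
    by (rule ruled_eq_f_map[OF I _ ne smooth vol1 vol2 r vol3]) (auto intro: is_interval_oo)
  have "F u = p\<^sub>0 + f_map \<alpha> (base_line P\<^sub>0) A E (\<Phi> u)" if "u \<in> U" for u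
  proof -
    have "\<Phi> u \<in> B" "\<Psi> (\<Phi> u) = u" using hom that by (auto simp: homeomorphism_def B_def)
    then have "f_map \<alpha> (base_line P\<^sub>0) A E (\<Phi> u) = F u - p\<^sub>0"
      using f[of "\<Phi> u"] F_eq[of "\<Phi> u"] BI by (auto simp: G_def)
    then show ?thesis by simp
  qed
  moreover have "smooth_on U \<Phi>" using smooth_on_subset[OF sm\<Phi>] U(3) U'(2) by blast
  moreover have "U \<subseteq> V" using U(3) U'(2) V1V by blast
  ultimately show thesis
    using that[OF adm U(1,2) _ B BI hom[folded B_def] _ sm\<Psi>] by blast
qed


section \<open>From charts to the manifold\<close>

lemma chart_inj: "is_chart X c \<Longrightarrow> inj_on (snd c) (fst c)"
  unfolding is_chart_def
  using homeomorphic_imp_injective_map[of "subtopology X (fst c)" "top_of_set (chart_range c)" "snd c"]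
    openin_subset[of X "fst c"] by (auto simp: Int_absorb1)

lemma local_rep_chart: "is_chart X c \<Longrightarrow> p \<in> fst c \<Longrightarrow> local_rep c f (snd c p) = f p"
  by (simp add: local_rep_def inv_into_f_f[OF chart_inj])

lemma chart_preimage_open:
  assumes "is_chart X c" "open W"
  shows "openin X {p \<in> fst c. snd c p \<in> W}"
proof -
  have op: "openin X (fst c)" and "continuous_map (subtopology X (fst c)) (top_of_set (chart_range c)) (snd c)"
    using assms(1) homeomorphic_imp_continuous_map by (auto simp: is_chart_def)
  then have "continuous_map (subtopology X (fst c)) euclidean (snd c)"
    by (simp add: continuous_map_in_subtopology)
  then have "openin (subtopology X (fst c)) {p \<in> topspace (subtopology X (fst c)). snd c p \<in> W}"
    using assms(2) by (intro openin_continuous_map_preimage) auto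
  moreover have "topspace (subtopology X (fst c)) = fst c"
    using openin_subset[OF op] by auto
  ultimately have "openin (subtopology X (fst c)) {p \<in> fst c. snd c p \<in> W}" by (simp only:)
  then show ?thesis unfolding openin_open_subtopology[OF op] by blast
qed

lemma open_overlap:
  assumes "is_chart X c" "openin X (fst c')"
  shows "open (overlap c c')"
proof -
  have "homeomorphic_map (subtopology X (fst c)) (top_of_set (chart_range c)) (snd c)"
    and r: "open (chart_range c)"
    using assms(1) by (auto simp: is_chart_def)
  then have "open_map (subtopology X (fst c)) (top_of_set (chart_range c)) (snd c)"
    using homeomorphic_imp_open_map by blast
  moreover have "openin (subtopology X (fst c)) (fst c \<inter> fst c')"
    using assms(2) openin_subtopology_Int2 by blast
  ultimately have "openin (top_of_set (chart_range c)) (overlap c c')"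
    unfolding overlap_def open_map_def by blast
  then show ?thesis using r openin_open_trans by blast
qed

text \<open>All sets \<open>{q. R (\<phi> q)}\<close> are open; a fibre of \<open>\<phi>\<close> and its complement are of this form.\<close>

lemma constant_of_locally_constant:
  assumes "connected_space X" and loc: "\<And>p. p \<in> topspace X \<Longrightarrow> \<exists>N. openin X N \<and> p \<in> N \<and> (\<forall>q\<in>N. \<phi> q = \<phi> p)"
    and "p \<in> topspace X" "q \<in> topspace X"
  shows "\<phi> q = \<phi> p"
proof -
  have op: "openin X {q \<in> topspace X. R (\<phi> q)}" for R
  proof (subst openin_subopen, safe)
    fix q assume q: "q \<in> topspace X" "R (\<phi> q)"
    obtain N where N: "openin X N" "q \<in> N" "\<forall>s\<in>N. \<phi> s = \<phi> q" using loc[OF q(1)] by blast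
    have "N \<subseteq> {q \<in> topspace X. R (\<phi> q)}"
    proof
      fix s assume s: "s \<in> N"
      show "s \<in> {q \<in> topspace X. R (\<phi> q)}"
        using bspec[OF N(3) s] q(2) openin_subset[OF N(1)] s by auto
    qed
    then show "\<exists>T. openin X T \<and> q \<in> T \<and> T \<subseteq> {q \<in> topspace X. R (\<phi> q)}"
      using N(1,2) by (intro exI[of _ N]) simp
  qed
  let ?T = "{q \<in> topspace X. \<phi> q = \<phi> p}"
  have "topspace X - ?T = {q \<in> topspace X. \<phi> q \<noteq> \<phi> p}" by auto
  then have "closedin X ?T" unfolding closedin_def using op[of "\<lambda>y. y \<noteq> \<phi> p"] by simp
  with op[of "\<lambda>y. y = \<phi> p"] have "?T = {} \<or> ?T = topspace X"
    using assms(1) unfolding connected_space_clopen_in by blast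
  then show ?thesis using assms(3,4) by auto
qed

text \<open>The map \<open>C + l f\<close> has derivative zero in every chart, where \<open>l\<close> is the eigenvalue of the shape
  operator, so it is constant on the connected manifold. Division by \<open>l \<noteq> 0\<close> gives the centre.\<close>

lemma hypersphere_centre:
  assumes hs: "affine_hypersphere X \<A> f C" and Jt: "J_tangent \<A> f C" and ne: "topspace X \<noteq> {}"
  obtains r p\<^sub>0 where "r \<noteq> 0" "\<And>p. p \<in> topspace X \<Longrightarrow> C p = r *\<^sub>R (f p - p\<^sub>0)"
proof -
  obtain l where l: "\<And>c u v. c \<in> \<A> \<Longrightarrow> u \<in> chart_range c \<Longrightarrow> shape_operator (local_rep c f) (local_rep c C) u v = l *\<^sub>R v"
    using hs unfolding affine_hypersphere_def by blast
  have atlas: "smooth_atlas X \<A>" and conn: "connected_space X"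
    and imm: "\<And>c. c \<in> \<A> \<Longrightarrow> immersion_on (chart_range c) (local_rep c f)"
    and bl: "\<And>c. c \<in> \<A> \<Longrightarrow> blaschke_on (chart_range c) (local_rep c f) (local_rep c C)"
    using hs by (auto simp: affine_hypersphere_def nondegenerate_hypersurface_def
        connected_orientable_3manifold_def blaschke_field_def)
  have chart: "is_chart X c" if "c \<in> \<A>" for c using atlas that by (simp add: smooth_atlas_def)
  have cover: "\<exists>c\<in>\<A>. p \<in> fst c" if "p \<in> topspace X" for p using atlas that by (auto simp: smooth_atlas_def)
  have opV: "open (chart_range c)" if "c \<in> \<A>" for c using chart[OF that] by (simp add: is_chart_def)
  obtain p1 where p1: "p1 \<in> topspace X" using ne by blast
  then obtain c1 where c1: "c1 \<in> \<A>" "p1 \<in> fst c1" using cover by blast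
  have "l \<noteq> 0"
  proof (rule J_tangent_sphere_proper[OF opV[OF c1(1)] _ imm[OF c1(1)] bl[OF c1(1)] l[OF c1(1)]])
    show "snd c1 p1 \<in> chart_range c1" using c1(2) by (simp add: chart_range_def)
    show "J (local_rep c1 C u) \<in> range (push (local_rep c1 f) u)" if "u \<in> chart_range c1" for u
      using Jt c1(1) that by (simp add: J_tangent_def)
  qed
  define \<phi> where "\<phi> p = C p + l *\<^sub>R f p" for p
  have "\<phi> p = \<phi> p1" if p: "p \<in> topspace X" for p
  proof (rule constant_of_locally_constant[OF conn _ p1 p])
    fix p assume "p \<in> topspace X"
    then obtain c where c: "c \<in> \<A>" "p \<in> fst c" using cover by blast
    let ?F = "local_rep c f" and ?C = "local_rep c C"
    have "snd c p \<in> chart_range c" using c(2) by (simp add: chart_range_def)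
    then obtain e where e: "e > 0" "ball (snd c p) e \<subseteq> chart_range c"
      using opV[OF c(1)] open_contains_ball by blast
    have "((\<lambda>u. ?C u + l *\<^sub>R ?F u) has_derivative (\<lambda>h. 0)) (at u within ball (snd c p) e)"
      if "u \<in> ball (snd c p) e" for u
    proof -
      have u: "u \<in> chart_range c" using that e by blast
      have "smooth_on (chart_range c) ?F" using imm[OF c(1)] by (simp add: immersion_on_def)
      from has_derivative_add[OF sphere_derivative[OF imm[OF c(1)] bl[OF c(1)] l[OF c(1)] u]
          has_derivative_scaleR_right[OF has_derivative_push[OF this u]], of l]
      show ?thesis by (simp add: has_derivative_at_withinI)
    qed
    then obtain k where k: "\<And>u. u \<in> ball (snd c p) e \<Longrightarrow> ?C u + l *\<^sub>R ?F u = k"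
      using has_derivative_zero_constant[OF convex_ball, of "snd c p" e "\<lambda>u. ?C u + l *\<^sub>R ?F u"] by blast
    let ?N = "{q \<in> fst c. snd c q \<in> ball (snd c p) e}"
    have "\<phi> q = k" if "q \<in> ?N" for q
    proof -
      have "q \<in> fst c" using that by simp
      note local_rep_chart[OF chart[OF c(1)] this, of f] local_rep_chart[OF chart[OF c(1)] this, of C]
      then show ?thesis using k[of "snd c q"] that by (simp add: \<phi>_def)
    qed
    moreover have "p \<in> ?N" using c(2) e(1) by simp
    ultimately have "p \<in> ?N" "\<forall>q\<in>?N. \<phi> q = \<phi> p" by auto
    with chart_preimage_open[OF chart[OF c(1)] open_ball, of "snd c p" e]
    show "\<exists>N. openin X N \<and> p \<in> N \<and> (\<forall>q\<in>N. \<phi> q = \<phi> p)" by blast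
  qed
  then have "C p = (- l) *\<^sub>R (f p - (1 / l) *\<^sub>R \<phi> p1)" if "p \<in> topspace X" for p
    using that \<open>l \<noteq> 0\<close> by (simp add: \<phi>_def algebra_simps)
  then show thesis using that[of "- l"] \<open>l \<noteq> 0\<close> by simp
qed

lemma homeomorphic_map_of_homeomorphism:
  "homeomorphism U B \<Phi> \<Psi> \<Longrightarrow> homeomorphic_map (top_of_set U) (top_of_set B) \<Phi>"
  unfolding homeomorphic_map_maps homeomorphic_maps_def homeomorphism_def
  by (intro exI[of _ \<Psi>]) (auto simp: continuous_map_in_subtopology)

text \<open>A chart of the atlas followed by a local diffeomorphism of \<open>\<real>\<^sup>3\<close> is again a coordinate chart.\<close>

lemma coordinate_chart_compose:
  assumes atlas: "smooth_atlas X \<A>" and c0: "c0 \<in> \<A>"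
    and U: "open U" "U \<subseteq> chart_range c0" and B: "open B"
    and hom: "homeomorphism U B \<Phi> \<Psi>" and sm: "smooth_on U \<Phi>" "smooth_on B \<Psi>"
  defines "N \<equiv> {p \<in> fst c0. snd c0 p \<in> U}"
  shows "coordinate_chart X \<A> (N, \<Phi> \<circ> snd c0)" "chart_range (N, \<Phi> \<circ> snd c0) = B"
proof -
  let ?c = "(N, \<Phi> \<circ> snd c0)"
  have chart0: "is_chart X c0" and charts: "\<And>c. c \<in> \<A> \<Longrightarrow> is_chart X c"
    using atlas c0 by (auto simp: smooth_atlas_def)
  have N: "openin X N" unfolding N_def by (rule chart_preimage_open[OF chart0 U(1)])
  have img: "snd c0 ` N = U" using U(2) by (auto simp: N_def chart_range_def)
  show rng: "chart_range ?c = B"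
    using hom unfolding chart_range_def homeomorphism_def by (simp only: fst_conv snd_conv image_comp[symmetric] img)
  have NX: "N \<subseteq> fst c0" "fst c0 \<subseteq> topspace X"
    using openin_subset chart0 by (auto simp: N_def is_chart_def)
  have "homeomorphic_map (subtopology (subtopology X (fst c0)) N) (subtopology (top_of_set (chart_range c0)) U) (snd c0)"
  proof (rule homeomorphic_map_subtopologies)
    show "homeomorphic_map (subtopology X (fst c0)) (top_of_set (chart_range c0)) (snd c0)"
      using chart0 by (simp add: is_chart_def)
    show "snd c0 ` (topspace (subtopology X (fst c0)) \<inter> N) = topspace (top_of_set (chart_range c0)) \<inter> U"
      using NX U(2) img by (simp add: Int_absorb1 Int_absorb2 inf.coboundedI1)
  qed
  then have "homeomorphic_map (subtopology X N) (top_of_set U) (snd c0)"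
    using NX U(2) by (simp add: subtopology_subtopology Int_absorb1 Int_absorb2)
  from homeomorphic_map_compose[OF this homeomorphic_map_of_homeomorphism[OF hom]]
  have chart: "is_chart X ?c"
    unfolding is_chart_def rng using N B by simp
  have \<Psi>\<Phi>: "\<Psi> (\<Phi> (snd c0 q)) = snd c0 q" if "q \<in> N" for q
    using hom that by (auto simp: N_def homeomorphism_def)
  have "compatible ?c c'" if c': "c' \<in> \<A>" for c'
  proof -
    have comp: "smooth_on (overlap c0 c') (local_rep c0 (snd c'))" "smooth_on (overlap c' c0) (local_rep c' (snd c0))"
      using atlas c0 c' by (auto simp: smooth_atlas_def compatible_def)
    have op': "openin X (fst c')" and op0: "openin X (fst c0)"
      using charts[OF c'] chart0 by (auto simp: is_chart_def)
    have O: "open (overlap ?c c')" "open (overlap c' ?c)" "open (overlap c0 c')"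
      using open_overlap[OF chart op'] open_overlap[OF charts[OF c'], of ?c] open_overlap[OF chart0 op'] N by auto
    have "smooth_on (overlap ?c c') (\<lambda>w. local_rep c0 (snd c') (\<Psi> w))"
    proof (rule smooth_on_compose[OF O(1,3) _ comp(1)])
      show "smooth_on (overlap ?c c') \<Psi>"
        by (rule smooth_on_subset[OF sm(2)]) (auto simp: overlap_def rng[symmetric] chart_range_def)
      show "\<Psi> ` overlap ?c c' \<subseteq> overlap c0 c'"
        using NX by (auto simp: overlap_def \<Psi>\<Phi>)
    qed
    moreover have "local_rep ?c (snd c') w = local_rep c0 (snd c') (\<Psi> w)" if w: "w \<in> overlap ?c c'" for w
    proof -
      obtain q where q: "w = \<Phi> (snd c0 q)" "q \<in> N" "q \<in> fst c'" using w by (auto simp: overlap_def)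
      have "local_rep ?c (snd c') w = snd c' q"
        using local_rep_chart[OF chart, of q "snd c'"] q by simp
      moreover have "local_rep c0 (snd c') (\<Psi> w) = snd c' q"
        using local_rep_chart[OF chart0, of q "snd c'"] q \<Psi>\<Phi>[OF q(2)] NX by auto
      ultimately show ?thesis by simp
    qed
    ultimately have 1: "smooth_on (overlap ?c c') (local_rep ?c (snd c'))"
      using smooth_on_cong[OF O(1), of "local_rep ?c (snd c')" "\<lambda>w. local_rep c0 (snd c') (\<Psi> w)"] by blast
    have "smooth_on (overlap c' ?c) (\<lambda>w. \<Phi> (local_rep c' (snd c0) w))"
    proof (rule smooth_on_compose[OF O(2) U(1) _ sm(1)])
      show "smooth_on (overlap c' ?c) (local_rep c' (snd c0))"
        by (rule smooth_on_subset[OF comp(2)]) (use NX in \<open>auto simp: overlap_def\<close>)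
      show "local_rep c' (snd c0) ` overlap c' ?c \<subseteq> U"
        using local_rep_chart[OF charts[OF c'], of _ "snd c0"] by (auto simp: overlap_def N_def)
    qed
    then have 2: "smooth_on (overlap c' ?c) (local_rep c' (snd ?c))"
      by (simp add: local_rep_def o_def)
    show ?thesis unfolding compatible_def using 1 2 by blast
  qed
  then show "coordinate_chart X \<A> ?c"
    unfolding coordinate_chart_def using chart by blast
qed

lemma null_hypersphere_normal_form:
  assumes hs: "affine_hypersphere X \<A> f C" and Jt: "J_tangent \<A> f C" and nd: "null_direction \<A> f (D_minus f)"
    and r: "r \<noteq> 0" and C: "\<And>p. p \<in> topspace X \<Longrightarrow> C p = r *\<^sub>R (f p - p\<^sub>0)" and p: "p \<in> topspace X"
  shows "\<exists>I \<alpha> \<beta> A E. admissible I \<alpha> \<beta> A E \<and>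
           (\<exists>c. coordinate_chart X \<A> c \<and> p \<in> fst c \<and> chart_range c \<subseteq> slab I \<and>
             (\<forall>q\<in>fst c. f q = p\<^sub>0 + f_map \<alpha> \<beta> A E (snd c q)))"
proof -
  have atlas: "smooth_atlas X \<A>"
    using hs by (simp add: affine_hypersphere_def nondegenerate_hypersurface_def connected_orientable_3manifold_def)
  obtain c0 where c0: "c0 \<in> \<A>" "p \<in> fst c0" using atlas p unfolding smooth_atlas_def by blast
  have chart0: "is_chart X c0" using atlas c0 by (simp add: smooth_atlas_def)
  let ?V = "chart_range c0" and ?F = "local_rep c0 f" and ?C = "local_rep c0 C"
  have V: "open ?V" and pV: "snd c0 p \<in> ?V" using chart0 c0(2) by (auto simp: is_chart_def chart_range_def)
  have imm: "immersion_on ?V ?F" and bl: "blaschke_on ?V ?F ?C"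
    using hs c0(1) by (auto simp: affine_hypersphere_def nondegenerate_hypersurface_def blaschke_field_def)
  have lin: "linear (push ?F u)" if "u \<in> ?V" for u
    using imm linear_push that by (auto simp: immersion_on_def)
  have CV: "?C u = r *\<^sub>R (?F u - p\<^sub>0)" if "u \<in> ?V" for u
  proof -
    obtain q where q: "q \<in> fst c0" "u = snd c0 q" using \<open>u \<in> ?V\<close> by (auto simp: chart_range_def)
    moreover have "q \<in> topspace X" using chart0 q(1) openin_subset by (auto simp: is_chart_def)
    ultimately show ?thesis using C local_rep_chart[OF chart0 q(1), of f] local_rep_chart[OF chart0 q(1), of C] by simp
  qed
  have JV: "J (?C u) \<in> range (push ?F u)" if "u \<in> ?V" for u
    using Jt c0(1) that by (simp add: J_tangent_def)
  obtain C' where C': "transversal_on ?V ?F C'" "\<And>u v. u \<in> ?V \<Longrightarrow> v \<in> D_minus f c0 u \<Longrightarrow> h_at ?F C' u v v = 0"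
    using nd c0(1) unfolding null_direction_def by blast
  have null: "h_at ?F C' u v v = 0" if "u \<in> ?V" "J (push ?F u v) = - push ?F u v" for u v
    using C'(2)[OF that(1)] that(2) D_minus_eq[OF lin[OF that(1)]] by blast
  have line: "\<exists>Y. Y \<noteq> 0 \<and> {v. J (push ?F u v) = - push ?F u v} = span {Y}" if u: "u \<in> ?V" for u
  proof -
    have "line_distribution \<A> (D_minus f)" using nd by (simp add: null_direction_def)
    then have "\<forall>c\<in>\<A>. \<forall>u\<in>chart_range c. \<exists>W Y. open W \<and> u \<in> W \<and> W \<subseteq> chart_range c \<and> smooth_on W Y \<and>
        (\<forall>w\<in>W. Y w \<noteq> (0::real^3) \<and> D_minus f c w = span {Y w})"
      unfolding line_distribution_def by (rule conjunct2)
    from bspec[OF bspec[OF this c0(1)] u]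
    obtain W Y where W: "u \<in> W" "\<forall>w\<in>W. Y w \<noteq> (0::real^3) \<and> D_minus f c0 w = span {Y w}"
      by (elim exE conjE)
    from bspec[OF W(2,1)] show ?thesis unfolding D_minus_eq[OF lin[OF u]] by blast
  qed
  obtain I \<alpha> \<beta> A E U B \<Phi> \<Psi> where adm: "admissible I \<alpha> \<beta> A E"
    and U: "open U" "snd c0 p \<in> U" "U \<subseteq> ?V" and B: "open B" "B \<subseteq> slab I"
    and hom: "homeomorphism U B \<Phi> \<Psi>" and sm: "smooth_on U \<Phi>" "smooth_on B \<Psi>"
    and F: "\<And>u. u \<in> U \<Longrightarrow> ?F u = p\<^sub>0 + f_map \<alpha> \<beta> A E (\<Phi> u)"
    by (rule local_normal_form[OF V imm bl r CV JV C'(1) null line pV]; (assumption | rule that))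
  let ?N = "{p \<in> fst c0. snd c0 p \<in> U}"
  note c = coordinate_chart_compose[OF atlas c0(1) U(1,3) B(1) hom sm]
  have "f q = p\<^sub>0 + f_map \<alpha> \<beta> A E ((\<Phi> \<circ> snd c0) q)" if "q \<in> ?N" for q
    using F[of "snd c0 q"] that local_rep_chart[OF chart0, of q f] by simp
  then show ?thesis
    using adm c B(2) c0(2) U(2)
    by (intro exI[of _ I] exI[of _ \<alpha>] exI[of _ \<beta>] exI[of _ A] exI[of _ E] conjI exI[of _ "(?N, \<Phi> \<circ> snd c0)"]) auto
qed

theorem theorem5p2:
  shows
   "(\<forall>(X :: 'm topology) \<A> f C.
       affine_hypersphere X \<A> f C \<and> J_tangent \<A> f C \<and> null_direction \<A> f (D_minus f) \<longrightarrow>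
       (\<exists>p\<^sub>0. is_centre X f C p\<^sub>0 \<and>
         (\<forall>p\<in>topspace X. \<exists>I \<alpha> \<beta> A E. admissible I \<alpha> \<beta> A E \<and>
           (\<exists>c. coordinate_chart X \<A> c \<and> p \<in> fst c \<and> chart_range c \<subseteq> slab I \<and>
             (\<forall>q\<in>fst c. f q = p\<^sub>0 + f_map \<alpha> \<beta> A E (snd c q))))))
    \<and>
    (\<forall>I \<alpha> \<beta> A E. admissible I \<alpha> \<beta> A E \<longrightarrow>
       J_tangent_affine_hypersphere (top_of_set (slab I)) {(slab I, id)} (f_map \<alpha> \<beta> A E) \<and>
       null_direction {(slab I, id)} (f_map \<alpha> \<beta> A E) (D_minus (f_map \<alpha> \<beta> A E)))"
proof (intro conjI allI impI; (elim conjE)?)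
  fix X :: "'m topology" and \<A> f C
  assume hs: "affine_hypersphere X \<A> f C" and Jt: "J_tangent \<A> f C" and nd: "null_direction \<A> f (D_minus f)"
  show "\<exists>p\<^sub>0. is_centre X f C p\<^sub>0 \<and>
         (\<forall>p\<in>topspace X. \<exists>I \<alpha> \<beta> A E. admissible I \<alpha> \<beta> A E \<and>
           (\<exists>c. coordinate_chart X \<A> c \<and> p \<in> fst c \<and> chart_range c \<subseteq> slab I \<and>
             (\<forall>q\<in>fst c. f q = p\<^sub>0 + f_map \<alpha> \<beta> A E (snd c q))))"
  proof (cases "topspace X = {}")
    case True
    \<comment> \<open>on the empty manifold every point is a centre\<close>
    then show ?thesis by (auto simp: is_centre_def)
  next
    case False
    obtain r p\<^sub>0 where r: "r \<noteq> 0" and C: "\<And>p. p \<in> topspace X \<Longrightarrow> C p = r *\<^sub>R (f p - p\<^sub>0)"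
      using hypersphere_centre[OF hs Jt False] by blast
    then have "is_centre X f C p\<^sub>0" by (auto simp: is_centre_def)
    then show ?thesis
      using null_hypersphere_normal_form[OF hs Jt nd r C] by blast
  qed
qed (use parametrised_hypersphere in blast)+

end
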